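(* Let $n\ge 1$ be an integer, $r_0>0$, and let $u:B_{r_0}(0)\subseteq\mathbb{R}^2\to\mathbb{R}$ be a non-constant harmonic function with boundary value $u|_{S^1_{r_0}}\in L^1(S^1_{r_0})$ and $u(0)=0$. Assume that $u$ has only $n$ nodal curves in $B_{r_0}(0)$ and that they intersect at $0$. Then for every nodal curve $\gamma_k\subset Z(u)$, the curvature of $\gamma_k$ at $0$ satisfies $$\Big|\kappa(u)|_{\gamma_k}(0)\Big|\le \frac{4(n+1)}{n r_0},$$ and this inequality is sharp when $n$ is odd. Moreover, when $n$ is even, $$\Big|\kappa(u)|_{\gamma_k}(0)\Big|\le \frac{4(n+1)}{n r_0}\cos\frac{\pi}{2(n+1)},$$ and this inequality is also sharp.
   Context: $B_r(p)$ is the open disk of radius $r$ centered at $p$ in $\mathbb{R}^2\cong\mathbb{C}$, and $S^1_{r}=\partial B_r(0)$. The nodal set of $u$ is $Z(u)=\{u=0\}$. The nodal set of a non-constant harmonic function in the plane is a union of maximal (inextendible) real-analytic curves, called nodal curves; near a zero $p$ of vanishing order $n$, exactly $n$ nodal curves pass through $p$, with equally spaced tangent directions. The assumption "only $n$ nodal curves that intersect at $0$" means that $Z(u)\cap B_{r_0}(0)$ consists of exactly $n$ nodal curves, all of which pass through $0$ (so the vanishing order of $u$ at $0$ is $n$). "Boundary value $u|_{S^1_{r_0}}=g\in L^1$" means that $u$ is the Poisson integral of $g$ in $B_{r_0}(0)$. $\kappa(u)|_{\gamma_k}(p)$ denotes the curvature of the plane curve $\gamma_k$ at $p$. "Sharp"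 means that, for the given $n$ and $r_0$, the right-hand side cannot be replaced by any smaller constant valid for all such $u$ and all nodal curves. *)

theory Defs
  imports "HOL-Analysis.Analysis"
begin

text \<open>
  The plane is identified with the type \<^typ>\<open>complex\<close>. A function on an open set \<open>D\<close> is a total
  function of which only the values on \<open>D\<close> matter.
\<close>

definition harmonic_on :: "(complex \<Rightarrow> real) \<Rightarrow> complex set \<Rightarrow> bool" where
  "harmonic_on u D \<longleftrightarrow> open D \<and>
     (\<exists>ux uy uxx uxy uyx uyy.
        (\<forall>z\<in>D. (u has_derivative (\<lambda>h. ux z * Re h + uy z * Im h)) (at z)) \<and>
        (\<forall>z\<in>D. (ux has_derivative (\<lambda>h. uxx z * Re h + uxy z * Im h)) (at z)) \<and>
        (\<forall>z\<in>D. (uy has_derivative (\<lambda>h. uyx z * Re h + uyy z * Im h)) (at z)) \<and>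
        continuous_on D uxx \<and> continuous_on D uxy \<and>
        continuous_on D uyx \<and> continuous_on D uyy \<and>
        (\<forall>z\<in>D. uxx z + uyy z = 0))"

text \<open>
  Integrability of \<open>g\<close> on the circle is with respect to the angle, which is arc length up to the
  factor \<open>r\<close>.
\<close>

definition L1_circle :: "real \<Rightarrow> (complex \<Rightarrow> real) \<Rightarrow> bool" where
  "L1_circle r g \<longleftrightarrow>
     set_integrable lebesgue {0..2 * pi} (\<lambda>\<theta>. g (complex_of_real r * cis \<theta>))"

definition Poisson_integral :: "real \<Rightarrow> (complex \<Rightarrow> real) \<Rightarrow> complex \<Rightarrow> real" where
  "Poisson_integral r g z =
     (1 / (2 * pi)) *
     set_lebesgue_integral lebesgue {0..2 * pi}
       (\<lambda>\<theta>. (r\<^sup>2 - (cmod z)\<^sup>2) / (cmod (complex_of_real r * cis \<theta> - z))\<^sup>2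
             * g (complex_of_real r * cis \<theta>))"

definition has_L1_boundary_value :: "(complex \<Rightarrow> real) \<Rightarrow> real \<Rightarrow> bool" where
  "has_L1_boundary_value u r \<longleftrightarrow>
     (\<exists>g. L1_circle r g \<and> (\<forall>z\<in>ball 0 r. u z = Poisson_integral r g z))"

definition real_analytic_at :: "(real \<Rightarrow> complex) \<Rightarrow> real \<Rightarrow> bool" where
  "real_analytic_at \<gamma> t \<longleftrightarrow>
     (\<exists>(a :: nat \<Rightarrow> complex) \<epsilon>. \<epsilon> > 0 \<and>
        (\<forall>s. \<bar>s - t\<bar> < \<epsilon> \<longrightarrow> (\<lambda>k. (s - t) ^ k *\<^sub>R a k) sums \<gamma> s))"

definition velocity :: "(real \<Rightarrow> complex) \<Rightarrow> real \<Rightarrow> complex" where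
  "velocity \<gamma> t = vector_derivative \<gamma> (at t)"

definition acceleration :: "(real \<Rightarrow> complex) \<Rightarrow> real \<Rightarrow> complex" where
  "acceleration \<gamma> t = vector_derivative (velocity \<gamma>) (at t)"

text \<open>
  Parametrized curves have an open, possibly unbounded, interval \<open>I\<close> as parameter domain and are
  regular (nonvanishing velocity).
\<close>

definition regular_analytic_curve :: "real set \<Rightarrow> (real \<Rightarrow> complex) \<Rightarrow> bool" where
  "regular_analytic_curve I \<gamma> \<longleftrightarrow>
     I \<noteq> {} \<and> open I \<and> is_interval I \<and>
     (\<forall>t\<in>I. real_analytic_at \<gamma> t \<and> velocity \<gamma> t \<noteq> 0)"

text \<open>
  Signed curvature \<open>(x' y'' - y' x'') / (x'\<^sup>2 + y'\<^sup>2) powr (3/2)\<close>; its absolute value does not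
  depend on the regular parametrization.
\<close>

definition curvature :: "(real \<Rightarrow> complex) \<Rightarrow> real \<Rightarrow> real" where
  "curvature \<gamma> t =
     (Re (velocity \<gamma> t) * Im (acceleration \<gamma> t) - Im (velocity \<gamma> t) * Re (acceleration \<gamma> t))
       / cmod (velocity \<gamma> t) ^ 3"

definition nodal_set :: "(complex \<Rightarrow> real) \<Rightarrow> complex set \<Rightarrow> complex set" where
  "nodal_set u D = {z \<in> D. u z = 0}"

text \<open>
  Nodal curves are taken as point sets, so that reparametrizations are not counted as different
  curves: a nodal curve is the trace of a regular real-analytic curve in the nodal set which is
  not properly contained in the trace of another one.
\<close>

definition parametrizes :: "real set \<Rightarrow> (real \<Rightarrow> complex) \<Rightarrow> complex set \<Rightarrow> bool" where
  "parametrizes I \<gamma> C \<longleftrightarrow> regular_analytic_curve I \<gamma> \<and> \<gamma> ` I = C"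

definition nodal_curve :: "(complex \<Rightarrow> real) \<Rightarrow> complex set \<Rightarrow> complex set \<Rightarrow> bool" where
  "nodal_curve u D C \<longleftrightarrow>
     C \<subseteq> nodal_set u D \<and> (\<exists>I \<gamma>. parametrizes I \<gamma> C) \<and>
     (\<forall>C' J \<delta>. parametrizes J \<delta> C' \<and> C' \<subseteq> nodal_set u D \<and> C \<subseteq> C' \<longrightarrow> C' = C)"

definition only_nodal_curves_through_0 :: "(complex \<Rightarrow> real) \<Rightarrow> complex set \<Rightarrow> nat \<Rightarrow> bool" where
  "only_nodal_curves_through_0 u D n \<longleftrightarrow>
     finite {C. nodal_curve u D C} \<and> card {C. nodal_curve u D C} = n \<and>
     nodal_set u D = \<Union> {C. nodal_curve u D C} \<and>
     (\<forall>C. nodal_curve u D C \<longrightarrow> 0 \<in> C)"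

definition admissible :: "nat \<Rightarrow> real \<Rightarrow> (complex \<Rightarrow> real) \<Rightarrow> bool" where
  "admissible n r u \<longleftrightarrow>
     harmonic_on u (ball 0 r) \<and> \<not> u constant_on ball 0 r \<and>
     has_L1_boundary_value u r \<and> u 0 = 0 \<and>
     only_nodal_curves_through_0 u (ball 0 r) n"

definition nodal_curvature_bound :: "nat \<Rightarrow> real \<Rightarrow> real \<Rightarrow> bool" where
  "nodal_curvature_bound n r K \<longleftrightarrow>
     (\<forall>u C I \<gamma> t. admissible n r u \<and> nodal_curve u (ball 0 r) C \<and>
        parametrizes I \<gamma> C \<and> t \<in> I \<and> \<gamma> t = 0 \<longrightarrow> \<bar>curvature \<gamma> t\<bar> \<le> K)"

definition sharp_nodal_curvature_bound :: "nat \<Rightarrow> real \<Rightarrow> real \<Rightarrow> bool" where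
  "sharp_nodal_curvature_bound n r K \<longleftrightarrow>
     nodal_curvature_bound n r K \<and> (\<forall>K'<K. \<not> nodal_curvature_bound n r K')"

end

theory Submission
  imports Defs "HOL-Complex_Analysis.Complex_Analysis"
begin

text \<open>
  Upper bound. Write \<open>u = Re f\<close> with \<open>f = z\<^sup>n h\<close>. The only critical point of \<open>f\<close> on the nodal set is
  \<open>0\<close>, since otherwise nodal arcs would enclose a region on which \<open>u\<close> vanishes; hence \<open>f = \<phi>\<^sup>n\<close> with \<open>\<phi>\<close>
  locally injective on the nodal set, the nodal curves are the preimages of \<open>n\<close> lines under \<open>\<phi>\<close>, and
  their \<open>2 n\<close> ends run to the boundary circle. So the boundary value \<open>g\<close> cannot show \<open>2 n + 2\<close> alternating
  signs: up to a global sign it has the sign pattern of \<open>\<Prod>j<2n. sin ((t - t\<^sub>j) / 2)\<close> for suitable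
  angles. Integrating \<open>g\<close> against this product times \<open>1 + cos\<close> of a shifted angle bounds the Fourier
  coefficient of order \<open>n + 1\<close> in terms of the one of order \<open>n\<close>, that is, \<open>h'(0)\<close> in terms of \<open>h(0)\<close>,
  which is the curvature; what is left is an extremal problem for sums of sines.

  Sharpness. The functions \<open>z\<^sup>n (1 + z + \<i>\<tau> (1 - z)) / (1 - z)\<^bsup>2n+1\<^esup>\<close>, with \<open>\<tau> = 0\<close> for odd \<open>n\<close> and
  \<open>\<tau> = tan (\<pi> / (2 n + 2))\<close> for even \<open>n\<close>, attain the bound on the unit disc. On their nodal set the
  argument is strictly increasing along circles around \<open>0\<close>, so each nodal curve is parametrized by the
  signed radius; dilating them slightly makes the boundary values continuous.
\<close>

text \<open>The constants come from \<open>2 / (n * r) * (\<bar>\<Sum>j<2*n. sin (\<tau> j)\<bar> +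
  2 * \<bar>sin ((\<Sum>j<2*n. \<tau> j) / 2)\<bar>)\<close>, where the \<open>2 * n\<close> angles
  \<open>\<tau> j\<close> are the boundary sign changes measured from the tangent of the nodal
  curve. Bounding every sine by one gives \<open>2 * n + 2\<close>. Equality would put all
  \<open>\<tau> j\<close> at pi / 2, or all at - pi / 2, modulo 2 pi; half their sum is then n pi /
  2 modulo pi, so the last sine is \<plusminus>1 for odd \<open>n\<close> but 0 for even
  \<open>n\<close>. This conflict produces the cosine factor. In both cases the maximum is attained
  with all sign changes at one boundary point, which is why the extremal functions have their only
  pole there while their real part vanishes on the rest of the unit circle.

  The boundary value is merely integrable, so a pointwise sign of it says nothing by itself. It is
  recovered, for almost every angle, as the sign of \<open>u\<close> on the last piece of the
  radius, where it can be confronted with the nodal curves.\<close>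

section \<open>Extremal sums of sines and cosines\<close>

text \<open>The cosine is not concave on all of [0, pi], so the difference \<open>h\<close> to the
  tangent line is studied directly. Its derivative sin y - sin t makes it fall up to t, rise up to
  pi - t and fall again; the minimum is h t = 0 or h pi, and h pi \<ge> 0 is where t \<le> pi / 6
  enters.\<close>

lemma cos_le_tangent_line:
  fixes t x :: real
  assumes t: "0 < t" "t \<le> pi / 6" and x: "0 \<le> x" "x \<le> pi"
  shows "cos x \<le> cos t - sin t * (x - t)"
proof -
  define h where "h = (\<lambda>x. cos t - sin t * (x - t) - cos x)"
  have der: "(h has_real_derivative (sin y - sin t)) (at y)" for y
    unfolding h_def by (auto intro!: derivative_eq_intros)
  have ht: "h t = 0" by (simp add: h_def)
  have pi: "pi < 3.2" "3 < pi" using pi_approx by auto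
  have tp: "t < pi / 2" using t pi by simp
  consider "x \<le> t" | "t \<le> x" "x \<le> pi - t" | "pi - t \<le> x" by linarith
  then have "0 \<le> h x"
  proof cases
    case 1
    have "h t \<le> h x"
    proof (rule DERIV_nonpos_imp_nonincreasing[OF 1])
      fix y assume "x \<le> y" "y \<le> t"
      then have "sin y \<le> sin t" using x tp by (intro sin_monotone_2pi_le) auto
      then show "\<exists>z. (h has_real_derivative z) (at y) \<and> z \<le> 0" using der[of y] by force
    qed
    then show ?thesis using ht by simp
  next
    case 2
    have "h t \<le> h x"
    proof (rule DERIV_nonneg_imp_nondecreasing[OF 2(1)])
      fix y assume y: "t \<le> y" "y \<le> x"
      have "sin t \<le> sin y"
      proof (cases "y \<le> pi / 2")
        case True then show ?thesis using y tp t by (intro sin_monotone_2pi_le) auto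
      next
        case False
        have "sin t \<le> sin (pi - y)" using y tp t 2 False by (intro sin_monotone_2pi_le) auto
        then show ?thesis by simp
      qed
      then show "\<exists>z. (h has_real_derivative z) (at y) \<and> 0 \<le> z" using der[of y] by force
    qed
    then show ?thesis using ht by simp
  next
    case 3
    have "h pi \<le> h x"
    proof (rule DERIV_nonpos_imp_nonincreasing[OF x(2)])
      fix y assume y: "x \<le> y" "y \<le> pi"
      have "sin (pi - y) \<le> sin t" using y tp t 3 by (intro sin_monotone_2pi_le) auto
      then show "\<exists>z. (h has_real_derivative z) (at y) \<and> z \<le> 0" using der[of y] by force
    qed
    moreover have "0 \<le> h pi"
    proof -
      have "sin t \<le> sin (pi/6)" using t by (intro sin_monotone_2pi_le) auto
      then have s: "sin t \<le> 1/2" by (simp add: sin_30)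
      have "sin t * (pi - t) \<le> 1/2 * (pi - t)" using s t pi by (intro mult_right_mono) auto
      then have "sin t * (pi - t) \<le> 3/2 - t/2 + 0.1" using pi by (simp add: field_simps)
      moreover have "cos t \<ge> 0.6"
      proof -
        have "cos (pi/6) \<le> cos t" using t pi by (intro cos_monotone_0_pi_le) auto
        moreover have "sqrt 3 \<ge> 1.2" by (rule real_le_rsqrt) (simp add: power2_eq_square)
        ultimately show ?thesis by (simp add: cos_30)
      qed
      ultimately show ?thesis using t by (simp add: h_def)
    qed
    ultimately show ?thesis by simp
  qed
  then show ?thesis by (simp add: h_def)
qed

text \<open>Jensen's inequality with the tangent line at pi / card I in place of concavity. Reducing
  the angles modulo 2 pi to [-pi, pi] keeps their total an odd multiple of pi, so the absolute
  values add up to at least pi; the tangent line has negative slope, so a larger total only lowers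
  the bound. Six or more terms make the point of tangency at most pi / 6.\<close>

lemma sum_cos_le_of_odd_pi_sum:
  fixes y :: "'a \<Rightarrow> real"
  assumes "finite I" and N: "card I \<ge> 6" and k: "(\<Sum>i\<in>I. y i) = (2 * of_int k + 1) * pi"
  shows "(\<Sum>i\<in>I. cos (y i)) \<le> card I * cos (pi / card I)"
proof -
  define N where "N = real (card I)"
  define t where "t = pi / N"
  have N6: "N \<ge> 6" using N by (simp add: N_def)
  have t: "0 < t" "t \<le> pi / 6" using N6 by (auto simp: t_def field_simps)
  define m where "m = (\<lambda>i. round (y i / (2 * pi)))"
  define z where "z = (\<lambda>i. y i - 2 * pi * of_int (m i))"
  have cosz: "cos (z i) = cos (y i)" for i
    unfolding z_def using cos_int_2pin[of "m i"] sin_int_2pin[of "m i"] by (simp add: cos_diff)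
  have zb: "\<bar>z i\<bar> \<le> pi" for i
  proof -
    have "\<bar>of_int (m i) - y i / (2 * pi)\<bar> \<le> 1 / 2" unfolding m_def by (rule of_int_round_abs_le)
    then have "2 * pi * \<bar>of_int (m i) - y i / (2 * pi)\<bar> \<le> pi" using mult_left_mono[of _ "1/2" "2*pi"] by simp
    moreover have "z i = (2 * pi) * - (of_int (m i) - y i / (2 * pi))"
      unfolding z_def by (simp add: field_simps)
    then have "2 * pi * \<bar>of_int (m i) - y i / (2 * pi)\<bar> = \<bar>z i\<bar>"
      by (simp only: abs_mult abs_minus_cancel) simp
    ultimately show ?thesis by simp
  qed
  have "(\<Sum>i\<in>I. z i) = (2 * of_int (k - (\<Sum>i\<in>I. m i)) + 1) * pi"
    unfolding z_def by (simp add: sum_subtractf k sum_distrib_left algebra_simps)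
  moreover have "pi \<le> \<bar>(2 * of_int j + 1) * pi\<bar>" for j :: int
  proof -
    have "1 \<le> \<bar>2 * j + 1\<bar>" by presburger
    then have "1 \<le> \<bar>2 * real_of_int j + 1\<bar>" by linarith
    then show ?thesis by (simp add: abs_mult)
  qed
  ultimately have "pi \<le> \<bar>\<Sum>i\<in>I. z i\<bar>" by metis
  also have "\<dots> \<le> (\<Sum>i\<in>I. \<bar>z i\<bar>)" by (rule sum_abs)
  finally have sz: "N * t \<le> (\<Sum>i\<in>I. \<bar>z i\<bar>)" using N6 by (simp add: t_def)
  have "(\<Sum>i\<in>I. cos (y i)) \<le> (\<Sum>i\<in>I. cos t - sin t * (\<bar>z i\<bar> - t))"
  proof (rule sum_mono)
    fix i
    have "cos (y i) = cos \<bar>z i\<bar>" by (simp add: cosz)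
    also have "\<dots> \<le> cos t - sin t * (\<bar>z i\<bar> - t)" by (rule cos_le_tangent_line) (use t zb in auto)
    finally show "cos (y i) \<le> cos t - sin t * (\<bar>z i\<bar> - t)" .
  qed
  also have "\<dots> = N * cos t - sin t * ((\<Sum>i\<in>I. \<bar>z i\<bar>) - N * t)"
    by (simp add: sum_subtractf sum_distrib_left[symmetric] N_def)
  also have "\<dots> \<le> N * cos t"
    using sz t sin_gt_zero[of t] pi_gt_zero by (simp add: zero_le_mult_iff)
  finally show ?thesis by (simp add: N_def t_def)
qed

text \<open>The left side is a sum of 2 n + 2 cosines: of the angles
  \<open>\<tau> j - pi / 2\<close> and, counted twice, of an angle \<open>\<psi>\<close> that
  completes the total to \<plusminus>pi. For n = 2 m the shift n pi / 2 is a multiple of pi, so cos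
  \<psi> is the sine of the half sum up to sign.\<close>

lemma sum_sin_plus_sin_half_sum_le:
  fixes \<tau> :: "nat \<Rightarrow> real"
  assumes n: "even n" "n \<ge> 2"
  shows "\<bar>\<Sum>j<2*n. sin (\<tau> j)\<bar> + 2 * \<bar>sin ((\<Sum>j<2*n. \<tau> j) / 2)\<bar> \<le> (2 * real n + 2) * cos (pi / (2 * real n + 2))"
proof -
  obtain m where m: "n = 2 * m" using n by (elim evenE)
  \<comment> \<open>Both values of \<open>s\<close>, applied to \<open>\<tau>\<close> and to its
    negative, cover the four sign combinations hidden in the two absolute values.\<close>
  have main: "(\<Sum>j<2*n. sin (x j)) + 2 * (s * (-1) ^ m) * sin ((\<Sum>j<2*n. x j) / 2) \<le> (2 * real n + 2) * cos (pi / (2 * real n + 2))"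
    if s: "s = 1 \<or> s = -1" for s :: real and x :: "nat \<Rightarrow> real"
  proof -
    define X where "X = (\<Sum>j<2*n. x j)"
    define \<psi> where "\<psi> = s * pi / 2 - (X - n * pi) / 2"
    define y where "y = (\<lambda>j. if j < 2 * n then x j - pi / 2 else \<psi>)"
    have split: "(\<Sum>j<2*n+2. F (y j)) = (\<Sum>j<2*n. F (x j - pi / 2)) + 2 * F \<psi>" for F :: "real \<Rightarrow> real"
      by (simp add: y_def)
    have "cos \<psi> = s * sin ((X - n * pi) / 2)"
      using s by (auto simp: \<psi>_def cos_diff cos_add)
    also have "(X - n * pi) / 2 = X / 2 - m * pi" by (simp add: m field_simps)
    also have "sin (X / 2 - m * pi) = (-1)^m * sin (X / 2)"
      by (simp add: sin_diff)
    finally have c: "cos \<psi> = s * (-1)^m * sin (X / 2)" by simp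
    have "(\<Sum>j<2*n+2. y j) = X - n * pi + 2 * \<psi>"
      using split[of "\<lambda>x. x"] by (simp add: sum_subtractf X_def)
    also have "\<dots> = s * pi" by (simp add: \<psi>_def field_simps)
    finally have "(\<Sum>j<2*n+2. y j) = (2 * of_int (if s = 1 then 0 else -1) + 1) * pi"
      using s by auto
    from sum_cos_le_of_odd_pi_sum[OF _ _ this] n
    have "(\<Sum>j<2*n+2. cos (y j)) \<le> (2 * real n + 2) * cos (pi / (2 * real n + 2))" by (simp add: algebra_simps)
    moreover have "cos (x j - pi / 2) = sin (x j)" for j by (simp add: cos_diff)
    ultimately show ?thesis using split[of cos] c unfolding X_def[symmetric]
      by (simp add: algebra_simps)
  qed
  have eq: "\<bar>a\<bar> + 2 * \<bar>b\<bar> \<le> B" if "\<And>s. s = 1 \<or> s = -1 \<Longrightarrow> a + 2 * s * b \<le> B"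
      "\<And>s. s = 1 \<or> s = -1 \<Longrightarrow> - a + 2 * s * b \<le> B" for a b B :: real
    using that(1)[of 1] that(1)[of "-1"] that(2)[of 1] that(2)[of "-1"] by linarith
  show ?thesis
  proof (rule eq)
    fix s :: real assume s: "s = 1 \<or> s = -1"
    show "(\<Sum>j<2*n. sin (\<tau> j)) + 2 * s * sin ((\<Sum>j<2*n. \<tau> j) / 2) \<le> (2 * real n + 2) * cos (pi / (2 * real n + 2))"
      using main[of "s * (-1) ^ m" \<tau>] s by (cases "even m") auto
    show "- (\<Sum>j<2*n. sin (\<tau> j)) + 2 * s * sin ((\<Sum>j<2*n. \<tau> j) / 2) \<le> (2 * real n + 2) * cos (pi / (2 * real n + 2))"
      using main[of "- (s * (-1) ^ m)" "\<lambda>j. - \<tau> j"] s by (cases "even m") (auto simp: sum_negf)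
  qed
qed

section \<open>Sign patterns of functions with few sign changes\<close>

definition alternating :: "(real \<Rightarrow> real) \<Rightarrow> real set \<Rightarrow> real \<Rightarrow> nat \<Rightarrow> bool" where
  "alternating g E s N \<longleftrightarrow> (\<exists>\<theta>. (\<forall>i<N. \<theta> i < \<theta> (Suc i)) \<and> (\<forall>i\<le>N. \<theta> i \<in> E \<and> 0 < s * (-1) ^ i * g (\<theta> i)))"

lemma alternating_Cons:
  assumes alt: "(\<forall>i<N. \<theta> i < \<theta> (Suc i)) \<and> (\<forall>i\<le>N. \<theta> i \<in> E' \<and> 0 < - s * (-1) ^ i * g (\<theta> i))"
    and a: "a < \<theta> 0" "a \<in> E" "0 < s * g a" and E': "E' \<subseteq> E"
  shows "alternating g E s (Suc N)"
proof -
  define \<eta> where "\<eta> = (\<lambda>i. if i = 0 then a else \<theta> (i - 1))"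
  have "\<eta> i < \<eta> (Suc i)" if "i < Suc N" for i
    using that alt a by (cases i) (auto simp: \<eta>_def)
  moreover have "\<eta> i \<in> E \<and> 0 < s * (-1) ^ i * g (\<eta> i)" if "i \<le> Suc N" for i
    using that alt a E' by (cases i) (auto simp: \<eta>_def)
  ultimately show ?thesis unfolding alternating_def by blast
qed

text \<open>Induction on N. The first zero \<open>t0\<close> is the infimum of the points where s g
  is positive: before it the sign s does not occur, and after it g cannot alternate N times starting
  with -s, since a point of sign s close to \<open>t0\<close> could be put in front. Half-angle
  sines serve as factors because on [0, 2 pi] each changes sign only at its own zero.\<close>

lemma sign_pattern_product:
  assumes "E \<subseteq> {L..2*pi}" "0 \<le> L" "L \<le> 2 * pi" "s = 1 \<or> s = -1" "\<not> alternating g E s N"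
  shows "\<exists>t. (\<forall>i<N. t i \<in> {L..2*pi}) \<and>
     (\<forall>\<theta>\<in>E. 0 \<le> - s * (-1) ^ N * g \<theta> * (\<Prod>i<N. sin ((\<theta> - t i) / 2)))"
  using assms
proof (induction N arbitrary: E L s)
  case 0
  have "s * g \<theta> \<le> 0" if "\<theta> \<in> E" for \<theta>
    using 0(5) that unfolding alternating_def by (force simp: not_less)
  then show ?case by auto
next
  case (Suc N)
  have sin_np: "sin ((\<theta> - t) / 2) \<le> 0" if "\<theta> \<le> t" "0 \<le> \<theta>" "t \<le> 2 * pi" for \<theta> t :: real
  proof -
    have "0 \<le> sin ((t - \<theta>) / 2)" using that by (intro sin_ge_zero) auto
    moreover have "sin ((\<theta> - t) / 2) = - sin ((t - \<theta>) / 2)"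
      using sin_minus[of "(t - \<theta>) / 2"] by (simp add: minus_divide_left)
    ultimately show ?thesis by simp
  qed
  have prod_np: "0 \<le> (-1) ^ k * (\<Prod>i<k. sin ((\<theta> - t i) / 2))"
    if "0 \<le> \<theta>" "\<And>i. i < k \<Longrightarrow> \<theta> \<le> t i \<and> t i \<le> 2 * pi" for k \<theta> and t :: "nat \<Rightarrow> real"
  proof -
    have "(-1) ^ k * (\<Prod>i<k. sin ((\<theta> - t i) / 2)) = (\<Prod>i<k. - sin ((\<theta> - t i) / 2))"
      by (simp add: prod_uminus)
    also have "\<dots> \<ge> 0" using that sin_np by (intro prod_nonneg) auto
    finally show ?thesis .
  qed
  define A where "A = {\<theta>\<in>E. 0 < s * g \<theta>}"
  show ?case
  proof (cases "A = {}")
    case True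
    \<comment> \<open>With no point of sign s left, all remaining zeros go to the right end 2 pi,
      where no factor changes sign any more.\<close>
    have "0 \<le> - s * (-1) ^ Suc N * g \<theta> * (\<Prod>i<Suc N. sin ((\<theta> - 2 * pi) / 2))" if "\<theta> \<in> E" for \<theta>
    proof -
      have "0 \<le> - (s * g \<theta>)" using True that by (auto simp: A_def not_less)
      moreover have "0 \<le> (-1) ^ Suc N * (\<Prod>i<Suc N. sin ((\<theta> - 2 * pi) / 2))"
        by (rule prod_np) (use that Suc.prems in auto)
      ultimately have "0 \<le> - (s * g \<theta>) * ((-1) ^ Suc N * (\<Prod>i<Suc N. sin ((\<theta> - 2 * pi) / 2)))"
        by (rule mult_nonneg_nonneg)
      then show ?thesis by (simp add: mult_ac)
    qed
    then show ?thesis using Suc.prems by (intro exI[of _ "\<lambda>_. 2 * pi"]) auto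
  next
    case False
    define t0 where "t0 = Inf A"
    have bdd: "bdd_below A" using Suc.prems(1) by (auto simp: A_def intro!: bdd_belowI[of _ L])
    have t0: "L \<le> t0" "t0 \<le> 2 * pi"
    proof -
      show "L \<le> t0" unfolding t0_def by (rule cInf_greatest[OF False]) (use Suc.prems(1) in \<open>auto simp: A_def\<close>)
      obtain a where a: "a \<in> A" using False by blast
      have "t0 \<le> a" unfolding t0_def by (rule cInf_lower[OF a bdd])
      moreover have "a \<le> 2 * pi" using a Suc.prems(1) by (auto simp: A_def)
      ultimately show "t0 \<le> 2 * pi" by simp
    qed
    define E' where "E' = E \<inter> {t0<..}"
    have "\<not> alternating g E' (-s) N"
    proof
      assume "alternating g E' (-s) N"
      then obtain \<theta> where th: "(\<forall>i<N. \<theta> i < \<theta> (Suc i)) \<and> (\<forall>i\<le>N. \<theta> i \<in> E' \<and> 0 < - s * (-1) ^ i * g (\<theta> i))"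
        unfolding alternating_def by blast
      then have "t0 < \<theta> 0" by (auto simp: E'_def)
      then obtain a where "a \<in> A" "a < \<theta> 0" using False bdd unfolding t0_def by (auto simp: cInf_less_iff)
      then have "alternating g E s (Suc N)" by (intro alternating_Cons[OF th]) (auto simp: A_def E'_def)
      then show False using Suc.prems by simp
    qed
    then obtain t where t: "\<And>i. i < N \<Longrightarrow> t i \<in> {t0..2*pi}"
      "\<And>\<theta>. \<theta> \<in> E' \<Longrightarrow> 0 \<le> s * (-1) ^ N * g \<theta> * (\<Prod>i<N. sin ((\<theta> - t i) / 2))"
    proof -
      have "E' \<subseteq> {t0..2*pi}" using Suc.prems(1) by (auto simp: E'_def)
      moreover have "0 \<le> t0" using t0 Suc.prems by simp
      moreover have "-s = 1 \<or> -s = -1" using Suc.prems(4) by auto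
      ultimately show ?thesis using Suc.IH[of E' t0 "-s"] t0 \<open>\<not> alternating g E' (-s) N\<close> that by fastforce
    qed
    define t' where "t' = (\<lambda>i. if i = 0 then t0 else t (i - 1))"
    have t': "t0 \<le> t' i \<and> t' i \<le> 2 * pi" if "i < Suc N" for i
      using that t(1) t0 by (cases i) (auto simp: t'_def)
    have "0 \<le> - s * (-1) ^ Suc N * g \<theta> * (\<Prod>i<Suc N. sin ((\<theta> - t' i) / 2))" if th: "\<theta> \<in> E" for \<theta>
    proof (cases "\<theta> < t0")
      case True
      then have "\<theta> \<notin> A" using bdd unfolding t0_def by (meson cInf_lower not_less)
      then have "0 \<le> - (s * g \<theta>)" using th by (auto simp: A_def)
      moreover have "0 \<le> (-1) ^ Suc N * (\<Prod>i<Suc N. sin ((\<theta> - t' i) / 2))"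
        by (rule prod_np) (use th Suc.prems True t' in \<open>force+\<close>)
      ultimately have "0 \<le> - (s * g \<theta>) * ((-1) ^ Suc N * (\<Prod>i<Suc N. sin ((\<theta> - t' i) / 2)))"
        by (rule mult_nonneg_nonneg)
      then show ?thesis by (simp add: mult_ac)
    next
      case False
      show ?thesis
      proof (cases "\<theta> = t0")
        case True then show ?thesis by (subst prod.lessThan_Suc_shift) (simp add: t'_def)
      next
        case ne: False
        have 1: "0 \<le> s * (-1) ^ N * g \<theta> * (\<Prod>i<N. sin ((\<theta> - t i) / 2))"
          by (rule t(2)) (use False ne th in \<open>auto simp: E'_def\<close>)
        have "0 \<le> sin ((\<theta> - t0) / 2)" using False th Suc.prems t0 by (intro sin_ge_zero) force+
        with 1 have "0 \<le> s * (-1) ^ N * g \<theta> * (\<Prod>i<N. sin ((\<theta> - t i) / 2)) * sin ((\<theta> - t0) / 2)"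
          by (rule mult_nonneg_nonneg)
        moreover have "(\<Prod>i<Suc N. sin ((\<theta> - t' i) / 2)) = sin ((\<theta> - t0) / 2) * (\<Prod>i<N. sin ((\<theta> - t i) / 2))"
          by (subst prod.lessThan_Suc_shift) (simp add: t'_def)
        ultimately show ?thesis by (simp add: mult_ac)
      qed
    qed
    then show ?thesis using t' t0 by (intro exI[of _ t']) (auto intro: order_trans)
  qed
qed

text \<open>If 2 n alternations were possible with both starting signs, the sequence that begins
  later could be prolonged by the first point of the other, giving 2 n + 1. An even number of
  factors is wanted because only then is the product of half-angle sines a 2 pi-periodic
  trigonometric polynomial.\<close>

lemma sign_pattern_even:
  assumes E: "E \<subseteq> {0..2*pi}" and na: "\<not> alternating g E 1 (2*n+1)" "\<not> alternating g E (-1) (2*n+1)"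
  shows "\<exists>\<sigma> t. (\<sigma> = 1 \<or> \<sigma> = -1) \<and> (\<forall>\<theta>\<in>E. 0 \<le> \<sigma> * g \<theta> * (\<Prod>i<2*n. sin ((\<theta> - t i) / 2)))"
proof -
  have "\<exists>s. (s = 1 \<or> s = -1) \<and> \<not> alternating g E s (2*n)"
  proof (rule ccontr)
    assume "\<not> ?thesis"
    then have a: "alternating g E 1 (2*n)" "alternating g E (-1) (2*n)" by auto
    obtain \<theta> where th: "(\<forall>i<2*n. \<theta> i < \<theta> (Suc i)) \<and> (\<forall>i\<le>2*n. \<theta> i \<in> E \<and> 0 < 1 * (-1) ^ i * g (\<theta> i))"
      using a(1) unfolding alternating_def by blast
    obtain \<eta> where et: "(\<forall>i<2*n. \<eta> i < \<eta> (Suc i)) \<and> (\<forall>i\<le>2*n. \<eta> i \<in> E \<and> 0 < -1 * (-1) ^ i * g (\<eta> i))"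
      using a(2) unfolding alternating_def by blast
    have t0: "\<theta> 0 \<in> E" "0 < g (\<theta> 0)" using th by (auto dest: spec[of _ 0])
    have e0: "\<eta> 0 \<in> E" "0 < - g (\<eta> 0)" using et by (auto dest: spec[of _ 0])
    have "\<theta> 0 \<noteq> \<eta> 0" using t0 e0 by auto
    then consider "\<theta> 0 < \<eta> 0" | "\<eta> 0 < \<theta> 0" by linarith
    then show False
    proof cases
      case 1
      have "alternating g E 1 (Suc (2*n))" by (rule alternating_Cons[where a="\<theta> 0" and \<theta>=\<eta> and E'=E]) (use 1 et t0 in auto)
      then show False using na by simp
    next
      case 2
      have "alternating g E (-1) (Suc (2*n))" by (rule alternating_Cons[where a="\<eta> 0" and \<theta>=\<theta> and E'=E]) (use 2 th e0 in auto)
      then show False using na by simp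
    qed
  qed
  then obtain s where s: "s = 1 \<or> s = -1" "\<not> alternating g E s (2*n)" by blast
  from sign_pattern_product[OF E _ _ s] obtain t where
    "\<forall>\<theta>\<in>E. 0 \<le> - s * (-1) ^ (2*n) * g \<theta> * (\<Prod>i<2*n. sin ((\<theta> - t i) / 2))" by auto
  then show ?thesis using s by (intro exI[of _ "-s"] exI[of _ t]) auto
qed


subsection \<open>Moments of a function with few sign changes\<close>

text \<open>These two coefficients meet the moments of order n + 1 and n later on. For roots on the
  unit circle the inverses are conjugates, which produces the sum of
  \<open>cis (- t j)\<close>.\<close>

lemma coeff_0_1_prod_linear:
  fixes p :: "nat \<Rightarrow> complex"
  assumes "\<And>j. p j \<noteq> 0"
  shows "coeff (\<Prod>j<N. [:- p j, 1:]) 0 = (\<Prod>j<N. - p j) \<and>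
    coeff (\<Prod>j<N. [:- p j, 1:]) 1 = - (\<Prod>j<N. - p j) * (\<Sum>j<N. inverse (p j))"
proof (induction N)
  case (Suc N)
  define q where "q = (\<Prod>j<N. [:- p j, 1:])"
  have "(\<Prod>j<Suc N. [:- p j, 1:]) = pCons 0 q + smult (- p N) q"
    by (simp add: q_def mult.commute)
  then show ?case using Suc assms[of N] by (simp add: q_def field_simps)
qed auto

lemma prod_linear_monic:
  fixes p :: "nat \<Rightarrow> complex"
  shows "degree (\<Prod>j<N. [:- p j, 1:]) = N \<and> coeff (\<Prod>j<N. [:- p j, 1:]) N = 1"
proof -
  have "degree (\<Prod>j<N. [:- p j, 1:]) = N" by (subst degree_prod_eq_sum_degree) auto
  moreover have "lead_coeff (\<Prod>j<N. [:- p j, 1:]) = 1" by (simp add: lead_coeff_prod)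
  ultimately show ?thesis by simp
qed

lemma sin_half_diff_cis:
  "complex_of_real (sin ((\<theta> - t) / 2)) = cis (- \<theta> / 2) * cis (- t / 2) * (cis \<theta> - cis t) / (2 * \<i>)"
proof -
  have "cis (- \<theta> / 2) * cis (- t / 2) * (cis \<theta> - cis t) = cis ((\<theta> - t) / 2) - cis (- ((\<theta> - t) / 2))"
  proof -
    have "- \<theta> / 2 + - t / 2 + \<theta> = (\<theta> - t) / 2" "- \<theta> / 2 + - t / 2 + t = - ((\<theta> - t) / 2)"
      by (simp_all add: field_simps)
    then show ?thesis by (simp only: right_diff_distrib cis_mult)
  qed
  also have "\<dots> = 2 * \<i> * sin ((\<theta> - t) / 2)" by (simp only: complex_eq_iff) simp
  finally show ?thesis by simp
qed

text \<open>Writing each sine through \<open>cis\<close> turns the product, up to a constant, into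
  cis (- n \<theta>) times the monic polynomial with roots \<open>cis (t j)\<close>, evaluated at
  cis \<theta>. Its coefficients are thus the Fourier coefficients of a trigonometric polynomial of
  degree n.\<close>

lemma prod_sin_half_diff:
  fixes t :: "nat \<Rightarrow> real" and n :: nat and \<theta> :: real
  defines "Q \<equiv> \<Prod>j<2*n. [:- cis (t j), 1:]" and "S \<equiv> \<Sum>j<2*n. t j"
  shows "complex_of_real (\<Prod>j<2*n. sin ((\<theta> - t j) / 2)) =
    (-1/4) ^ n * cis (- S / 2) * (\<Sum>k\<le>2*n. coeff Q k * cis ((real k - real n) * \<theta>))"
proof -
  have "complex_of_real (\<Prod>j<2*n. sin ((\<theta> - t j) / 2)) =
      (\<Prod>j<2*n. (cis (- \<theta> / 2) / (2*\<i>)) * cis (- t j / 2) * (cis \<theta> - cis (t j)))"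
    unfolding of_real_prod sin_half_diff_cis by (rule prod.cong) (simp_all add: mult_ac)
  also have "\<dots> = (cis (- \<theta> / 2) / (2*\<i>)) ^ (2*n) * (\<Prod>j<2*n. cis (- t j / 2)) * (\<Prod>j<2*n. cis \<theta> - cis (t j))"
    unfolding prod.distrib by simp
  also have "(\<Prod>j<m. cis (- t j / 2)) = cis (- (\<Sum>j<m. t j) / 2)" for m
    by (induction m) (simp_all add: cis_mult field_simps)
  also have "(\<Prod>j<2*n. cis \<theta> - cis (t j)) = poly Q (cis \<theta>)" by (simp add: Q_def poly_prod)
  also have "poly Q (cis \<theta>) = (\<Sum>k\<le>2*n. coeff Q k * cis (real k * \<theta>))"
    using prod_linear_monic[where N="2*n" and p="\<lambda>j. cis (t j)"] by (simp add: poly_altdef Q_def Complex.DeMoivre)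
  also have "(cis (- \<theta> / 2) / (2*\<i>)) ^ (2*n) = (-1/4) ^ n * cis (- real n * \<theta>)"
  proof -
    have "(cis (- \<theta> / 2) / (2*\<i>)) ^ 2 = (-1/4) * cis (- \<theta>)"
      using cis_mult[of "- \<theta> / 2" "- \<theta> / 2"] by (simp add: power_divide power2_eq_square mult.left_commute mult.assoc)
    then show ?thesis unfolding power_mult by (simp only: power_mult_distrib Complex.DeMoivre) simp
  qed
  finally have "complex_of_real (\<Prod>j<2*n. sin ((\<theta> - t j) / 2)) =
    (\<Sum>k\<le>2*n. (-1/4) ^ n * cis (- S / 2) * (coeff Q k * (cis (- real n * \<theta>) * cis (real k * \<theta>))))"
    by (simp add: S_def sum_distrib_left mult_ac)
  also have "\<dots> = (\<Sum>k\<le>2*n. (-1/4) ^ n * cis (- S / 2) * (coeff Q k * cis ((real k - real n) * \<theta>)))"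
    by (simp add: cis_mult algebra_simps)
  finally show ?thesis by (simp only: sum_distrib_left)
qed

text \<open>The product of g with \<open>P\<close> has one sign, so the modulus of its first Fourier
  coefficient is at most that of its integral. As the moments of order below n vanish, the integral
  sees only the orders n and -n, that is, the two end coefficients of \<open>Q\<close>, and the
  first Fourier coefficient only the orders n + 1 and n, that is, the coefficients 0 and 1. The
  common factor (1/4) ^ n cancels.\<close>

lemma moment_inequality:
  fixes g :: "real \<Rightarrow> real" and t :: "nat \<Rightarrow> real" and A :: "real set"
  assumes g: "set_integrable lebesgue A g"
    and M: "\<And>k::int. M k = (LINT \<theta>:A|lebesgue. complex_of_real (g \<theta>) * cis (- of_int k * \<theta>))"
    and M0: "\<And>k::int. \<bar>k\<bar> < int n \<Longrightarrow> M k = 0" and n: "n \<ge> 1"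
    and \<sigma>: "\<sigma> = 1 \<or> \<sigma> = -1"
    and pos: "AE \<theta> in lebesgue. \<theta> \<in> A \<longrightarrow> 0 \<le> \<sigma> * g \<theta> * (\<Prod>j<2*n. sin ((\<theta> - t j) / 2))"
  shows "cmod (M (int n + 1) - (\<Sum>j<2*n. cis (- t j)) * M (int n)) \<le> 2 * \<bar>Re (cis ((\<Sum>j<2*n. t j) / 2) * M (int n))\<bar>"
proof -
  define S where "S = (\<Sum>j<2*n. t j)"
  define Q where "Q = (\<Prod>j<2*n. [:- cis (t j), 1:])"
  define P where "P = (\<lambda>\<theta>. \<Prod>j<2*n. sin ((\<theta> - t j) / 2))"
  define K where "K = ((-1/4) ^ n * cis (- S / 2) :: complex)"
  have gc: "set_integrable lebesgue A (\<lambda>\<theta>. complex_of_real (g \<theta>) * h \<theta>)"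
    if h: "h \<in> borel_measurable borel" "\<And>\<theta>. cmod (h \<theta>) \<le> B" for h :: "real \<Rightarrow> complex" and B
    unfolding set_integrable_def
  proof (rule Bochner_Integration.integrable_bound)
    show "integrable lebesgue (\<lambda>\<theta>. B * (indicator A \<theta> *\<^sub>R g \<theta>))"
      using g unfolding set_integrable_def by (rule integrable_mult_right)
    have "(\<lambda>\<theta>. indicator A \<theta> *\<^sub>R g \<theta>) \<in> borel_measurable lebesgue"
      using g unfolding set_integrable_def by (rule borel_measurable_integrable)
    moreover have "h \<in> borel_measurable lebesgue" using h(1) by (intro measurable_completion) simp
    ultimately have "(\<lambda>\<theta>. complex_of_real (indicator A \<theta> *\<^sub>R g \<theta>) * h \<theta>) \<in> borel_measurable lebesgue"
      by measurable
    then show "(\<lambda>\<theta>. indicator A \<theta> *\<^sub>R (complex_of_real (g \<theta>) * h \<theta>)) \<in> borel_measurable lebesgue"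
      by (simp add: scaleR_conv_of_real mult.assoc)
    show "AE \<theta> in lebesgue. norm (indicator A \<theta> *\<^sub>R (complex_of_real (g \<theta>) * h \<theta>)) \<le> norm (B * (indicator A \<theta> *\<^sub>R g \<theta>))"
    proof (rule AE_I2)
      fix \<theta>
      have "cmod (h \<theta>) \<le> \<bar>B\<bar>" using h(2)[of \<theta>] by linarith
      then show "norm (indicator A \<theta> *\<^sub>R (complex_of_real (g \<theta>) * h \<theta>)) \<le> norm (B * (indicator A \<theta> *\<^sub>R g \<theta>))"
        by (auto simp: indicator_def norm_mult abs_mult mult.commute[of "\<bar>g \<theta>\<bar>"] intro: mult_right_mono)
    qed
  qed
  have gcis: "set_integrable lebesgue A (\<lambda>\<theta>. complex_of_real (g \<theta>) * cis (c * \<theta>))" for c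
    by (rule gc[of _ 1]) (auto intro!: borel_measurable_continuous_onI continuous_intros)
  have PQ: "complex_of_real (P \<theta>) * cis (- l * \<theta>) = K * (\<Sum>k\<le>2*n. coeff Q k * cis ((real k - real n - l) * \<theta>))" for \<theta> l
  proof -
    have "complex_of_real (P \<theta>) = K * (\<Sum>k\<le>2*n. coeff Q k * cis ((real k - real n) * \<theta>))"
      unfolding P_def K_def Q_def S_def by (rule prod_sin_half_diff)
    then show ?thesis
      by (simp add: sum_distrib_left sum_distrib_right mult.assoc cis_mult algebra_simps)
  qed
  have int: "(LINT \<theta>:A|lebesgue. complex_of_real (g \<theta>) * (complex_of_real (P \<theta>) * cis (- of_int l * \<theta>)))
     = K * (\<Sum>k\<le>2*n. coeff Q k * M (int n + l - int k))" for l :: int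
  proof -
    have "(LINT \<theta>:A|lebesgue. complex_of_real (g \<theta>) * (complex_of_real (P \<theta>) * cis (- of_int l * \<theta>)))
      = (LINT \<theta>:A|lebesgue. (\<Sum>k\<le>2*n. K * coeff Q k * (complex_of_real (g \<theta>) * cis (- of_int (int n + l - int k) * \<theta>))))"
    proof (intro arg_cong[where f="set_lebesgue_integral lebesgue A"] ext)
      fix \<theta>
      have e: "real k - real n - of_int l = - of_int (int n + l - int k)" for k by simp
      show "complex_of_real (g \<theta>) * (complex_of_real (P \<theta>) * cis (- of_int l * \<theta>)) =
        (\<Sum>k\<le>2*n. K * coeff Q k * (complex_of_real (g \<theta>) * cis (- of_int (int n + l - int k) * \<theta>)))"
        unfolding PQ[of \<theta> "of_int l"] e sum_distrib_left by (intro sum.cong refl) (simp only: mult_ac)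
    qed
    also have "\<dots> = (\<Sum>k\<le>2*n. LINT \<theta>:A|lebesgue. K * coeff Q k * (complex_of_real (g \<theta>) * cis (- of_int (int n + l - int k) * \<theta>)))"
      unfolding set_lebesgue_integral_def scaleR_sum_right
      by (rule Bochner_Integration.integral_sum, fold set_integrable_def) (intro set_integrable_mult_right gcis)
    also have "\<dots> = (\<Sum>k\<le>2*n. K * coeff Q k * M (int n + l - int k))"
      by (intro sum.cong refl) (simp only: set_integral_mult_right M)
    finally show ?thesis by (simp add: sum_distrib_left mult.assoc)
  qed
  have Qc: "coeff Q 0 = cis S" "coeff Q 1 = - cis S * (\<Sum>j<2*n. cis (- t j))" "coeff Q (2*n) = 1"
  proof -
    have "(\<Prod>j<m. cis (t j)) = cis (\<Sum>j<m. t j)" for m by (induction m) (simp_all add: cis_mult)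
    then have "(\<Prod>j<2*n. - cis (t j)) = cis S" by (simp add: prod_uminus S_def)
    then show "coeff Q 0 = cis S" "coeff Q 1 = - cis S * (\<Sum>j<2*n. cis (- t j))" "coeff Q (2*n) = 1"
      using coeff_0_1_prod_linear[of "\<lambda>j. cis (t j)" "2*n"] prod_linear_monic[where N="2*n" and p="\<lambda>j. cis (t j)"]
      by (simp_all add: Q_def)
  qed
  have cnjM: "M (- k) = cnj (M k)" for k
  proof -
    have "cnj (M k) = (LINT \<theta>:A|lebesgue. cnj (complex_of_real (g \<theta>) * cis (- of_int k * \<theta>)))"
      unfolding M set_lebesgue_integral_def
      by (subst integral_bounded_linear'[OF bounded_linear_cnj bounded_linear_cnj, symmetric]) (auto simp: scaleR_conv_of_real)
    also have "\<dots> = M (- k)" unfolding M by (simp add: cis_cnj)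
    finally show ?thesis by simp
  qed
  have KS: "K * cis S = (-1/4) ^ n * cis (S / 2)" by (simp add: K_def cis_mult mult.assoc)
  have i0: "(LINT \<theta>:A|lebesgue. complex_of_real (g \<theta> * P \<theta>)) = (-1/4)^n * (2 * Re (cis (S / 2) * M n))"
  proof -
    have "(\<Sum>k\<le>2*n. coeff Q k * M (int n - int k)) = (\<Sum>k\<in>{0,2*n}. coeff Q k * M (int n - int k))"
      by (rule sum.mono_neutral_right) (auto intro!: M0)
    also have "\<dots> = cis S * M n + cnj (M n)" using n by (simp add: Qc cnjM[symmetric])
    finally have "(LINT \<theta>:A|lebesgue. complex_of_real (g \<theta> * P \<theta>)) = K * (cis S * M n + cnj (M n))"
      using int[of 0] by simp
    also have "\<dots> = (-1/4)^n * (cis (S/2) * M n + cnj (cis (S/2) * M n))"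
      unfolding distrib_left mult.assoc[symmetric] KS by (simp add: K_def cis_cnj)
    also have "\<dots> = (-1/4)^n * (2 * Re (cis (S / 2) * M n))" unfolding complex_add_cnj by simp
    finally show ?thesis .
  qed
  have i1: "(LINT \<theta>:A|lebesgue. complex_of_real (g \<theta> * P \<theta>) * cis (- \<theta>)) =
     (-1/4)^n * cis (S / 2) * (M (int n + 1) - (\<Sum>j<2*n. cis (- t j)) * M n)"
  proof -
    have "(\<Sum>k\<le>2*n. coeff Q k * M (int n + 1 - int k)) = (\<Sum>k\<in>{0,1}. coeff Q k * M (int n + 1 - int k))"
      by (rule sum.mono_neutral_right) (use n in \<open>auto intro!: M0\<close>)
    also have "\<dots> = cis S * (M (int n + 1) - (\<Sum>j<2*n. cis (- t j)) * M n)" using Qc(2) by (simp add: Qc algebra_simps)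
    finally show ?thesis using int[of 1] KS by (simp add: mult.assoc[symmetric])
  qed
  \<comment> \<open>The sign hypothesis turns the integral of the absolute value of g P, left by the
    triangle inequality, into \<sigma> times the integral of g P.\<close>
  have "cmod (LINT \<theta>:A|lebesgue. complex_of_real (g \<theta> * P \<theta>) * cis (- \<theta>)) \<le> (LINT \<theta>:A|lebesgue. \<sigma> * g \<theta> * P \<theta>)"
  proof -
    have "cmod (LINT \<theta>:A|lebesgue. complex_of_real (g \<theta> * P \<theta>) * cis (- \<theta>)) \<le>
      (LINT \<theta>|lebesgue. cmod (indicator A \<theta> *\<^sub>R (complex_of_real (g \<theta> * P \<theta>) * cis (- \<theta>))))"
      unfolding set_lebesgue_integral_def by (rule integral_norm_bound)
    also have "\<dots> = (LINT \<theta>:A|lebesgue. \<sigma> * g \<theta> * P \<theta>)"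
      unfolding set_lebesgue_integral_def
    proof (rule integral_cong_AE)
      have "(\<lambda>\<theta>. indicator A \<theta> *\<^sub>R g \<theta>) \<in> borel_measurable lebesgue"
        using g unfolding set_integrable_def by (rule borel_measurable_integrable)
      moreover have "P \<in> borel_measurable lebesgue" unfolding P_def
          by (intro measurable_completion) simp
      ultimately have "(\<lambda>\<theta>. (indicator A \<theta> *\<^sub>R g \<theta>) * P \<theta>) \<in> borel_measurable lebesgue" by measurable
      then have "(\<lambda>\<theta>. \<bar>(indicator A \<theta> *\<^sub>R g \<theta>) * P \<theta>\<bar>) \<in> borel_measurable lebesgue"
        "(\<lambda>\<theta>. \<sigma> * ((indicator A \<theta> *\<^sub>R g \<theta>) * P \<theta>)) \<in> borel_measurable lebesgue" by measurable
      moreover have "(\<lambda>\<theta>. cmod (indicator A \<theta> *\<^sub>R (complex_of_real (g \<theta> * P \<theta>) * cis (- \<theta>)))) = (\<lambda>\<theta>. \<bar>(indicator A \<theta> *\<^sub>R g \<theta>) * P \<theta>\<bar>)"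
        by (auto simp: norm_mult abs_mult indicator_def)
      moreover have "(\<lambda>\<theta>. indicator A \<theta> *\<^sub>R (\<sigma> * g \<theta> * P \<theta>)) = (\<lambda>\<theta>. \<sigma> * ((indicator A \<theta> *\<^sub>R g \<theta>) * P \<theta>))"
        by (auto simp: indicator_def)
      ultimately show "(\<lambda>\<theta>. cmod (indicator A \<theta> *\<^sub>R (complex_of_real (g \<theta> * P \<theta>) * cis (- \<theta>)))) \<in> borel_measurable lebesgue"
        "(\<lambda>\<theta>. indicator A \<theta> *\<^sub>R (\<sigma> * g \<theta> * P \<theta>)) \<in> borel_measurable lebesgue" by simp_all
      show "AE \<theta> in lebesgue. cmod (indicator A \<theta> *\<^sub>R (complex_of_real (g \<theta> * P \<theta>) * cis (- \<theta>))) = indicator A \<theta> *\<^sub>R (\<sigma> * g \<theta> * P \<theta>)"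
        using pos
      proof eventually_elim
        case (elim \<theta>)
        then have "\<theta> \<in> A \<Longrightarrow> 0 \<le> \<sigma> * g \<theta> * P \<theta>" by (simp add: P_def)
        then have "\<theta> \<in> A \<Longrightarrow> \<bar>g \<theta> * P \<theta>\<bar> = \<sigma> * g \<theta> * P \<theta>" using \<sigma> by auto
        then show ?case by (auto simp: indicator_def norm_mult abs_mult)
      qed
    qed
    finally show ?thesis .
  qed
  also have "(LINT \<theta>:A|lebesgue. \<sigma> * g \<theta> * P \<theta>) \<le> cmod (LINT \<theta>:A|lebesgue. complex_of_real (g \<theta> * P \<theta>))"
  proof -
    have "(LINT \<theta>:A|lebesgue. complex_of_real (g \<theta> * P \<theta>)) = of_real (LINT \<theta>:A|lebesgue. g \<theta> * P \<theta>)"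
      by (rule set_integral_complex_of_real)
    moreover have "(LINT \<theta>:A|lebesgue. \<sigma> * g \<theta> * P \<theta>) = \<sigma> * (LINT \<theta>:A|lebesgue. g \<theta> * P \<theta>)"
      by (simp add: mult.assoc set_integral_mult_right)
    ultimately show ?thesis using \<sigma> by auto
  qed
  finally have "cmod ((-1/4)^n * cis (S / 2) * (M (int n + 1) - (\<Sum>j<2*n. cis (- t j)) * M n))
      \<le> cmod (complex_of_real ((-1/4)^n * (2 * Re (cis (S / 2) * M n))))"
    unfolding i0 i1 .
  moreover have "cmod (complex_of_real ((-1/4)^n * (2 * R))) = (1/4)^n * (2 * \<bar>R\<bar>)" for R
    unfolding norm_of_real by (simp add: abs_mult power_abs)
  moreover have "cmod ((-1/4)^n * cis (S / 2) * Y) = (1/4)^n * cmod Y" for Y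
    by (simp add: norm_mult norm_power)
  ultimately show ?thesis by (simp only: S_def) simp
qed

subsection \<open>Radial limits of Poisson integrals\<close>

text \<open>The part of k above a large level N has small integral. The part below N contributes at
  most N times the measure of T - E on an open T containing E, because k vanishes on E, and outer
  regularity makes that measure small.\<close>

lemma integral_le_on_open_near_null:
  fixes k :: "real \<Rightarrow> real"
  assumes k: "integrable lebesgue k" "\<And>x. 0 \<le> k x" and E: "E \<in> sets lebesgue" "\<And>x. x \<in> E \<Longrightarrow> k x = 0" and e: "e > 0"
  obtains U where "open U" "E \<subseteq> U" "(LINT x:U|lebesgue. k x) < e"
proof -
  have [measurable]: "k \<in> borel_measurable lebesgue" using k(1) by (rule borel_measurable_integrable)
  have "(\<lambda>N::nat. integral\<^sup>L lebesgue (\<lambda>x. k x - min (k x) (real N))) \<longlonglongrightarrow> integral\<^sup>L lebesgue (\<lambda>x::real. 0::real)"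
  proof (rule integral_dominated_convergence[where w=k])
    show "AE x in lebesgue. (\<lambda>N. k x - min (k x) (real N)) \<longlonglongrightarrow> 0"
    proof (rule AE_I2)
      fix x
      obtain N0 where "k x \<le> real N0" using real_arch_simple by blast
      then have "\<forall>N\<ge>N0. k x - min (k x) (real N) = 0" by auto
      then show "(\<lambda>N. k x - min (k x) (real N)) \<longlonglongrightarrow> 0"
        by (intro tendsto_eventually) (auto simp: eventually_sequentially)
    qed
    show "AE x in lebesgue. norm (k x - min (k x) (real N)) \<le> k x" for N
      using k(2) by (intro AE_I2) (simp add: min_def)
    show "(\<lambda>x. k x - min (k x) (real N)) \<in> borel_measurable lebesgue" for N by measurable
  qed (rule borel_measurable_const, rule k(1))
  then have "eventually (\<lambda>N::nat. (LINT x|lebesgue. k x - min (k x) (real N)) < e / 2) sequentially"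
    using e by (intro order_tendstoD) auto
  then obtain N :: nat where N: "(LINT x|lebesgue. k x - min (k x) (real N)) < e / 2"
    by (auto simp: eventually_sequentially)
  obtain T where T: "open T" "E \<subseteq> T" "T - E \<in> lmeasurable" "emeasure lebesgue (T - E) < ennreal (e / (2 * (real N + 1)))"
    using sets_lebesgue_outer_open[OF E(1), of "e / (2 * (real N + 1))"] e by auto
  have mT: "measure lebesgue (T - E) < e / (2 * (real N + 1))"
  proof -
    have "emeasure lebesgue (T - E) = ennreal (measure lebesgue (T - E))"
      using T(3) by (intro emeasure_eq_ennreal_measure) (auto simp: fmeasurable_def)
    then show ?thesis using T(4) by (simp add: ennreal_less_iff)
  qed
  have intT: "set_integrable lebesgue T k"
    unfolding set_integrable_def using T(1) k(1) by (intro integrable_mult_indicator) (auto simp: lborelD_Collect)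
  have "(LINT x:T|lebesgue. k x) \<le> (LINT x|lebesgue. (k x - min (k x) (real N)) + real N * indicator (T - E) x)"
    unfolding set_lebesgue_integral_def
  proof (rule integral_mono)
    show "integrable lebesgue (\<lambda>x. indicator T x *\<^sub>R k x)" using intT by (simp add: set_integrable_def)
    show "integrable lebesgue (\<lambda>x. k x - min (k x) (real N) + real N * indicator (T - E) x)"
    proof (intro Bochner_Integration.integrable_add Bochner_Integration.integrable_diff integrable_mult_right k)
      show "integrable lebesgue (\<lambda>x. min (k x) (real N))"
        by (rule Bochner_Integration.integrable_bound[OF k(1)]) (use k in auto)
      show "integrable lebesgue (\<lambda>x. indicat_real (T - E) x)"
        using T(3) by (intro integrable_real_indicator) (auto simp: fmeasurable_def)
    qed
    show "indicator T x *\<^sub>R k x \<le> k x - min (k x) (real N) + real N * indicator (T - E) x" for x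
      using k(2)[of x] E(2)[of x] by (auto simp: indicator_def)
  qed
  also have "\<dots> = (LINT x|lebesgue. (k x - min (k x) (real N))) + real N * measure lebesgue (T - E)"
  proof (subst Bochner_Integration.integral_add)
    show "integrable lebesgue (\<lambda>x. k x - min (k x) (real N))"
      by (intro Bochner_Integration.integrable_diff k Bochner_Integration.integrable_bound[OF k(1), of "\<lambda>x. min (k x) (real N)"]) (use k in auto)
    show "integrable lebesgue (\<lambda>x. real N * indicat_real (T - E) x)"
      using T(3) by (intro integrable_mult_right integrable_real_indicator) (auto simp: fmeasurable_def)
  qed (use T(3) in simp)
  also have "\<dots> < e / 2 + e / 2"
  proof -
    have "real N * measure lebesgue (T - E) \<le> real N * (e / (2 * (real N + 1)))"
      using mT by (intro mult_left_mono) auto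
    also have "\<dots> \<le> e / 2" using e by (simp add: field_simps)
    finally show ?thesis using N by simp
  qed
  finally show ?thesis using that T by simp
qed

text \<open>The Lebesgue differentiation theorem at zeros of k, by Vitali covering. Each exceptional
  point is the centre of arbitrarily small balls inside U over which k has integral above l s.
  Disjoint balls of this kind cover almost all exceptional points, and their total length, 2 s each,
  is at most 2 / l times the integral of k over U.\<close>

lemma negligible_large_averages:
  fixes k :: "real \<Rightarrow> real"
  assumes k: "integrable lebesgue k" "\<And>x. 0 \<le> k x" and E: "E \<in> sets lebesgue" "\<And>x. x \<in> E \<Longrightarrow> k x = 0" and l: "l > 0"
  shows "negligible {x\<in>E. \<forall>d>0. \<exists>s. 0 < s \<and> s < d \<and> l * s < (LINT y:cball x s|lebesgue. k y)}" (is "negligible ?A")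
  unfolding negligible_outer_le
proof (intro allI impI)
  fix e :: real assume e: "e > 0"
  obtain U where U: "open U" "E \<subseteq> U" "(LINT x:U|lebesgue. k x) < l * e / 2"
    using integral_le_on_open_near_null[OF k E, of "l * e / 2"] l e by auto
  have [measurable]: "k \<in> borel_measurable lebesgue" using k(1) by (rule borel_measurable_integrable)
  \<comment> \<open>As a measure with density k, the integral of k becomes countably additive over
    the disjoint balls.\<close>
  define \<nu> where "\<nu> = density lebesgue (\<lambda>x. ennreal (k x))"
  have nu: "emeasure \<nu> X = ennreal (LINT x:X|lebesgue. k x)" if [measurable]: "X \<in> sets lebesgue" for X
  proof -
    have "emeasure \<nu> X = (\<integral>\<^sup>+x. ennreal (indicator X x *\<^sub>R k x) \<partial>lebesgue)"
      unfolding \<nu>_def by (subst emeasure_density) (auto intro!: nn_integral_cong simp: indicator_def)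
    also have "\<dots> = ennreal (LINT x:X|lebesgue. k x)" unfolding set_lebesgue_integral_def
      by (rule nn_integral_eq_integral) (use k integrable_mult_indicator[OF that k(1)] in auto)
    finally show ?thesis .
  qed
  define K where "K = {(x, s). 0 < s \<and> cball x s \<subseteq> U \<and> l * s < (LINT y:cball x s|lebesgue. k y)}"
  obtain C where C: "countable C" "C \<subseteq> K"
     "pairwise (\<lambda>i j. disjnt (cball (fst i) (snd i)) (cball (fst j) (snd j))) C"
     "negligible (?A - (\<Union>i \<in> C. cball (fst i) (snd i)))"
  proof (rule Vitali_covering_theorem_cballs[of K snd ?A fst])
    show "0 < snd i" if "i \<in> K" for i using that by (auto simp: K_def)
    show "\<exists>i. i \<in> K \<and> x \<in> cball (fst i) (snd i) \<and> snd i < d" if "x \<in> ?A" "0 < d" for x d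
    proof -
      have "x \<in> U" using that U by auto
      then obtain d' where d': "d' > 0" "cball x d' \<subseteq> U" using U(1) open_contains_cball by blast
      obtain s where s: "0 < s" "s < min d d'" "l * s < (LINT y:cball x s|lebesgue. k y)"
      proof -
        have "\<exists>s. 0 < s \<and> s < min d d' \<and> l * s < (LINT y:cball x s|lebesgue. k y)"
          using \<open>x \<in> ?A\<close> \<open>0 < d\<close> d'(1) by (simp del: min_less_iff_conj)
        then show ?thesis using that by blast
      qed
      have "cball x s \<subseteq> U" using d' s by (auto simp: subset_iff)
      then have "(x, s) \<in> K" using s by (simp add: K_def)
      then show ?thesis using s by (intro exI[of _ "(x, s)"]) auto
    qed
  qed
  define B where "B = (\<lambda>i. cball (fst i) (snd i) :: real set)"
  have disj: "disjoint_family_on B C"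
    using C(3) unfolding disjoint_family_on_def pairwise_def disjnt_def B_def by blast
  have Bm: "B i \<in> sets lebesgue" for i unfolding B_def by simp
  have BU: "(\<Union>i\<in>C. B i) \<subseteq> U" using C(2) by (force simp: B_def K_def)
  have "emeasure lebesgue (\<Union>i\<in>C. B i) = (\<integral>\<^sup>+i. emeasure lebesgue (B i) \<partial>count_space C)"
    using Bm disj C(1) by (intro emeasure_UN_countable) auto
  also have "\<dots> \<le> (\<integral>\<^sup>+i. ennreal (2 / l) * emeasure \<nu> (B i) \<partial>count_space C)"
  proof (rule nn_integral_mono)
    fix i assume "i \<in> space (count_space C)"
    then have i: "0 < snd i" "l * snd i < (LINT y:B i|lebesgue. k y)" using C(2) by (auto simp: K_def B_def)
    have "emeasure lebesgue (B i) = ennreal (2 * snd i)"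
      using i by (simp add: B_def cball_eq_atLeastAtMost)
    also have "\<dots> \<le> ennreal (2 / l * (LINT y:B i|lebesgue. k y))"
      using i l by (intro ennreal_leI) (simp add: field_simps)
    also have "\<dots> = ennreal (2 / l) * emeasure \<nu> (B i)"
      using l unfolding nu[OF Bm] by (intro ennreal_mult') simp
    finally show "emeasure lebesgue (B i) \<le> ennreal (2 / l) * emeasure \<nu> (B i)" .
  qed
  also have "\<dots> = ennreal (2 / l) * (\<integral>\<^sup>+i. emeasure \<nu> (B i) \<partial>count_space C)"
    by (rule nn_integral_cmult) simp
  also have "(\<integral>\<^sup>+i. emeasure \<nu> (B i) \<partial>count_space C) = emeasure \<nu> (\<Union>i\<in>C. B i)"
    using Bm disj C(1) by (intro emeasure_UN_countable[symmetric]) (auto simp: \<nu>_def)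
  also have "\<dots> \<le> emeasure \<nu> U"
    using BU U(1) by (intro emeasure_mono) (auto simp: \<nu>_def)
  also have "\<dots> \<le> ennreal (l * e / 2)" using U by (subst nu) (auto intro!: ennreal_leI)
  finally have "emeasure lebesgue (\<Union>i\<in>C. B i) \<le> ennreal (2 / l) * ennreal (l * e / 2)"
    by (simp add: mult_left_mono)
  also have "\<dots> = ennreal e" using l e by (simp add: ennreal_mult'[symmetric])
  finally have le: "emeasure lebesgue (\<Union>i\<in>C. B i) \<le> ennreal e" .
  have UNm: "(\<Union>i\<in>C. B i) \<in> sets lebesgue" using Bm C(1) by (intro sets.countable_UN') auto
  have lm: "(\<Union>i\<in>C. B i) \<in> lmeasurable"
    using UNm le by (intro fmeasurableI) (auto simp: less_top[symmetric] top_unique)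
  have ml: "measure lebesgue (\<Union>i\<in>C. B i) \<le> e"
    using le e by (simp add: measure_def enn2real_leI)
  have neg: "negligible (?A - (\<Union>i\<in>C. B i))" using C(4) by (simp add: B_def)
  show "\<exists>T. ?A \<subseteq> T \<and> T \<in> lmeasurable \<and> measure lebesgue T \<le> e"
  proof (intro exI[of _ "(\<Union>i\<in>C. B i) \<union> (?A - (\<Union>i\<in>C. B i))"] conjI)
    show "(\<Union>i\<in>C. B i) \<union> (?A - (\<Union>i\<in>C. B i)) \<in> lmeasurable"
      by (rule fmeasurable.Un[OF lm negligible_imp_measurable[OF neg]])
    have "measure lebesgue ((\<Union>i\<in>C. B i) \<union> (?A - (\<Union>i\<in>C. B i))) \<le> measure lebesgue (\<Union>i\<in>C. B i) + measure lebesgue (?A - (\<Union>i\<in>C. B i))"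
      using lm neg by (intro measure_Un_le) (auto dest: negligible_imp_measurable fmeasurableD)
    then show "measure lebesgue ((\<Union>i\<in>C. B i) \<union> (?A - (\<Union>i\<in>C. B i))) \<le> e"
      using ml negligible_imp_measure0[OF neg] by simp
  qed blast
qed

section \<open>Estimates of the Poisson kernel near the boundary\<close>

text \<open>The kernel of the unit disc at the point r cis \<theta>, without the normalising factor
  1 / (2 pi).\<close>

definition poisson_kernel :: "real \<Rightarrow> real \<Rightarrow> real \<Rightarrow> real" where
  "poisson_kernel r \<theta> t = (1 - r\<^sup>2) / (cmod (cis t - complex_of_real r * cis \<theta>))\<^sup>2"

lemma cmod_cis_minus_sq: "(cmod (cis t - complex_of_real r * cis \<theta>))\<^sup>2 = (1 - r)\<^sup>2 + 4 * r * (sin ((t - \<theta>) / 2))\<^sup>2"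
proof -
  have "(cmod (cis t - complex_of_real r * cis \<theta>))\<^sup>2 = (cos t - r * cos \<theta>)\<^sup>2 + (sin t - r * sin \<theta>)\<^sup>2"
    by (simp add: cmod_power2)
  also have "\<dots> = ((cos t)\<^sup>2 + (sin t)\<^sup>2) + r\<^sup>2 * ((cos \<theta>)\<^sup>2 + (sin \<theta>)\<^sup>2) - 2 * r * (cos t * cos \<theta> + sin t * sin \<theta>)"
    by algebra
  also have "\<dots> = 1 + r\<^sup>2 - 2 * r * cos (t - \<theta>)" by (simp add: cos_diff)
  also have "cos (t - \<theta>) = 1 - 2 * (sin ((t - \<theta>) / 2))\<^sup>2"
    using cos_double_sin[of "(t - \<theta>) / 2"] by (simp only: mult_2 field_sum_of_halves)
  finally show ?thesis by (simp add: power2_eq_square algebra_simps)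
qed

lemma half_le_sin:
  fixes y :: real assumes y: "0 \<le> y" "y \<le> 1" shows "y / 2 \<le> sin y"
proof -
  have "(\<lambda>x. sin x - x / 2) 0 \<le> (\<lambda>x. sin x - x / 2) y"
  proof (rule DERIV_nonneg_imp_nondecreasing[OF y(1)])
    fix x assume x: "0 \<le> x" "x \<le> y"
    have "cos (pi / 3) \<le> cos x" using x y pi_gt3 by (intro cos_monotone_0_pi_le) auto
    moreover have "((\<lambda>x. sin x - x / 2) has_real_derivative cos x - 1 / 2) (at x)"
      by (auto intro!: derivative_eq_intros)
    ultimately show "\<exists>z. ((\<lambda>x. sin x - x / 2) has_real_derivative z) (at x) \<and> 0 \<le> z"
      by (auto simp: cos_60)
  qed
  then show ?thesis by simp
qed

text \<open>A majorant by boxes of dyadic width lets integrals against the kernel be bounded by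
  averages over balls. For the least i with |x| \<le> 2^i d, either i = 0 or |x| exceeds 2^(i-1) d,
  so x^2 is at least 4^(i-1) d^2; the lost exponent is the factor 4.\<close>

lemma inverse_quadratic_le_dyadic:
  fixes d x :: real
  assumes d: "d > 0" and x: "\<bar>x\<bar> \<le> 2 ^ N * d"
  shows "d / (d\<^sup>2 + x\<^sup>2) \<le> (\<Sum>i\<le>N. 4 / 4 ^ i / d * indicator (cball 0 (2 ^ i * d)) x)"
proof -
  define i where "i = (LEAST i. \<bar>x\<bar> \<le> 2 ^ i * d)"
  have i: "\<bar>x\<bar> \<le> 2 ^ i * d" "i \<le> N" unfolding i_def using x by (auto intro: LeastI Least_le)
  have "d / (d\<^sup>2 + x\<^sup>2) \<le> 4 / 4 ^ i / d"
  proof (cases i)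
    case 0
    have "d / (d\<^sup>2 + x\<^sup>2) \<le> d / d\<^sup>2" using d by (intro divide_left_mono) (auto intro!: mult_pos_pos add_pos_nonneg)
    also have "\<dots> \<le> 4 / d" using d by (simp add: power2_eq_square divide_simps)
    finally show ?thesis using 0 by simp
  next
    case (Suc j)
    have "\<not> \<bar>x\<bar> \<le> 2 ^ j * d" using Suc not_less_Least[of j "\<lambda>i. \<bar>x\<bar> \<le> 2 ^ i * d"] by (simp add: i_def)
    then have "(2 ^ j * d)\<^sup>2 \<le> x\<^sup>2" using d by (metis abs_le_square_iff abs_of_nonneg less_eq_real_def linorder_not_le mult_nonneg_nonneg zero_le_numeral zero_le_power)
    then have "4 ^ j * d\<^sup>2 \<le> d\<^sup>2 + x\<^sup>2"     proof -
      have "(2 ^ j * d)\<^sup>2 = 4 ^ j * d\<^sup>2"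
      proof -
        have "((2::real) ^ j)\<^sup>2 = (2 ^ 2) ^ j" by (simp only: power_mult[symmetric] mult.commute)
        then show ?thesis by (simp add: power_mult_distrib)
      qed
      then show ?thesis using \<open>(2 ^ j * d)\<^sup>2 \<le> x\<^sup>2\<close> by (simp add: add_increasing)
    qed
    then have "d / (d\<^sup>2 + x\<^sup>2) \<le> d / (4 ^ j * d\<^sup>2)" using d by (intro divide_left_mono) (auto intro!: mult_pos_pos add_pos_nonneg)
    also have "\<dots> = 4 / 4 ^ i / d" using d Suc by (simp add: power2_eq_square)
    finally show ?thesis .
  qed
  also have "\<dots> = 4 / 4 ^ i / d * indicator (cball 0 (2 ^ i * d)) x" using i by simp
  also have "\<dots> \<le> (\<Sum>i\<le>N. 4 / 4 ^ i / d * indicator (cball 0 (2 ^ i * d)) x)"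
    using i d by (intro member_le_sum) auto
  finally show ?thesis .
qed


text \<open>By \<open>half_le_sin\<close> and r \<ge> 1/2 the denominator is at least an eighth of
  (1 - r)^2 + (t - \<theta>)^2, and the numerator is at most 2 (1 - r); hence the constant
  16.\<close>

lemma poisson_kernel_le_near:
  assumes r: "1/2 \<le> r" "r < 1" and t: "\<bar>t - \<theta>\<bar> \<le> 1"
  shows "poisson_kernel r \<theta> t \<le> 16 * ((1 - r) / ((1 - r)\<^sup>2 + (t - \<theta>)\<^sup>2))"
proof -
  define x where "x = t - \<theta>"
  have "\<bar>x / 2\<bar> / 2 \<le> sin \<bar>x / 2\<bar>" using t by (intro half_le_sin) (auto simp: x_def)
  then have "(\<bar>x / 2\<bar> / 2)\<^sup>2 \<le> (sin \<bar>x / 2\<bar>)\<^sup>2" by (intro power_mono) auto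
  then have s: "x\<^sup>2 / 16 \<le> (sin (x / 2))\<^sup>2" by (simp add: power_divide abs_if split: if_splits)
  have *: "2 * (x\<^sup>2 / 16) \<le> 4 * r * (sin (x / 2))\<^sup>2" using s r by (intro mult_mono) auto
  have den: "((1 - r)\<^sup>2 + x\<^sup>2) / 8 \<le> (1 - r)\<^sup>2 + 4 * r * (sin (x / 2))\<^sup>2"
  proof -
    have "((1 - r)\<^sup>2 + x\<^sup>2) / 8 = (1 - r)\<^sup>2 / 8 + 2 * (x\<^sup>2 / 16)" by (simp add: field_simps)
    moreover have "(1 - r)\<^sup>2 / 8 \<le> (1 - r)\<^sup>2" by simp
    ultimately show ?thesis using * by linarith
  qed
  have pos: "0 < (1 - r)\<^sup>2 + x\<^sup>2" using r by (intro add_pos_nonneg) auto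
  have "poisson_kernel r \<theta> t = (1 - r\<^sup>2) / ((1 - r)\<^sup>2 + 4 * r * (sin (x / 2))\<^sup>2)"
    unfolding poisson_kernel_def cmod_cis_minus_sq x_def ..
  also have "\<dots> \<le> (2 * (1 - r)) / (((1 - r)\<^sup>2 + x\<^sup>2) / 8)"
  proof (rule frac_le)
    show "1 - r\<^sup>2 \<le> 2 * (1 - r)" using zero_le_power2[of "1 - r"] by (simp add: power2_eq_square algebra_simps)
  qed (use r den pos in auto)
  finally show ?thesis by (simp add: x_def mult.commute)
qed

text \<open>Points near opposite ends of [0, 2 pi] are close on the circle, so \<theta> is kept at
  distance d from both ends. Then |t - \<theta>| / 2 lies between d / 2 and pi - d / 2, where the
  sine is at least sin (d / 2).\<close>

lemma poisson_kernel_le_far: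
  assumes r: "1/2 \<le> r" "r < 1" and \<theta>: "0 < d" "d < pi" "d \<le> \<theta>" "\<theta> \<le> 2 * pi - d" and t: "0 \<le> t" "t \<le> 2 * pi" "d \<le> \<bar>t - \<theta>\<bar>"
  shows "poisson_kernel r \<theta> t \<le> (1 - r) / (sin (d / 2))\<^sup>2"
proof -
  define y where "y = \<bar>t - \<theta>\<bar> / 2"
  have y: "d / 2 \<le> y" "y \<le> pi - d / 2" using \<theta> t by (auto simp: y_def)
  have "sin (d / 2) \<le> sin y"
  proof (cases "y \<le> pi / 2")
    case True then show ?thesis using y \<theta> by (intro sin_monotone_2pi_le) auto
  next
    case False
    then have "sin (d / 2) \<le> sin (pi - y)" using y \<theta> by (intro sin_monotone_2pi_le) auto
    then show ?thesis by simp
  qed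
  moreover have sp: "0 < sin (d / 2)" using \<theta> by (intro sin_gt_zero) auto
  ultimately have "(sin (d / 2))\<^sup>2 \<le> (sin y)\<^sup>2" by (intro power_mono) auto
  also have "(sin y)\<^sup>2 = (sin ((t - \<theta>) / 2))\<^sup>2"
  proof -
    have "y = (t - \<theta>) / 2 \<or> y = - ((t - \<theta>) / 2)" unfolding y_def by linarith
    then show ?thesis by (elim disjE) (simp_all only: sin_minus power2_minus)
  qed
  finally have s: "(sin (d / 2))\<^sup>2 \<le> (sin ((t - \<theta>) / 2))\<^sup>2" .
  have "2 * (sin (d / 2))\<^sup>2 \<le> 4 * r * (sin ((t - \<theta>) / 2))\<^sup>2" using s r by (intro mult_mono) auto
  also have "\<dots> \<le> (1 - r)\<^sup>2 + 4 * r * (sin ((t - \<theta>) / 2))\<^sup>2" by simp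
  finally have den: "2 * (sin (d / 2))\<^sup>2 \<le> (1 - r)\<^sup>2 + 4 * r * (sin ((t - \<theta>) / 2))\<^sup>2" .
  have "poisson_kernel r \<theta> t \<le> (2 * (1 - r)) / (2 * (sin (d / 2))\<^sup>2)"
    unfolding poisson_kernel_def cmod_cis_minus_sq
  proof (rule frac_le)
    show "1 - r\<^sup>2 \<le> 2 * (1 - r)" using zero_le_power2[of "1 - r"] by (simp add: power2_eq_square algebra_simps)
  qed (use r den sp in auto)
  also have "\<dots> = (1 - r) / (sin (d / 2))\<^sup>2" by (rule mult_divide_mult_cancel_left) simp
  finally show ?thesis .
qed

text \<open>The lower bound is the height of a box of area one over the interval of length 2 (1 - r)
  around \<theta>, so this interval alone carries kernel mass at least one.\<close>

lemma poisson_kernel_ge_near: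
  assumes r: "0 \<le> r" "r < 1" and t: "\<bar>t - \<theta>\<bar> \<le> 1 - r"
  shows "1 / (2 * (1 - r)) \<le> poisson_kernel r \<theta> t"
proof -
  define x where "x = t - \<theta>"
  have "\<bar>sin (x / 2)\<bar> \<le> \<bar>x / 2\<bar>" by (rule abs_sin_x_le_abs_x)
  then have "(sin (x / 2))\<^sup>2 \<le> (x / 2)\<^sup>2" by (simp only: abs_le_square_iff)
  then have "4 * r * (sin (x / 2))\<^sup>2 \<le> 4 * 1 * (x / 2)\<^sup>2" using r by (intro mult_mono) auto
  also have "\<dots> = x\<^sup>2" by (simp add: power2_eq_square)
  also have "x\<^sup>2 \<le> (1 - r)\<^sup>2" using t r by (simp add: x_def abs_le_square_iff[symmetric])
  finally have den: "(1 - r)\<^sup>2 + 4 * r * (sin (x / 2))\<^sup>2 \<le> 2 * (1 - r)\<^sup>2" by simp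
  have "1 / (2 * (1 - r)) = (1 - r) / (2 * (1 - r)\<^sup>2)" using r by (simp add: power2_eq_square)
  also have "\<dots> \<le> (1 - r\<^sup>2) / ((1 - r)\<^sup>2 + 4 * r * (sin (x / 2))\<^sup>2)"
  proof (rule frac_le)
    show "1 - r \<le> 1 - r\<^sup>2" using r by (simp add: power2_eq_square mult_left_le)
    then show "0 \<le> 1 - r\<^sup>2" using r by simp
    show "0 < (1 - r)\<^sup>2 + 4 * r * (sin (x / 2))\<^sup>2" using r by (intro add_pos_nonneg) auto
  qed (use den in auto)
  finally show ?thesis unfolding poisson_kernel_def cmod_cis_minus_sq x_def .
qed

lemma poisson_kernel_nonneg: "0 \<le> r \<Longrightarrow> r < 1 \<Longrightarrow> 0 \<le> poisson_kernel r \<theta> t"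
  unfolding poisson_kernel_def by (auto simp: power_le_one abs_square_le_1)

lemma continuous_on_poisson_kernel:
  assumes "0 \<le> r" "r < 1" shows "continuous_on UNIV (poisson_kernel r \<theta>)"
proof -
  have "(1 - r)\<^sup>2 + 4 * r * (sin ((t - \<theta>) / 2))\<^sup>2 \<noteq> 0" for t
  proof -
    have "0 < (1 - r)\<^sup>2 + 4 * r * (sin ((t - \<theta>) / 2))\<^sup>2" using assms by (intro add_pos_nonneg) auto
    then show ?thesis by simp
  qed
  then show ?thesis unfolding poisson_kernel_def cmod_cis_minus_sq by (intro continuous_intros) auto
qed

lemma poisson_kernel_bounded:
  assumes "0 \<le> r" "r < 1" shows "\<bar>poisson_kernel r \<theta> t\<bar> \<le> 1 / (1 - r)\<^sup>2"
proof -
  have "1 - r\<^sup>2 \<ge> 0" using assms by (simp add: abs_square_le_1)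
  then have "\<bar>poisson_kernel r \<theta> t\<bar> = poisson_kernel r \<theta> t"
    using poisson_kernel_nonneg[OF assms] by simp
  also have "\<dots> \<le> 1 / (1 - r)\<^sup>2" unfolding poisson_kernel_def cmod_cis_minus_sq
    by (rule frac_le) (use assms in auto)
  finally show ?thesis .
qed

lemma integrable_mult_poisson_kernel:
  assumes k: "integrable lebesgue (k :: real \<Rightarrow> real)" and r: "0 \<le> r" "r < 1"
  shows "integrable lebesgue (\<lambda>t. poisson_kernel r \<theta> t * k t)"
proof (rule Bochner_Integration.integrable_bound)
  show "integrable lebesgue (\<lambda>t. 1 / (1 - r)\<^sup>2 * k t)" using k by (rule integrable_mult_right)
  have "poisson_kernel r \<theta> \<in> borel_measurable lebesgue"
    using continuous_on_poisson_kernel[OF r] by (intro measurable_completion) (simp add: borel_measurable_continuous_onI)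
  then show "(\<lambda>t. poisson_kernel r \<theta> t * k t) \<in> borel_measurable lebesgue"
    using borel_measurable_integrable[OF k] by (rule borel_measurable_times)
  show "AE t in lebesgue. norm (poisson_kernel r \<theta> t * k t) \<le> norm (1 / (1 - r)\<^sup>2 * k t)"
  proof (rule AE_I2)
    fix t
    have "norm (poisson_kernel r \<theta> t * k t) = \<bar>poisson_kernel r \<theta> t\<bar> * \<bar>k t\<bar>" by (simp add: abs_mult)
    also have "\<dots> \<le> 1 / (1 - r)\<^sup>2 * \<bar>k t\<bar>" using poisson_kernel_bounded[OF r] by (intro mult_right_mono) auto
    also have "\<dots> = norm (1 / (1 - r)\<^sup>2 * k t)" using r by (simp add: abs_mult)
    finally show "norm (poisson_kernel r \<theta> t * k t) \<le> norm (1 / (1 - r)\<^sup>2 * k t)" .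
  qed
qed

text \<open>Within distance d the dyadic majorant turns small averages into a geometric sum of at
  most 128 \<eta>; farther away the kernel tends to 0 with r and adds at most \<eta>. The constant
  200 is a round number above 129.\<close>

lemma poisson_integral_small:
  fixes k :: "real \<Rightarrow> real"
  assumes k: "integrable lebesgue k" "\<And>x. 0 \<le> k x" "\<And>x. x \<notin> {0..2*pi} \<Longrightarrow> k x = 0"
    and \<theta>: "0 < \<theta>" "\<theta> < 2 * pi" and \<eta>: "\<eta> > 0"
    and small: "d0 > 0" "\<And>s. 0 < s \<Longrightarrow> s < d0 \<Longrightarrow> (LINT y:cball \<theta> s|lebesgue. k y) \<le> \<eta> * s"
  shows "\<exists>\<rho><1. \<forall>r. \<rho> < r \<and> r < 1 \<longrightarrow> (LINT t|lebesgue. poisson_kernel r \<theta> t * k t) \<le> 200 * \<eta>"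
proof -
  \<comment> \<open>The term d0 / 4 keeps the largest dyadic ball within the range of the hypothesis
    on averages, 1 / 4 admits the near estimate, and the distances to 0 and 2 pi admit the far
    estimate.\<close>
  define d where "d = min (min (d0 / 4) (1 / 4)) (min \<theta> (2 * pi - \<theta>))"
  have d: "0 < d" "d \<le> d0 / 4" "d \<le> 1/4" "d \<le> \<theta>" "\<theta> \<le> 2 * pi - d" "d < pi"
    using \<theta> small(1) pi_gt3 by (auto simp: d_def min_def)
  define S where "S = (sin (d / 2))\<^sup>2"
  have S: "S > 0" using sin_gt_zero[of "d/2"] d by (simp add: S_def)
  define I where "I = (LINT t|lebesgue. k t)"
  have I: "0 \<le> I" unfolding I_def using k by (intro Bochner_Integration.integral_nonneg) auto
  \<comment> \<open>The three terms ensure r \<ge> 1/2, 1 - r < d and a far contribution of at most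
    \<eta>.\<close>
  define \<rho> where "\<rho> = max (1 / 2) (max (1 - d) (1 - \<eta> * S / (I + 1)))"
  have "\<rho> < 1" using d S I \<eta> by (auto simp: \<rho>_def)
  moreover have "(LINT t|lebesgue. poisson_kernel r \<theta> t * k t) \<le> 200 * \<eta>" if r: "\<rho> < r" "r < 1" for r
  proof -
    define e where "e = 1 - r"
    have e: "0 < e" "e < d" "e * I / S \<le> \<eta>" "1/2 \<le> r" "0 \<le> r"
    proof -
      show "0 < e" "e < d" "1/2 \<le> r" "0 \<le> r" using r by (auto simp: e_def \<rho>_def)
      have "e < \<eta> * S / (I + 1)" using r by (auto simp: e_def \<rho>_def)
      then have "e * (I + 1) < \<eta> * S" using I by (simp add: field_simps)
      then have "e * I \<le> \<eta> * S" using \<open>0 < e\<close> by (simp add: field_simps)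
      then show "e * I / S \<le> \<eta>" using S by (simp add: field_simps)
    qed
    obtain M where "d / e < real M" using reals_Archimedean2 by blast
    also have "real M < 2 ^ M" by (rule of_nat_less_two_power)
    finally have "d \<le> 2 ^ M * e" using e by (simp add: field_simps)
    define N where "N = (LEAST N. d \<le> 2 ^ N * e)"
    have N: "d \<le> 2 ^ N * e" unfolding N_def using \<open>d \<le> 2 ^ M * e\<close> by (rule LeastI)
    have N2: "2 ^ N * e < d0"
    proof (cases N)
      case 0 then show ?thesis using e d by simp
    next
      case (Suc j)
      then have "\<not> d \<le> 2 ^ j * e" using not_less_Least[of j "\<lambda>N. d \<le> 2 ^ N * e"] by (simp add: N_def)
      then show ?thesis using Suc d by simp
    qed
    define J where "J = (\<lambda>i. LINT y:cball \<theta> (2 ^ i * e)|lebesgue. k y)"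
    have iJ: "integrable lebesgue (\<lambda>t. indicator (cball \<theta> (2 ^ i * e)) t * k t)" for i
      using integrable_mult_indicator[OF _ k(1), of "cball \<theta> (2 ^ i * e)"] by simp
    have pt: "poisson_kernel r \<theta> t * k t \<le>
       (\<Sum>i\<le>N. 64 / 4 ^ i / e * (indicator (cball \<theta> (2 ^ i * e)) t * k t)) + e / S * k t" for t
    proof (cases "t \<in> {0..2*pi}")
      case False then show ?thesis using k(3) by simp
    next
      case True
      have nn: "0 \<le> (\<Sum>i\<le>N. 64 / 4 ^ i / e * (indicator (cball \<theta> (2 ^ i * e)) t * k t))"
        using e k by (intro sum_nonneg) auto
      show ?thesis
      proof (cases "\<bar>t - \<theta>\<bar> \<le> d")
        case True
        have "poisson_kernel r \<theta> t \<le> 16 * (e / (e\<^sup>2 + (t - \<theta>)\<^sup>2))"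
          unfolding e_def by (rule poisson_kernel_le_near) (use True d e r in auto)
        also have "e / (e\<^sup>2 + (t - \<theta>)\<^sup>2) \<le> (\<Sum>i\<le>N. 4 / 4 ^ i / e * indicator (cball 0 (2 ^ i * e)) (t - \<theta>))"
          by (rule inverse_quadratic_le_dyadic) (use e True N in auto)
        finally have "poisson_kernel r \<theta> t \<le> (\<Sum>i\<le>N. 64 / 4 ^ i / e * indicator (cball \<theta> (2 ^ i * e)) t)"
          by (simp add: sum_distrib_left indicator_def dist_real_def abs_minus_commute)
        then have "poisson_kernel r \<theta> t * k t \<le> (\<Sum>i\<le>N. 64 / 4 ^ i / e * indicator (cball \<theta> (2 ^ i * e)) t) * k t"
          using k by (intro mult_right_mono)
        also have "\<dots> = (\<Sum>i\<le>N. 64 / 4 ^ i / e * (indicator (cball \<theta> (2 ^ i * e)) t * k t))"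
          by (simp add: sum_distrib_right mult.assoc)
        finally show ?thesis using e S k(2)[of t] by (simp add: add_increasing2)
      next
        case False
        have "poisson_kernel r \<theta> t \<le> e / S" unfolding e_def S_def
          by (rule poisson_kernel_le_far) (use False True d e r in auto)
        then have "poisson_kernel r \<theta> t * k t \<le> e / S * k t" using k by (intro mult_right_mono)
        then show ?thesis using nn by simp
      qed
    qed
    have "(LINT t|lebesgue. poisson_kernel r \<theta> t * k t) \<le>
      (LINT t|lebesgue. (\<Sum>i\<le>N. 64 / 4 ^ i / e * (indicator (cball \<theta> (2 ^ i * e)) t * k t)) + e / S * k t)"
      using pt k(1) iJ e r by (intro integral_mono integrable_mult_poisson_kernel Bochner_Integration.integrable_add
        Bochner_Integration.integrable_sum integrable_mult_right) auto
    also have "\<dots> = (\<Sum>i\<le>N. 64 / 4 ^ i / e * J i) + e / S * I"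
    proof (subst Bochner_Integration.integral_add)
      show "integrable lebesgue (\<lambda>t. \<Sum>i\<le>N. 64 / 4 ^ i / e * (indicator (cball \<theta> (2 ^ i * e)) t * k t))"
        using iJ by (intro Bochner_Integration.integrable_sum integrable_mult_right)
      show "integrable lebesgue (\<lambda>t. e / S * k t)" using k(1) by (rule integrable_mult_right)
      show "(LINT t|lebesgue. (\<Sum>i\<le>N. 64 / 4 ^ i / e * (indicator (cball \<theta> (2 ^ i * e)) t * k t))) + (LINT t|lebesgue. e / S * k t) =
        (\<Sum>i\<le>N. 64 / 4 ^ i / e * J i) + e / S * I"
        using iJ by (subst Bochner_Integration.integral_sum) (auto simp: J_def I_def set_lebesgue_integral_def)
    qed
    also have "(\<Sum>i\<le>N. 64 / 4 ^ i / e * J i) \<le> (\<Sum>i\<le>N. 64 * \<eta> * (1/2) ^ i)"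
    proof (rule sum_mono)
      fix i assume "i \<in> {..N}"
      then have "(2::real) ^ i * e \<le> 2 ^ N * e" using e by (intro mult_right_mono power_increasing) auto
      then have "2 ^ i * e < d0" using N2 by linarith
      then have "J i \<le> \<eta> * (2 ^ i * e)" unfolding J_def using e by (intro small(2)) auto
      then have "64 / 4 ^ i / e * J i \<le> 64 / 4 ^ i / e * (\<eta> * (2 ^ i * e))" using e by (intro mult_left_mono) auto
      also have "\<dots> = 64 * \<eta> * (2 ^ i / 4 ^ i)" using e by simp
      also have "(2::real) ^ i / 4 ^ i = (1/2) ^ i" by (simp add: power_divide[symmetric])
      finally show "64 / 4 ^ i / e * J i \<le> 64 * \<eta> * (1/2) ^ i" .
    qed
    also have "\<dots> = 64 * \<eta> * (\<Sum>i\<le>N. (1/2) ^ i)" by (simp add: sum_distrib_left)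
    also have "(\<Sum>i\<le>N. (1/2::real) ^ i) \<le> 2"
    proof -
      have "(\<Sum>i\<le>N. (1/2::real) ^ i) = 2 - (1/2) ^ N" by (induction N) auto
      then show ?thesis by simp
    qed
    finally show ?thesis using e \<eta> by (simp add: mult.commute)
  qed
  ultimately show ?thesis by blast
qed

text \<open>For a level 0 < c < g \<theta> the deficit \<open>k c\<close>, the positive part of c -
  g, vanishes at \<theta>. For almost every such \<theta> its averages are small, so its Poisson
  integral drops to c / 2 or less near the boundary. Since g + k c \<ge> c throughout, the Poisson
  integral of the sum is at least c there, which leaves at least c / 2 for g.\<close>

theorem AE_poisson_integral_pos:
  fixes g :: "real \<Rightarrow> real"
  assumes g: "set_integrable lebesgue {0..2*pi} g"
  shows "AE \<theta> in lebesgue. \<theta> \<in> {0<..<2*pi} \<and> 0 < g \<theta> \<longrightarrow>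
    (\<exists>\<rho><1. \<forall>r. \<rho> < r \<and> r < 1 \<longrightarrow> 0 < (LINT t:{0..2*pi}|lebesgue. poisson_kernel r \<theta> t * g t))"
proof -
  have gm: "(\<lambda>t. indicator {0..2*pi} t * g t) \<in> borel_measurable lebesgue" and gi: "integrable lebesgue (\<lambda>t. indicator {0..2*pi} t * g t)"
    using g unfolding set_integrable_def by (auto dest: borel_measurable_integrable)
  define E where "E = (\<lambda>c::real. {t\<in>{0..2*pi}. c \<le> g t})"
  define k where "k = (\<lambda>(c::real) t. indicator {0..2*pi} t * max 0 (c - g t))"
  have ki: "integrable lebesgue (k c)" for c
  proof -
    have "integrable lebesgue (\<lambda>t. max 0 (indicator {0..2*pi} t * c - indicator {0..2*pi} t * g t))"
      by (intro integrable_max Bochner_Integration.integrable_diff gi integrable_mult_left) auto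
    also have "(\<lambda>t. max 0 (indicator {0..2*pi} t * c - indicator {0..2*pi} t * g t)) = k c"
      by (auto simp: k_def indicator_def fun_eq_iff)
    finally show ?thesis .
  qed
  have Em: "E c \<in> sets lebesgue" for c
  proof -
    have "E c = {0..2*pi} \<inter> {t \<in> space lebesgue. c \<le> indicator {0..2*pi} t * g t}"
      by (auto simp: E_def indicator_def)
    moreover have "{t \<in> space lebesgue. c \<le> indicator {0..2*pi} t * g t} \<in> sets lebesgue"
      using gm by measurable
    ultimately show ?thesis by auto
  qed
  define B where "B = (\<lambda>c l. {x\<in>E c. \<forall>d>0. \<exists>s. 0 < s \<and> s < d \<and> l * s < (LINT y:cball x s|lebesgue. k c y)})"
  have neg: "negligible (B c l)" if "l > 0" for c l
    unfolding B_def by (rule negligible_large_averages[OF ki _ Em _ that]) (auto simp: k_def E_def)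
  \<comment> \<open>Rational levels keep the union of exceptional sets countable; q / 400 is half
    the level divided by the constant 200 of \<open>poisson_integral_small\<close>.\<close>
  define X where "X = (\<Union>q\<in>{q\<in>\<rat>. 0 < q}. B q (q / 400))"
  have "negligible X" unfolding X_def
    by (rule negligible_countable_Union) (auto intro!: neg countable_image countable_subset[OF _ countable_rat])
  then have "AE \<theta> in lebesgue. \<theta> \<notin> X" by (intro AE_not_in) (simp add: negligible_iff_null_sets)
  then show ?thesis
  proof eventually_elim
    case (elim \<theta>)
    show ?case
    proof
      assume \<theta>: "\<theta> \<in> {0<..<2*pi} \<and> 0 < g \<theta>"
      obtain c where c: "c \<in> \<rat>" "0 < c" "c < g \<theta>" using Rats_dense_in_real \<theta> by blast
      have "\<theta> \<notin> B c (c / 400)" using elim c by (auto simp: X_def)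
      then obtain d0 where d0: "d0 > 0" "\<And>s. 0 < s \<Longrightarrow> s < d0 \<Longrightarrow> (LINT y:cball \<theta> s|lebesgue. k c y) \<le> c / 400 * s"
      proof -
        have "\<theta> \<in> E c" using \<theta> c by (auto simp: E_def)
        then have "\<not> (\<forall>d>0. \<exists>s. 0 < s \<and> s < d \<and> c / 400 * s < (LINT y:cball \<theta> s|lebesgue. k c y))"
          using \<open>\<theta> \<notin> B c (c / 400)\<close> unfolding B_def by blast
        then show ?thesis using that by (meson not_less)
      qed
      have "\<exists>\<rho><1. \<forall>r. \<rho> < r \<and> r < 1 \<longrightarrow> (LINT t|lebesgue. poisson_kernel r \<theta> t * k c t) \<le> 200 * (c / 400)"
        by (rule poisson_integral_small[OF ki _ _ _ _ _ d0]) (use c \<theta> in \<open>auto simp: k_def\<close>)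
      then obtain \<rho> where \<rho>: "\<rho> < 1" "\<And>r. \<rho> < r \<Longrightarrow> r < 1 \<Longrightarrow> (LINT t|lebesgue. poisson_kernel r \<theta> t * k c t) \<le> c / 2"
        by auto
      \<comment> \<open>Beyond this radius the interval of half-length 1 - r around \<theta> lies
        inside [0, 2 pi].\<close>
      define \<rho>' where "\<rho>' = max (max \<rho> 0) (1 - min \<theta> (2 * pi - \<theta>))"
      have "\<rho>' < 1" using \<rho> \<theta> by (auto simp: \<rho>'_def)
      moreover have "0 < (LINT t:{0..2*pi}|lebesgue. poisson_kernel r \<theta> t * g t)" if r: "\<rho>' < r" "r < 1" for r
      proof -
        have r': "0 \<le> r" "\<rho> < r" "1 - r \<le> \<theta>" "\<theta> \<le> 2 * pi - (1 - r)" using r by (auto simp: \<rho>'_def)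
        define e where "e = 1 - r"
        have e: "0 < e" using r by (simp add: e_def)
        define h where "h = (\<lambda>t. c * (1 / (2 * e)) * indicator (cball \<theta> e) t)"
        have hi: "integrable lebesgue h" unfolding h_def cball_eq_atLeastAtMost
          by (intro integrable_mult_right integrable_real_indicator) (auto simp: emeasure_lborel_Icc_eq)
        have hI: "(LINT t|lebesgue. h t) = c"
          unfolding h_def using e by (simp add: cball_eq_atLeastAtMost)
        have pi: "integrable lebesgue (\<lambda>t. poisson_kernel r \<theta> t * (indicator {0..2*pi} t * g t))"
          by (rule integrable_mult_poisson_kernel[OF gi]) (use r' r in auto)
        have pk: "integrable lebesgue (\<lambda>t. poisson_kernel r \<theta> t * k c t)"
          by (rule integrable_mult_poisson_kernel[OF ki]) (use r' r in auto)
        have "c = (LINT t|lebesgue. h t)" using hI by simp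
        also have "\<dots> \<le> (LINT t|lebesgue. poisson_kernel r \<theta> t * (indicator {0..2*pi} t * g t) + poisson_kernel r \<theta> t * k c t)"
        proof (rule integral_mono[OF hi Bochner_Integration.integrable_add[OF pi pk]])
          fix t
          have p0: "0 \<le> poisson_kernel r \<theta> t" by (rule poisson_kernel_nonneg) (use r' r in auto)
          show "h t \<le> poisson_kernel r \<theta> t * (indicator {0..2*pi} t * g t) + poisson_kernel r \<theta> t * k c t"
          proof (cases "t \<in> {0..2*pi}")
            case True
            have "h t \<le> poisson_kernel r \<theta> t * c"
            proof (cases "t \<in> cball \<theta> e")
              case True
              then have "1 / (2 * e) \<le> poisson_kernel r \<theta> t" unfolding e_def
                by (intro poisson_kernel_ge_near) (use r' r in \<open>auto simp: dist_real_def e_def\<close>)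
              then have "c * (1 / (2 * e)) \<le> c * poisson_kernel r \<theta> t" using c by (intro mult_left_mono) auto
              then show ?thesis using True by (simp add: h_def mult.commute)
            qed (use p0 c in \<open>simp add: h_def\<close>)
            also have "\<dots> \<le> poisson_kernel r \<theta> t * (g t + max 0 (c - g t))" using p0 by (intro mult_left_mono) auto
            finally show ?thesis using True by (simp add: k_def distrib_left)
          next
            case False
            then have "t \<notin> cball \<theta> e" using r' by (auto simp: e_def dist_real_def)
            then show ?thesis using False by (simp add: h_def k_def)
          qed
        qed
        also have "\<dots> = (LINT t|lebesgue. poisson_kernel r \<theta> t * (indicator {0..2*pi} t * g t)) + (LINT t|lebesgue. poisson_kernel r \<theta> t * k c t)"
          by (rule Bochner_Integration.integral_add[OF pi pk])
        also have "\<dots> \<le> (LINT t|lebesgue. poisson_kernel r \<theta> t * (indicator {0..2*pi} t * g t)) + c / 2"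
          using \<rho>(2)[OF r'(2) r(2)] by simp
        finally have "0 < (LINT t|lebesgue. poisson_kernel r \<theta> t * (indicator {0..2*pi} t * g t))" using c by simp
        then show ?thesis unfolding set_lebesgue_integral_def by (simp add: mult.left_commute)
      qed
      ultimately show "\<exists>\<rho><1. \<forall>r. \<rho> < r \<and> r < 1 \<longrightarrow> 0 < (LINT t:{0..2*pi}|lebesgue. poisson_kernel r \<theta> t * g t)" by blast
    qed
  qed
qed

subsection \<open>Poisson integrals as real parts of power series\<close>

lemma Re_herglotz: "x \<noteq> 1 \<Longrightarrow> Re ((1 + x) / (1 - x)) = (1 - (cmod x)\<^sup>2) / (cmod (1 - x))\<^sup>2"
  unfolding Re_divide cmod_power2 by (simp add: power2_eq_square algebra_simps)

lemma herglotz_sums: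
  fixes x :: complex assumes "cmod x < 1"
  shows "(\<lambda>k. (if k = 0 then 1 else 2) * x ^ k) sums ((1 + x) / (1 - x))"
proof -
  have "x \<noteq> 1" using assms by auto
  have "(\<lambda>k. 2 * x ^ k) sums (2 * (1 / (1 - x)))" by (intro sums_mult geometric_sums assms)
  moreover have "(\<lambda>k. if k = 0 then - 1 else (0::complex)) sums (-1)" using sums_single[of 0 "\<lambda>_. -1::complex"] by simp
  ultimately have "(\<lambda>k. 2 * x ^ k + (if k = 0 then - 1 else 0)) sums (2 * (1 / (1 - x)) + (-1))" by (rule sums_add)
  also have "(\<lambda>k. 2 * x ^ k + (if k = 0 then - 1 else 0)) = (\<lambda>k. (if k = 0 then 1 else 2) * x ^ k)" by auto
  also have "2 * (1 / (1 - x)) + (-1) = (1 + x) / (1 - x)" using \<open>x \<noteq> 1\<close> by (simp add: field_simps)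
  finally show ?thesis .
qed

text \<open>The Poisson kernel is the real part of the Herglotz kernel (1 + x) / (1 - x) with x = (z
  / r) cis (- \<theta>). Integrating its expansion term by term yields a power series whose
  coefficients are Fourier moments of g; only the constant term lacks the factor 2.\<close>

lemma Poisson_integral_series:
  fixes g :: "complex \<Rightarrow> real" and M :: "int \<Rightarrow> complex"
  assumes g: "L1_circle r g" and r: "r > 0"
    and M: "\<And>k. M k = (LINT \<theta>:{0..2*pi}|lebesgue. complex_of_real (g (complex_of_real r * cis \<theta>)) * cis (- of_int k * \<theta>))"
  obtains f where "f holomorphic_on ball 0 r"
    "\<And>z. z \<in> ball 0 r \<Longrightarrow> (\<lambda>k. (if k = 0 then M 0 / (2 * pi) else M (int k) / (pi * r ^ k)) * z ^ k) sums f z"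
    "\<And>z. z \<in> ball 0 r \<Longrightarrow> Poisson_integral r g z = Re (f z)"
proof -
  define A where "A = {0..2*pi}"
  define G where "G = (\<lambda>\<theta>. g (complex_of_real r * cis \<theta>))"
  define c where "c = (\<lambda>k. if k = 0 then M 0 / (2 * pi) else M (int k) / (pi * r ^ k))"
  define f where "f = (\<lambda>z. \<Sum>k. c k * z ^ k)"
  have Gi: "integrable lebesgue (\<lambda>\<theta>. indicator A \<theta> *\<^sub>R G \<theta>)"
    using g by (simp add: L1_circle_def set_integrable_def A_def G_def)
  have main: "(\<lambda>k. c k * z ^ k) sums f z \<and> Poisson_integral r g z = Re (f z)" if z: "z \<in> ball 0 r" for z
  proof -
    define w where "w = z / r"
    have w: "cmod w < 1" using z r by (simp add: w_def norm_divide)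
    define d where "d = (\<lambda>k::nat. if k = 0 then 1 else 2 :: complex)"
    define F where "F = (\<lambda>k \<theta>. complex_of_real (indicator A \<theta> *\<^sub>R G \<theta>) * (d k * (w * cis (- \<theta>)) ^ k))"
    have meas: "(\<lambda>\<theta>. d k * (w * cis (- \<theta>)) ^ k) \<in> borel_measurable lebesgue" for k
      by (intro measurable_completion) (auto intro!: borel_measurable_continuous_onI continuous_intros)
    have nF: "norm (F k \<theta>) \<le> 2 * cmod w ^ k * \<bar>indicator A \<theta> *\<^sub>R G \<theta>\<bar>" for k \<theta>
      by (auto simp: F_def d_def norm_mult norm_power indicator_def)
    have Fi: "integrable lebesgue (F k)" for k
    proof (rule Bochner_Integration.integrable_bound)
      show "integrable lebesgue (\<lambda>\<theta>. 2 * cmod w ^ k * \<bar>indicator A \<theta> *\<^sub>R G \<theta>\<bar>)"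
        using Gi by (intro integrable_mult_right integrable_abs)
      have "(\<lambda>\<theta>. complex_of_real (indicator A \<theta> *\<^sub>R G \<theta>)) \<in> borel_measurable lebesgue"
        using borel_measurable_integrable[OF Gi] by measurable
      then show "F k \<in> borel_measurable lebesgue" unfolding F_def by (rule borel_measurable_times[OF _ meas])
      show "AE \<theta> in lebesgue. norm (F k \<theta>) \<le> norm (2 * cmod w ^ k * \<bar>indicator A \<theta> *\<^sub>R G \<theta>\<bar>)"
        using nF by (auto simp: abs_mult)
    qed
    have wc: "cmod (w * cis (- \<theta>)) < 1" for \<theta> using w by (simp add: norm_mult)
    have Fs: "(\<lambda>k. F k \<theta>) sums (complex_of_real (indicator A \<theta> *\<^sub>R G \<theta>) * ((1 + w * cis (- \<theta>)) / (1 - w * cis (- \<theta>))))" for \<theta>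
      unfolding F_def d_def by (intro sums_mult herglotz_sums wc)
    have "(\<lambda>k. integral\<^sup>L lebesgue (F k)) sums (LINT \<theta>|lebesgue. (\<Sum>k. F k \<theta>))"
    proof (rule sums_integral[OF Fi])
      show "AE \<theta> in lebesgue. summable (\<lambda>k. norm (F k \<theta>))"
      proof (rule AE_I2)
        fix \<theta>
        have "summable (\<lambda>k. 2 * cmod w ^ k * \<bar>indicator A \<theta> *\<^sub>R G \<theta>\<bar>)"
          using w by (intro summable_mult2 summable_mult summable_geometric) simp
        then show "summable (\<lambda>k. norm (F k \<theta>))" by (rule summable_comparison_test'[where N=0]) (use nF in auto)
      qed
      have "summable (\<lambda>k. 2 * cmod w ^ k * (LINT \<theta>|lebesgue. \<bar>indicator A \<theta> *\<^sub>R G \<theta>\<bar>))"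
        using w by (intro summable_mult2 summable_mult summable_geometric) simp
      then show "summable (\<lambda>k. LINT \<theta>|lebesgue. norm (F k \<theta>))"
      proof (rule summable_comparison_test'[where N=0])
        fix k
        have "(LINT \<theta>|lebesgue. norm (F k \<theta>)) \<le> (LINT \<theta>|lebesgue. 2 * cmod w ^ k * \<bar>indicator A \<theta> *\<^sub>R G \<theta>\<bar>)"
          using Gi Fi nF by (intro integral_mono integrable_norm integrable_mult_right integrable_abs)
        also have "\<dots> = 2 * cmod w ^ k * (LINT \<theta>|lebesgue. \<bar>indicator A \<theta> *\<^sub>R G \<theta>\<bar>)" by simp
        finally show "norm (LINT \<theta>|lebesgue. norm (F k \<theta>)) \<le> 2 * cmod w ^ k * (LINT \<theta>|lebesgue. \<bar>indicator A \<theta> *\<^sub>R G \<theta>\<bar>)"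
          by simp
      qed
    qed
    moreover have "integral\<^sup>L lebesgue (F k) = 2 * pi * (c k * z ^ k)" for k
    proof -
      have "integral\<^sup>L lebesgue (F k) = (LINT \<theta>|lebesgue. d k * w ^ k * (indicator A \<theta> *\<^sub>R (complex_of_real (G \<theta>) * cis (- of_int (int k) * \<theta>))))"
        by (intro Bochner_Integration.integral_cong refl)
          (auto simp: F_def indicator_def power_mult_distrib Complex.DeMoivre)
      also have "\<dots> = d k * w ^ k * M (int k)"
        unfolding M set_lebesgue_integral_def A_def G_def by (rule integral_mult_right_zero)
      also have "\<dots> = 2 * pi * (c k * z ^ k)"
        using r by (auto simp: d_def c_def w_def power_divide)
      finally show ?thesis .
    qed
    moreover define I where "I = (LINT \<theta>|lebesgue. (\<Sum>k. F k \<theta>))"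
    ultimately have "(\<lambda>k. 2 * pi * (c k * z ^ k)) sums I" by simp
    then have "(\<lambda>k. 1 / (2 * pi) * (2 * pi * (c k * z ^ k))) sums (1 / (2 * pi) * I)" by (rule sums_mult)
    then have s: "(\<lambda>k. c k * z ^ k) sums (1 / (2 * pi) * I)" by simp
    then have fz: "f z = 1 / (2 * pi) * I" unfolding f_def by (rule sums_unique[symmetric])
    have Ii: "integrable lebesgue (\<lambda>\<theta>. \<Sum>k. F k \<theta>)"
    proof (rule integrable_suminf[OF Fi])
      show "AE \<theta> in lebesgue. summable (\<lambda>k. norm (F k \<theta>))"
      proof (rule AE_I2)
        fix \<theta>
        have "summable (\<lambda>k. 2 * cmod w ^ k * \<bar>indicator A \<theta> *\<^sub>R G \<theta>\<bar>)"
          using w by (intro summable_mult2 summable_mult summable_geometric) simp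
        then show "summable (\<lambda>k. norm (F k \<theta>))" by (rule summable_comparison_test'[where N=0]) (use nF in auto)
      qed
      have "summable (\<lambda>k. 2 * cmod w ^ k * (LINT \<theta>|lebesgue. \<bar>indicator A \<theta> *\<^sub>R G \<theta>\<bar>))"
        using w by (intro summable_mult2 summable_mult summable_geometric) simp
      then show "summable (\<lambda>k. LINT \<theta>|lebesgue. norm (F k \<theta>))"
      proof (rule summable_comparison_test'[where N=0])
        fix k
        have "(LINT \<theta>|lebesgue. norm (F k \<theta>)) \<le> (LINT \<theta>|lebesgue. 2 * cmod w ^ k * \<bar>indicator A \<theta> *\<^sub>R G \<theta>\<bar>)"
          using Gi Fi nF by (intro integral_mono integrable_norm integrable_mult_right integrable_abs)
        also have "\<dots> = 2 * cmod w ^ k * (LINT \<theta>|lebesgue. \<bar>indicator A \<theta> *\<^sub>R G \<theta>\<bar>)" by simp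
        finally show "norm (LINT \<theta>|lebesgue. norm (F k \<theta>)) \<le> 2 * cmod w ^ k * (LINT \<theta>|lebesgue. \<bar>indicator A \<theta> *\<^sub>R G \<theta>\<bar>)"
          by simp
      qed
    qed
    have "Re I = (LINT \<theta>|lebesgue. Re (\<Sum>k. F k \<theta>))"
      unfolding I_def using Ii by (simp add: integral_Re)
    also have "\<dots> = (LINT \<theta>|lebesgue. indicator A \<theta> *\<^sub>R ((r\<^sup>2 - (cmod z)\<^sup>2) / (cmod (complex_of_real r * cis \<theta> - z))\<^sup>2 * G \<theta>))"
    proof (intro Bochner_Integration.integral_cong refl)
      fix \<theta>
      define x where "x = w * cis (- \<theta>)"
      have x1: "x \<noteq> 1" using wc[of \<theta>] by (auto simp: x_def)
      have "Re (\<Sum>k. F k \<theta>) = indicator A \<theta> * G \<theta> * Re ((1 + x) / (1 - x))"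
      proof -
        have "(\<Sum>k. F k \<theta>) = complex_of_real (indicator A \<theta> *\<^sub>R G \<theta>) * ((1 + x) / (1 - x))"
          using Fs[of \<theta>] unfolding x_def by (rule sums_unique[symmetric])
        moreover have "Re (complex_of_real a * y) = a * Re y" for a y by simp
        ultimately show ?thesis by (simp only: real_scaleR_def)
      qed
      also have "Re ((1 + x) / (1 - x)) = (1 - (cmod x)\<^sup>2) / (cmod (1 - x))\<^sup>2" by (rule Re_herglotz[OF x1])
      also have "\<dots> = (r\<^sup>2 * (1 - (cmod x)\<^sup>2)) / (r\<^sup>2 * (cmod (1 - x))\<^sup>2)" using r by simp
      also have "r\<^sup>2 * (1 - (cmod x)\<^sup>2) = r\<^sup>2 - (cmod z)\<^sup>2"
        using r by (simp add: x_def w_def norm_mult norm_divide right_diff_distrib power_divide)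
      also have "r\<^sup>2 * (cmod (1 - x))\<^sup>2 = (cmod (complex_of_real r * cis \<theta> - z))\<^sup>2"
      proof -
        have "complex_of_real r * cis \<theta> - z = complex_of_real r * cis \<theta> * (1 - x)"
          using r by (simp add: x_def w_def right_diff_distrib cis_mult[symmetric] field_simps)
             (simp add: mult.assoc cis_mult)
        then show ?thesis using r by (simp add: norm_mult power_mult_distrib)
      qed
      finally show "Re (\<Sum>k. F k \<theta>) = indicator A \<theta> *\<^sub>R ((r\<^sup>2 - (cmod z)\<^sup>2) / (cmod (complex_of_real r * cis \<theta> - z))\<^sup>2 * G \<theta>)"
        by (simp add: mult_ac)
    qed
    also have "\<dots> = 2 * pi * Poisson_integral r g z"
      unfolding Poisson_integral_def set_lebesgue_integral_def G_def A_def by simp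
    finally have "Poisson_integral r g z = Re I / (2 * pi)" by simp
    also have "\<dots> = Re (f z)" unfolding fz by (simp add: Re_divide_of_real flip: of_real_mult)
    finally show ?thesis using s fz by simp
  qed
  have "f holomorphic_on ball 0 r"
    by (rule power_series_holomorphic[where a=c]) (use main in auto)
  then show ?thesis using that[of f] main unfolding c_def by blast
qed

subsection \<open>Real-analytic curves and their curvature\<close>

text \<open>With a complex parameter, velocity, acceleration and local injectivity of a curve become
  questions about one holomorphic function.\<close>

lemma real_analytic_at_iff_holomorphic:
  "real_analytic_at \<gamma> t \<longleftrightarrow>
    (\<exists>F e. e > 0 \<and> F holomorphic_on ball 0 e \<and> (\<forall>s. \<bar>s\<bar> < e \<longrightarrow> \<gamma> (t + s) = F (of_real s)))"
proof
  assume "real_analytic_at \<gamma> t"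
  then obtain a e where e: "e > 0" and a: "\<And>s. \<bar>s - t\<bar> < e \<Longrightarrow> (\<lambda>k. (s - t) ^ k *\<^sub>R a k) sums \<gamma> s"
    unfolding real_analytic_at_def by blast
  have sm: "summable (\<lambda>k. a k * w ^ k)" if "w \<in> ball 0 e" for w :: complex
  proof -
    have "cmod w < e" using that by simp
    then obtain x where x: "cmod w < x" "x < e" using dense by blast
    have "(\<lambda>k. ((t + x) - t) ^ k *\<^sub>R a k) sums \<gamma> (t + x)"
      using x norm_ge_zero[of w] by (intro a) linarith
    then have "summable (\<lambda>k. a k * (complex_of_real x) ^ k)"
      by (auto simp: sums_iff scaleR_conv_of_real mult.commute)
    then show ?thesis by (rule powser_inside) (use x norm_ge_zero[of w] in \<open>simp del: norm_ge_zero\<close>)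
  qed
  define F where "F = (\<lambda>w. \<Sum>k. a k * w ^ k)"
  have "F holomorphic_on ball 0 e"
    by (rule power_series_holomorphic[where a=a]) (use sm in \<open>auto simp: F_def summable_sums\<close>)
  moreover have "\<gamma> (t + s) = F (of_real s)" if "\<bar>s\<bar> < e" for s
    using a[of "t + s"] that by (simp add: F_def sums_iff scaleR_conv_of_real mult.commute)
  ultimately show "\<exists>F e. e > 0 \<and> F holomorphic_on ball 0 e \<and> (\<forall>s. \<bar>s\<bar> < e \<longrightarrow> \<gamma> (t + s) = F (of_real s))"
    using e by blast
next
  assume "\<exists>F e. e > 0 \<and> F holomorphic_on ball 0 e \<and> (\<forall>s. \<bar>s\<bar> < e \<longrightarrow> \<gamma> (t + s) = F (of_real s))"
  then obtain F e where e: "e > 0" and F: "F holomorphic_on ball 0 e" "\<And>s. \<bar>s\<bar> < e \<Longrightarrow> \<gamma> (t + s) = F (of_real s)"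
    by blast
  have main: "(\<lambda>k. (s - t) ^ k *\<^sub>R ((deriv ^^ k) F 0 / fact k)) sums \<gamma> s" if s: "\<bar>s - t\<bar> < e" for s
  proof -
    have "complex_of_real (s - t) \<in> ball 0 e" using s by (simp del: of_real_diff)
    from holomorphic_power_series[OF F(1) this]
    have "(\<lambda>k. (deriv ^^ k) F 0 / fact k * complex_of_real (s - t) ^ k) sums F (complex_of_real (s - t))" by simp
    moreover have "\<gamma> s = F (complex_of_real (s - t))" using F(2)[OF s] by simp
    ultimately show ?thesis by (simp add: scaleR_conv_of_real mult.commute del: of_real_diff)
  qed
  show "real_analytic_at \<gamma> t"
    unfolding real_analytic_at_def by (intro exI conjI allI impI, rule e, erule main)
qed

lemma complexification_velocity:
  assumes "e > 0" "F holomorphic_on ball 0 e" "\<And>s. \<bar>s\<bar> < e \<Longrightarrow> \<gamma> (t + s) = F (of_real s)" "\<bar>s\<bar> < e"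
  shows "(\<gamma> has_vector_derivative deriv F (of_real s)) (at (t + s))" "velocity \<gamma> (t + s) = deriv F (of_real s)"
proof -
  have "of_real s \<in> ball (0::complex) e" using assms(4) by simp
  then have "(F has_field_derivative deriv F (of_real s)) (at (of_real (t + s) - of_real t))"
    using holomorphic_derivI[OF assms(2)] by simp
  then have "((\<lambda>w. F (w - of_real t)) has_field_derivative deriv F (of_real s) * 1) (at (of_real (t + s)))"
    by (rule DERIV_chain2) (auto intro!: derivative_eq_intros)
  then have "((\<lambda>x. F (of_real x - of_real t)) has_vector_derivative deriv F (of_real s) * 1) (at (t + s))"
    by (rule has_vector_derivative_real_field)
  then have "((\<lambda>x. F (of_real x - of_real t)) has_vector_derivative deriv F (of_real s)) (at (t + s))"
    by simp
  then show v: "(\<gamma> has_vector_derivative deriv F (of_real s)) (at (t + s))"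
  proof (rule has_vector_derivative_transform_within_open[where S="{t - e <..< t + e}"])
    show "F (of_real x - of_real t) = \<gamma> x" if "x \<in> {t - e<..<t + e}" for x
      using assms(3)[of "x - t"] that by (simp add: abs_less_iff)
  qed (use assms(4) in \<open>auto simp: abs_less_iff\<close>)
  then show "velocity \<gamma> (t + s) = deriv F (of_real s)"
    unfolding velocity_def by (rule vector_derivative_at)
qed

lemma complexification_acceleration:
  assumes "e > 0" "F holomorphic_on ball 0 e" "\<And>s. \<bar>s\<bar> < e \<Longrightarrow> \<gamma> (t + s) = F (of_real s)"
  shows "acceleration \<gamma> t = deriv (deriv F) 0"
proof -
  have "deriv F holomorphic_on ball 0 e" using assms(2) by (intro holomorphic_deriv) auto
  moreover have "velocity \<gamma> (t + s) = deriv F (of_real s)" if "\<bar>s\<bar> < e" for s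
    using complexification_velocity(2)[OF assms that] .
  ultimately have "velocity (velocity \<gamma>) (t + 0) = deriv (deriv F) (of_real 0)"
    using assms(1) by (intro complexification_velocity(2)[of e "deriv F" "velocity \<gamma>"]) auto
  then show ?thesis by (simp add: acceleration_def velocity_def)
qed

lemma real_analytic_at_has_velocity:
  assumes "real_analytic_at \<gamma> t"
  shows "(\<gamma> has_vector_derivative velocity \<gamma> t) (at t)"
proof -
  obtain F e where F: "e > 0" "F holomorphic_on ball 0 e" "\<And>s. \<bar>s\<bar> < e \<Longrightarrow> \<gamma> (t + s) = F (of_real s)"
    using assms unfolding real_analytic_at_iff_holomorphic by blast
  show ?thesis using complexification_velocity[OF F, of 0] F(1) by simp
qed

text \<open>Dividing the curve by its parameter removes the factor \<open>s ^ n\<close> from \<open>f (\<gamma> s)\<close>; the two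
  relations are the value and the first derivative of the real part of the quotient at \<open>s = 0\<close>.\<close>

lemma nodal_curve_jet:
  assumes \<gamma>: "real_analytic_at \<gamma> t" "\<gamma> t = 0" "velocity \<gamma> t \<noteq> 0"
    and h: "h holomorphic_on ball 0 R" "R > 0"
    and d: "d > 0" "\<And>s. \<bar>s - t\<bar> < d \<Longrightarrow> Re (\<gamma> s ^ n * h (\<gamma> s)) = 0" and n: "n \<ge> 1"
  shows "Re (h 0 * velocity \<gamma> t ^ n) = 0"
    "real n * Re (h 0 * velocity \<gamma> t ^ n * (acceleration \<gamma> t / velocity \<gamma> t)) / 2 = - Re (deriv h 0 * velocity \<gamma> t ^ (n + 1))"
proof -
  obtain F e where F: "e > 0" "F holomorphic_on ball 0 e" "\<And>s. \<bar>s\<bar> < e \<Longrightarrow> \<gamma> (t + s) = F (of_real s)"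
    using \<gamma>(1) unfolding real_analytic_at_iff_holomorphic by blast
  define v where "v = velocity \<gamma> t"
  define Z where "Z = (\<lambda>w. if w = 0 then deriv F 0 else (F w - F 0) / (w - 0))"
  have Z: "Z holomorphic_on ball 0 e" unfolding Z_def by (rule pole_lemma_open[OF F(2)]) auto
  have F0: "F 0 = 0" using F(3)[of 0] F(1) \<gamma>(2) by simp
  have FZ: "F w = w * Z w" for w by (simp add: Z_def F0)
  have v: "v = Z 0" using complexification_velocity(2)[OF F, of 0] F(1) by (simp add: v_def Z_def)
  have Zd: "(Z has_field_derivative deriv Z w) (at w)" if "w \<in> ball 0 e" for w
    using holomorphic_derivI[OF Z _ that] by simp
  have dF: "deriv F w = Z w + w * deriv Z w" if "w \<in> ball 0 e" for w
  proof (rule DERIV_imp_deriv)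
    have "((\<lambda>w. w * Z w) has_field_derivative (Z w + w * deriv Z w)) (at w)"
      using Zd[OF that] by (auto intro!: derivative_eq_intros)
    then show "(F has_field_derivative (Z w + w * deriv Z w)) (at w)"       using ext[of F "\<lambda>w. w * Z w", OF FZ] by simp
  qed
  have acc: "acceleration \<gamma> t = 2 * deriv Z 0"
  proof -
    have "deriv (deriv F) 0 = deriv (\<lambda>w. Z w + w * deriv Z w) 0"
    proof (rule deriv_cong_ev)
      have "eventually (\<lambda>w. w \<in> ball (0::complex) e) (nhds 0)" using F(1) by (intro eventually_nhds_in_open) auto
      then show "eventually (\<lambda>w. deriv F w = Z w + w * deriv Z w) (nhds 0)" by eventually_elim (rule dF)
    qed simp
    also have "\<dots> = 2 * deriv Z 0"
    proof (rule DERIV_imp_deriv)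
      have "deriv Z holomorphic_on ball 0 e" using Z by (intro holomorphic_deriv) auto
      then have "(deriv Z has_field_derivative deriv (deriv Z) 0) (at 0)"
        using F(1) by (intro holomorphic_derivI) auto
      then show "((\<lambda>w. Z w + w * deriv Z w) has_field_derivative 2 * deriv Z 0) (at 0)"
        using Zd[of 0] F(1) by (auto intro!: derivative_eq_intros)
    qed
    finally show ?thesis using complexification_acceleration[OF F] by simp
  qed
  define q where "q = (\<lambda>w. Z w ^ n * h (F w))"
  have hd: "(h has_field_derivative deriv h 0) (at (F 0))"
    using holomorphic_derivI[OF h(1), of 0] h(2) by (simp add: F0)
  have Fd: "(F has_field_derivative v) (at 0)"
    using holomorphic_derivI[OF F(2), of 0] F(1) by (simp add: v dF)
  have hF: "((\<lambda>w. h (F w)) has_field_derivative deriv h 0 * v) (at 0)"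
    using DERIV_chain2[OF hd Fd] .
  define q' where "q' = of_nat n * v ^ (n - 1) * deriv Z 0 * h 0 + v ^ n * (deriv h 0 * v)"
  have qd: "(q has_field_derivative q') (at 0)"
    unfolding q_def q'_def using Zd[of 0] F(1) hF
    by (auto intro!: derivative_eq_intros simp: v[symmetric] F0 algebra_simps)
  have qs: "((\<lambda>s. q (of_real s)) has_vector_derivative q') (at 0)"
    by (rule has_vector_derivative_real_field) (use qd in simp)
  have rq: "((\<lambda>s. Re (q (of_real s))) has_real_derivative Re q') (at 0)"
    using bounded_linear.has_vector_derivative[OF bounded_linear_Re qs] by (simp add: has_real_derivative_iff_has_vector_derivative)
  define d' where "d' = min d e"
  have d': "d' > 0" using d(1) F(1) by (simp add: d'_def)
  have z: "Re (q (of_real s)) = 0" if "s \<noteq> 0" "\<bar>s\<bar> < d'" for s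
  proof -
    have "Re (\<gamma> (t + s) ^ n * h (\<gamma> (t + s))) = 0" using d(2)[of "t + s"] that by (simp add: d'_def)
    also have "\<gamma> (t + s) = of_real s * Z (of_real s)" using F(3)[of s] that FZ by (simp add: d'_def)
    also have "(of_real s * Z (of_real s)) ^ n * h (of_real s * Z (of_real s)) = of_real (s ^ n) * q (of_real s)"
      by (simp add: q_def FZ power_mult_distrib)
    also have "Re \<dots> = s ^ n * Re (q (of_real s))" by simp
    finally show ?thesis using that by simp
  qed
  have "((\<lambda>s. Re (q (of_real s))) \<longlongrightarrow> Re (q (of_real 0))) (at 0)"
    using DERIV_isCont[OF rq] by (simp add: isCont_def)
  moreover have "((\<lambda>s. Re (q (of_real s))) \<longlongrightarrow> 0) (at 0)"
  proof (rule tendsto_eventually)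
    show "eventually (\<lambda>s. Re (q (of_real s)) = 0) (at 0)"
      unfolding eventually_at using d' z by (auto simp: dist_real_def)
  qed
  ultimately have "Re (q (of_real 0)) = 0" by (intro tendsto_unique[OF at_neq_bot])
  then have q0: "Re (q 0) = 0" by simp
  then show "Re (h 0 * velocity \<gamma> t ^ n) = 0" by (simp add: q_def F0 v_def[symmetric] v mult.commute)
  have "((\<lambda>s. 0 :: real) has_real_derivative Re q') (at 0)"
  proof (rule has_field_derivative_transform_within[OF rq d'])
    show "Re (q (of_real s)) = 0" if "dist s 0 < d'" for s using z[of s] q0 that by (cases "s = 0") auto
  qed auto
  then have q'0: "Re q' = 0" using DERIV_unique DERIV_const by blast
  have "v \<noteq> 0" using \<gamma>(3) by (simp add: v_def)
  have "q' = complex_of_real (real n / 2) * (h 0 * v ^ n * (acceleration \<gamma> t / v)) + deriv h 0 * v ^ (n + 1)"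
  proof -
    have "v ^ n = v * v ^ (n - 1)" using n by (cases n) auto
    then show ?thesis using \<open>v \<noteq> 0\<close> by (simp add: q'_def acc)
  qed
  moreover have "Re (complex_of_real k * X + Y) = k * Re X + Re Y" for k X Y by simp
  ultimately have "Re q' = real n / 2 * Re (h 0 * v ^ n * (acceleration \<gamma> t / v)) + Re (deriv h 0 * v ^ (n + 1))"
    by (simp only:)
  then show "real n * Re (h 0 * velocity \<gamma> t ^ n * (acceleration \<gamma> t / velocity \<gamma> t)) / 2 = - Re (deriv h 0 * velocity \<gamma> t ^ (n + 1))"
    using q'0 by (simp add: v_def)
qed

text \<open>Along the unit tangent e the first jet relation makes h 0 e^n purely imaginary. The
  second relation therefore sees only the imaginary part of acceleration / velocity, and this
  imaginary part divided by the speed is the signed curvature.\<close>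

lemma curvature_nodal:
  assumes \<gamma>: "real_analytic_at \<gamma> t" "\<gamma> t = 0" "velocity \<gamma> t \<noteq> 0"
    and h: "h holomorphic_on ball 0 R" "R > 0" "h 0 \<noteq> 0"
    and d: "d > 0" "\<And>s. \<bar>s - t\<bar> < d \<Longrightarrow> Re (\<gamma> s ^ n * h (\<gamma> s)) = 0" and n: "n \<ge> 1"
  defines "e \<equiv> velocity \<gamma> t / cmod (velocity \<gamma> t)"
  shows "cmod e = 1" "Re (h 0 * e ^ n) = 0"
    "curvature \<gamma> t = 2 * Re (deriv h 0 * e ^ (n + 1)) / (n * Im (h 0 * e ^ n))"
proof -
  define v where "v = velocity \<gamma> t"
  define A where "A = acceleration \<gamma> t"
  define c where "c = cmod v"
  have c: "c > 0" "v \<noteq> 0" using \<gamma>(3) by (auto simp: c_def v_def)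
  have ve: "v = of_real c * e" using c by (simp add: e_def v_def[symmetric] c_def)
  show e1: "cmod e = 1" using c by (simp add: e_def v_def[symmetric] norm_divide)
  have j1: "Re (h 0 * v ^ n) = 0" and j2: "real n * Re (h 0 * v ^ n * (A / v)) / 2 = - Re (deriv h 0 * v ^ (n + 1))"
    using nodal_curve_jet[OF \<gamma> h(1,2) d n] by (auto simp: v_def A_def)
  have hv: "h 0 * v ^ n = of_real (c ^ n) * (h 0 * e ^ n)" by (simp add: ve power_mult_distrib)
  show r0: "Re (h 0 * e ^ n) = 0" using j1 c unfolding hv by (simp only: Re_complex_of_real times_complex.simps) simp
  define m where "m = Im (h 0 * e ^ n)"
  have he: "h 0 * e ^ n = \<i> * of_real m" using r0 by (simp add: complex_eq_iff m_def)
  have "e \<noteq> 0" using e1 by auto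
  then have "h 0 * e ^ n \<noteq> 0" using h(3) by simp
  then have m0: "m \<noteq> 0" using he by auto
  have "Re (h 0 * v ^ n * (A / v)) = - (c ^ n * m) * Im (A / v)"
  proof -
    have "h 0 * v ^ n * (A / v) = of_real (c ^ n * m) * (\<i> * (A / v))" unfolding hv he by simp
    then show ?thesis by (simp only: Re_complex_of_real Im_complex_of_real times_complex.simps) simp
  qed
  moreover have "Re (deriv h 0 * v ^ (n + 1)) = c ^ (n + 1) * Re (deriv h 0 * e ^ (n + 1))"
  proof -
    have "deriv h 0 * v ^ (n + 1) = of_real (c ^ (n + 1)) * (deriv h 0 * e ^ (n + 1))"
      unfolding ve power_mult_distrib by simp
    then show ?thesis by (simp only: Re_complex_of_real times_complex.simps) simp
  qed
  moreover define Y where "Y = Re (deriv h 0 * e ^ (n + 1))"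
  ultimately have "real n * (- (c ^ n * m) * Im (A / v)) / 2 = - (c ^ (n + 1) * Y)"
    using j2 by simp
  then have "c ^ n * (real n * m * Im (A / v)) = c ^ n * (2 * c * Y)"
    by (simp add: field_simps)
  then have k: "real n * m * Im (A / v) = 2 * c * Re (deriv h 0 * e ^ (n + 1))"
    using c unfolding Y_def by simp
  have "Im (A / v) = (Im A * Re v - Re A * Im v) / c ^ 2"
    unfolding Im_divide c_def cmod_power2 ..
  then have "Re v * Im A - Im v * Re A = c ^ 2 * Im (A / v)" using c by (simp add: mult.commute)
  then have "curvature \<gamma> t = c ^ 2 * Im (A / v) / c ^ 3"
    unfolding curvature_def v_def[symmetric] A_def[symmetric] c_def[symmetric] by simp
  also have "\<dots> = Im (A / v) / c" using c by (simp add: power2_eq_square power3_eq_cube)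
  finally have "curvature \<gamma> t = Im (A / v) / c" .
  also have "\<dots> = 2 * Re (deriv h 0 * e ^ (n + 1)) / (n * m)"
    using k c m0 n by (simp add: field_simps)
  finally show "curvature \<gamma> t = 2 * Re (deriv h 0 * e ^ (n + 1)) / (n * Im (h 0 * e ^ n))" by (simp add: m_def)
qed

subsection \<open>Nodal sets of the form \<open>Re (\<phi> ^ n) = 0\<close>\<close>

text \<open>Unit vectors spanning the n lines on which Re (w ^ n) = 0; the index k + n gives the
  vector opposite to that of k.\<close>

definition nodal_dir :: "nat \<Rightarrow> nat \<Rightarrow> complex" where
  "nodal_dir n k = cis ((2 * real k + 1) * pi / (2 * real n))"

lemma norm_nodal_dir [simp]: "cmod (nodal_dir n k) = 1"
  by (simp add: nodal_dir_def)

lemma nodal_dir_nz [simp]: "nodal_dir n k \<noteq> 0"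
  by (simp add: nodal_dir_def)

lemma Re_nodal_dir_power: "n \<ge> 1 \<Longrightarrow> Re ((of_real x * nodal_dir n k) ^ n) = 0"
proof -
  assume n: "n \<ge> 1"
  have "real n * ((2 * real k + 1) * pi / (2 * real n)) = real (Suc (2 * k)) * pi / 2"
    using n by (simp add: field_simps)
  then have "nodal_dir n k ^ n = cis (real (Suc (2 * k)) * pi / 2)" by (simp only: nodal_dir_def Complex.DeMoivre)
  moreover have "cos (real (Suc (2 * k)) * pi / 2) = 0" by (rule cos_zero_iff[THEN iffD2]) (rule disjI1, rule exI[of _ "Suc (2 * k)"], simp)
  ultimately show ?thesis by (simp add: power_mult_distrib flip: of_real_power)
qed

lemma on_nodal_line_exists:
  assumes n: "n \<ge> 1" and w: "Re (w ^ n) = 0"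
  obtains k x where "k < n" "w = of_real x * nodal_dir n k"
proof -
  define r where "r = cmod w"
  define t where "t = Arg w"
  have wrt: "w = of_real r * cis t" unfolding r_def t_def by (metis rcis_cmod_Arg rcis_def)
  show ?thesis
  proof (cases "r = 0")
    case True then show ?thesis using that[of 0 0] n wrt by simp
  next
    case False
    have "w ^ n = of_real (r ^ n) * cis (real n * t)" unfolding wrt by (simp add: power_mult_distrib Complex.DeMoivre)
    then have "cos (real n * t) = 0" using w False by simp
    then obtain i where i: "odd i" "real n * t = of_int i * (pi / 2)" unfolding cos_zero_iff_int by blast
    obtain j where j: "i = 2 * j + 1" using i(1) by (elim oddE)
    define k where "k = nat (j mod int n)"
    have kn: "k < n" using n by (simp add: k_def nat_less_iff)
    define m where "m = j div int n"
    have jk: "j = int n * m + int k" using n by (simp add: m_def k_def)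
    have "t = (2 * real k + 1) * pi / (2 * real n) + of_int m * pi"
      using i(2) n unfolding j jk by (simp add: field_simps)
    then have "cis t = nodal_dir n k * cis (of_int m * pi)" by (simp add: nodal_dir_def cis_mult)
    moreover have "cis (of_int m * pi) = of_real (cos (of_int m * pi))"
      by (simp add: complex_eq_iff sin_int_times_real mult.commute)
    ultimately have "w = of_real (r * cos (of_int m * pi)) * nodal_dir n k" using wrt by simp
    then show ?thesis using that kn by blast
  qed
qed

lemma nodal_line_unique:
  assumes "k < n" "l < n" "of_real x * nodal_dir n k = of_real y * nodal_dir n l" "x \<noteq> 0"
  shows "k = l"
proof -
  define a where "a = (\<lambda>k. (2 * real k + 1) * pi / (2 * real n))"
  have n: "n > 0" using assms by simp
  have "of_real x * (nodal_dir n k * cnj (nodal_dir n l)) = of_real y * (nodal_dir n l * cnj (nodal_dir n l))"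
    using arg_cong[OF assms(3), of "\<lambda>w. w * cnj (nodal_dir n l)"] by (simp only: mult.assoc)
  also have "nodal_dir n l * cnj (nodal_dir n l) = 1" by (simp add: complex_norm_square[symmetric])
  also have "nodal_dir n k * cnj (nodal_dir n l) = cis (a k - a l)"
    by (simp add: nodal_dir_def a_def cis_cnj cis_mult)
  finally have "x * sin (a k - a l) = 0" by (simp add: complex_eq_iff)
  then have s: "sin (a k - a l) = 0" using assms by simp
  have d: "a k - a l = (real k - real l) / real n * pi" using n by (simp add: a_def field_simps)
  have "\<bar>(real k - real l) / real n\<bar> < 1" using assms n by (auto simp: field_simps abs_less_iff)
  then have "\<bar>(real k - real l) / real n\<bar> * pi < 1 * pi" by (intro mult_strict_right_mono) auto
  moreover have "\<bar>c * pi\<bar> = \<bar>c\<bar> * pi" for c by (simp add: abs_mult)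
  ultimately have "\<bar>a k - a l\<bar> < pi" unfolding d by (metis mult_1)
  then have "- pi < a k - a l" "a k - a l < pi" by linarith+
  then have "a k - a l = 0" using s by (rule sin_eq_0_pi)
  then show ?thesis unfolding d using n by simp
qed

definition nodal_line :: "nat \<Rightarrow> nat \<Rightarrow> complex set" where
  "nodal_line n k = range (\<lambda>x. of_real x * nodal_dir n k)"

lemma nodal_lineI: "w = of_real x * nodal_dir n k \<Longrightarrow> w \<in> nodal_line n k"
  by (auto simp: nodal_line_def)

lemma closed_nodal_line: "closed (nodal_line n k)"
proof -
  have "nodal_line n k = {w. Im (w / nodal_dir n k) = 0}"
  proof (intro set_eqI iffI)
    fix w assume "w \<in> {w. Im (w / nodal_dir n k) = 0}"
    then have "w / nodal_dir n k = of_real (Re (w / nodal_dir n k))" by (simp add: complex_eq_iff)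
    then have "w = of_real (Re (w / nodal_dir n k)) * nodal_dir n k" by (metis nodal_dir_nz nonzero_divide_eq_eq)
    then show "w \<in> nodal_line n k" unfolding nodal_line_def by blast
  qed (auto simp: nodal_line_def)
  also have "closed \<dots>" by (intro closed_Collect_eq continuous_intros) auto
  finally show ?thesis .
qed

text \<open>Distinct lines meet only at 0, so the finitely many lines not through w form a closed
  set that misses a neighbourhood of w.\<close>

lemma nodal_line_locally:
  assumes n: "n \<ge> 1" and w: "Re (w ^ n) = 0" "w \<noteq> 0"
  obtains k where "k < n" "eventually (\<lambda>y. Re (y ^ n) = 0 \<longrightarrow> y \<in> nodal_line n k) (nhds w)"
proof -
  obtain k x where k: "k < n" "w = of_real x * nodal_dir n k" using on_nodal_line_exists[OF n w(1)] by blast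
  define C where "C = (\<Union>l\<in>{..<n} - {k}. nodal_line n l)"
  have "closed C" unfolding C_def by (intro closed_UN closed_nodal_line ballI) auto
  moreover have "w \<notin> C"
  proof
    assume "w \<in> C"
    then obtain l y where "l < n" "l \<noteq> k" "w = of_real y * nodal_dir n l" by (auto simp: C_def nodal_line_def)
    moreover have "x \<noteq> 0" using k w by auto
    ultimately show False using nodal_line_unique[of k n l x y] k by metis
  qed
  ultimately have "eventually (\<lambda>y. y \<in> - C) (nhds w)" by (intro eventually_nhds_in_open) auto
  then have "eventually (\<lambda>y. Re (y ^ n) = 0 \<longrightarrow> y \<in> nodal_line n k) (nhds w)"
  proof eventually_elim
    case (elim y)
    show ?case
    proof
      assume "Re (y ^ n) = 0"
      then obtain l z where "l < n" "y = of_real z * nodal_dir n l" using on_nodal_line_exists[OF n] by metis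
      then show "y \<in> nodal_line n k" using elim by (cases "l = k") (auto simp: C_def nodal_line_def)
    qed
  qed
  then show ?thesis using that k by blast
qed

lemma has_vector_derivative_quotient:
  fixes f :: "real \<Rightarrow> complex"
  assumes "(f has_vector_derivative w) (at t)"
  shows "((\<lambda>s. (f s - f t) / of_real (s - t)) \<longlongrightarrow> w) (at t)"
proof -
  have "((\<lambda>s. Re (f s)) has_real_derivative Re w) (at t)" "((\<lambda>s. Im (f s)) has_real_derivative Im w) (at t)"
    using bounded_linear.has_vector_derivative[OF bounded_linear_Re assms]
      bounded_linear.has_vector_derivative[OF bounded_linear_Im assms]
    by (simp_all add: has_real_derivative_iff_has_vector_derivative)
  then show ?thesis
    unfolding has_field_derivative_iff tendsto_complex_iff
    by (simp add: Re_divide_of_real Im_divide_of_real del: of_real_diff)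
qed

lemma regular_analytic_curveD:
  assumes "regular_analytic_curve I \<gamma>"
  shows "I \<noteq> {}" "open I" "connected I" "\<And>t. t \<in> I \<Longrightarrow> real_analytic_at \<gamma> t" "\<And>t. t \<in> I \<Longrightarrow> velocity \<gamma> t \<noteq> 0"
    "\<And>t. t \<in> I \<Longrightarrow> (\<gamma> has_vector_derivative velocity \<gamma> t) (at t)" "continuous_on I \<gamma>"
proof -
  show 0: "I \<noteq> {}" "open I" "connected I" "\<And>t. t \<in> I \<Longrightarrow> real_analytic_at \<gamma> t" "\<And>t. t \<in> I \<Longrightarrow> velocity \<gamma> t \<noteq> 0"
    using assms by (auto simp: regular_analytic_curve_def is_interval_connected)
  show 1: "\<And>t. t \<in> I \<Longrightarrow> (\<gamma> has_vector_derivative velocity \<gamma> t) (at t)" using 0 real_analytic_at_has_velocity by blast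
  show "continuous_on I \<gamma>"
    using 1 by (intro continuous_at_imp_continuous_on ballI) (auto dest: has_vector_derivative_continuous)
qed

section \<open>Nodal curves as lifts of lines through the root of the holomorphic function\<close>

text \<open>The setting that both halves of the theorem reach, by \<open>nodal_root_exists\<close>
  and by \<open>transversal_root\<close>. Injectivity of \<phi> is not assumed; it is locally
  invertible along the nodal set and vanishes only at 0, so the nodal set is the union of the
  preimages of n lines, and these preimages meet only at 0.\<close>

locale nodal_root =
  fixes \<phi> :: "complex \<Rightarrow> complex" and R :: real and n :: nat and u :: "complex \<Rightarrow> real"
  assumes R: "R > 0" and n: "n \<ge> 1"
    and hol: "\<phi> holomorphic_on ball 0 R" and phi0: "\<phi> 0 = 0" and phinz: "\<And>z. z \<in> ball 0 R \<Longrightarrow> \<phi> z = 0 \<Longrightarrow> z = 0"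
    and u: "\<And>z. z \<in> ball 0 R \<Longrightarrow> u z = Re (\<phi> z ^ n)"
    and dphi: "\<And>z. z \<in> ball 0 R \<Longrightarrow> Re (\<phi> z ^ n) = 0 \<Longrightarrow> deriv \<phi> z \<noteq> 0"
begin

abbreviation "N \<equiv> nodal_set u (ball 0 R)"

definition L :: "nat \<Rightarrow> complex set" where
  "L k = {z \<in> ball 0 R. \<phi> z \<in> nodal_line n k}"

text \<open>Sections of \<phi> over an open interval of a line. With the position on the line as
  parameter there is no freedom of reparametrization, so two curves can be compared pointwise and
  glued.\<close>

definition lift :: "nat \<Rightarrow> real set \<Rightarrow> (real \<Rightarrow> complex) \<Rightarrow> bool" where
  "lift k J s \<longleftrightarrow> J \<noteq> {} \<and> open J \<and> connected J \<and> continuous_on J s \<and>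
     (\<forall>x\<in>J. s x \<in> ball 0 R \<and> \<phi> (s x) = of_real x * nodal_dir n k)"

lemma N_iff: "z \<in> N \<longleftrightarrow> z \<in> ball 0 R \<and> Re (\<phi> z ^ n) = 0"
  using u by (auto simp: nodal_set_def)

lemma L_subset_N: "L k \<subseteq> N"
  using Re_nodal_dir_power[OF n] by (auto simp: L_def N_iff nodal_line_def)

lemma N_eq: "N = (\<Union>k<n. L k)"
proof
  show "N \<subseteq> (\<Union>k<n. L k)"
  proof
    fix z assume "z \<in> N"
    then obtain k x where "k < n" "\<phi> z = of_real x * nodal_dir n k" "z \<in> ball 0 R"
      using on_nodal_line_exists[OF n] unfolding N_iff by metis
    then show "z \<in> (\<Union>k<n. L k)" by (auto simp: L_def nodal_line_def)
  qed
qed (use L_subset_N in blast)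

lemma zero_in_L: "0 \<in> L k"
  using R by (auto simp: L_def phi0 nodal_line_def intro: image_eqI[of _ _ 0])

lemma L_disjoint: "k < n \<Longrightarrow> l < n \<Longrightarrow> z \<in> L k \<Longrightarrow> z \<in> L l \<Longrightarrow> z \<noteq> 0 \<Longrightarrow> k = l"
proof -
  assume a: "k < n" "l < n" "z \<in> L k" "z \<in> L l" "z \<noteq> 0"
  obtain x where x: "\<phi> z = of_real x * nodal_dir n k" "z \<in> ball 0 R" using a by (auto simp: L_def nodal_line_def)
  obtain y where y: "\<phi> z = of_real y * nodal_dir n l" using a by (auto simp: L_def nodal_line_def)
  have "x \<noteq> 0" using phinz[OF x(2)] x(1) a by auto
  then show "k = l" using nodal_line_unique[OF a(1,2)] x y by metis
qed

lemma phi_deriv: "z \<in> ball 0 R \<Longrightarrow> (\<phi> has_field_derivative deriv \<phi> z) (at z)"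
  using holomorphic_derivI[OF hol] by simp

lemma local_inverse:
  assumes "z0 \<in> N"
  shows "\<exists>r g. r > 0 \<and> ball z0 r \<subseteq> ball 0 R \<and> inj_on \<phi> (ball z0 r) \<and> open (\<phi> ` ball z0 r) \<and>
    g holomorphic_on \<phi> ` ball z0 r \<and> (\<forall>z\<in>ball z0 r. g (\<phi> z) = z \<and> deriv \<phi> z * deriv g (\<phi> z) = 1)"
proof -
  have z0: "z0 \<in> ball 0 R" "deriv \<phi> z0 \<noteq> 0" using assms dphi by (auto simp: N_iff)
  obtain r where r: "r > 0" "ball z0 r \<subseteq> ball 0 R" "open (\<phi> ` ball z0 r)" "inj_on \<phi> (ball z0 r)"
    using has_complex_derivative_locally_invertible[OF hol z0(1) open_ball z0(2)] by blast
  have "\<phi> holomorphic_on ball z0 r" using hol r(2) holomorphic_on_subset by blast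
  then obtain g where "g holomorphic_on \<phi> ` ball z0 r"
    "\<And>z. z \<in> ball z0 r \<Longrightarrow> deriv \<phi> z * deriv g (\<phi> z) = 1" "\<And>z. z \<in> ball z0 r \<Longrightarrow> g (\<phi> z) = z"
    using holomorphic_has_inverse[OF _ open_ball r(4)] by blast
  then show ?thesis using r by blast
qed

lemma L_nontrivial: "\<exists>z\<in>L k. z \<noteq> 0"
proof -
  have "0 \<in> N" using R n by (simp add: N_iff phi0)
  then obtain r g where r: "r > 0" "ball (0::complex) r \<subseteq> ball 0 R" "inj_on \<phi> (ball 0 r)" "open (\<phi> ` ball 0 r)"
    "g holomorphic_on \<phi> ` ball 0 r" "\<forall>z\<in>ball 0 r. g (\<phi> z) = z \<and> deriv \<phi> z * deriv g (\<phi> z) = 1"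
    using local_inverse[OF \<open>0 \<in> N\<close>] by (elim exE conjE) (rule that)
  have "0 \<in> \<phi> ` ball 0 r" using r(1) phi0 by force
  then obtain e where e: "e > 0" "ball 0 e \<subseteq> \<phi> ` ball 0 r" using r(4) openE by blast
  have "of_real (e / 2) * nodal_dir n k \<in> ball 0 e" using e(1) by (simp add: norm_mult)
  then have "of_real (e / 2) * nodal_dir n k \<in> \<phi> ` ball 0 r" using e(2) by blast
  then obtain z where z: "z \<in> ball 0 r" "\<phi> z = of_real (e / 2) * nodal_dir n k" by (metis imageE)
  then have "z \<in> L k" using r(2) nodal_lineI[OF z(2)] by (auto simp: L_def)
  moreover have "z \<noteq> 0" using z e phi0 by auto
  ultimately show ?thesis by blast
qed

lemma L_inj: "inj_on L {..<n}"
proof (rule inj_onI)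
  fix k l assume kl: "k \<in> {..<n}" "l \<in> {..<n}" "L k = L l"
  obtain z where "z \<in> L k" "z \<noteq> 0" using L_nontrivial by blast
  then show "k = l" using L_disjoint kl by auto
qed

text \<open>Near each parameter a continuous section coincides with a holomorphic local inverse of
  \<phi> restricted to the line; it is therefore analytic, and its velocity is nonzero because the
  derivative of the inverse is.\<close>

lemma lift_regular:
  assumes s: "lift k J s"
  shows "regular_analytic_curve J s" "s ` J \<subseteq> L k"
proof -
  show sub: "s ` J \<subseteq> L k" using s by (auto simp: lift_def L_def nodal_line_def)
  show "regular_analytic_curve J s" unfolding regular_analytic_curve_def is_interval_connected_1
  proof (intro conjI ballI)
    fix x0 assume x0: "x0 \<in> J"
    define E where "E = nodal_dir n k"
    have "s x0 \<in> N" using sub x0 L_subset_N by blast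
  then obtain r g where r: "r > 0" "ball (s x0) r \<subseteq> ball 0 R" "inj_on \<phi> (ball (s x0) r)" "open (\<phi> ` ball (s x0) r)"
    "g holomorphic_on \<phi> ` ball (s x0) r" "\<forall>z\<in>ball (s x0) r. g (\<phi> z) = z \<and> deriv \<phi> z * deriv g (\<phi> z) = 1"
    using local_inverse[OF \<open>s x0 \<in> N\<close>] by (elim exE conjE) (rule that)
    have px0: "\<phi> (s x0) = of_real x0 * E" using s x0 by (simp add: lift_def E_def)
    have "s x0 \<in> ball (s x0) r" using r(1) by simp
    then have xE: "of_real x0 * E \<in> \<phi> ` ball (s x0) r" using px0 by (metis imageI)
    then obtain e1 where e1: "e1 > 0" "ball (of_real x0 * E) e1 \<subseteq> \<phi> ` ball (s x0) r" using r(4) openE by blast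
    have "isCont s x0" using s x0 unfolding lift_def by (metis continuous_on_eq_continuous_at)
    then obtain e2 where e2: "e2 > 0" "\<And>x. dist x x0 < e2 \<Longrightarrow> dist (s x) (s x0) < r"
      using r(1) unfolding continuous_at_eps_delta by blast
    obtain e3 where e3: "e3 > 0" "ball x0 e3 \<subseteq> J" using s x0 openE unfolding lift_def by metis
    define e where "e = min e1 (min e2 e3)"
    define F where "F = (\<lambda>w. g (of_real x0 * E + w * E))"
    have e: "e > 0" using e1 e2 e3 by (simp add: e_def)
    have inball: "of_real x0 * E + w * E \<in> \<phi> ` ball (s x0) r" if "w \<in> ball 0 e" for w
    proof -
      have "of_real x0 * E + w * E \<in> ball (of_real x0 * E) e1"
        using that by (simp add: e_def dist_norm norm_mult E_def)
      then show ?thesis using e1(2) by blast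
    qed
    have "(g \<circ> (\<lambda>w. of_real x0 * E + w * E)) holomorphic_on ball 0 e"
      by (rule holomorphic_on_compose_gen[OF _ r(5)]) (use inball in \<open>auto intro!: holomorphic_intros\<close>)
    then have F: "F holomorphic_on ball 0 e" by (simp add: F_def o_def)
    have sF: "s (x0 + x) = F (of_real x)" if x: "\<bar>x\<bar> < e" for x
    proof -
      have "s (x0 + x) \<in> ball (s x0) r" using e2(2)[of "x0 + x"] x by (simp add: e_def dist_real_def dist_commute)
      then have "s (x0 + x) = g (\<phi> (s (x0 + x)))" using r(6) by simp
      also have "x0 + x \<in> J" using e3(2) x by (auto simp: e_def dist_real_def subset_iff)
      then have "\<phi> (s (x0 + x)) = of_real x0 * E + of_real x * E" using s by (simp add: lift_def E_def algebra_simps)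
      finally show ?thesis by (simp add: F_def)
    qed
    show "real_analytic_at s x0" unfolding real_analytic_at_iff_holomorphic using e F sF by blast
    have "velocity s x0 = deriv F 0" using complexification_velocity(2)[OF e F sF, of 0] e by simp
    moreover have "(F has_field_derivative deriv g (of_real x0 * E) * E) (at 0)"
    proof -
      have "(g has_field_derivative deriv g (of_real x0 * E)) (at (of_real x0 * E + 0 * E))"
        using holomorphic_derivI[OF r(5) r(4)] \<open>of_real x0 * E \<in> \<phi> ` ball (s x0) r\<close> by simp
      then show ?thesis unfolding F_def by (rule DERIV_chain2) (auto intro!: derivative_eq_intros)
    qed
    ultimately have "velocity s x0 = deriv g (of_real x0 * E) * E" by (simp add: DERIV_imp_deriv)
    moreover have "deriv g (of_real x0 * E) \<noteq> 0" using r(6) r(1) px0 by (metis centre_in_ball mult_zero_right zero_neq_one)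
    ultimately show "velocity s x0 \<noteq> 0" by (simp add: E_def)
  qed (use s in \<open>auto simp: lift_def\<close>)
qed

lemma phi_along_curve:
  assumes \<gamma>: "regular_analytic_curve I \<gamma>" "\<gamma> ` I \<subseteq> N" and t: "t \<in> I"
  shows "((\<lambda>s. \<phi> (\<gamma> s)) has_vector_derivative velocity \<gamma> t * deriv \<phi> (\<gamma> t)) (at t)"
    "velocity \<gamma> t * deriv \<phi> (\<gamma> t) \<noteq> 0"
proof -
  have g: "\<gamma> t \<in> ball 0 R" "Re (\<phi> (\<gamma> t) ^ n) = 0" using \<gamma> t N_iff by blast+
  show "((\<lambda>s. \<phi> (\<gamma> s)) has_vector_derivative velocity \<gamma> t * deriv \<phi> (\<gamma> t)) (at t)"
    using field_vector_diff_chain_at[OF regular_analytic_curveD(6)[OF \<gamma>(1) t] phi_deriv[OF g(1)]] by (simp add: o_def)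
  show "velocity \<gamma> t * deriv \<phi> (\<gamma> t) \<noteq> 0"
    using regular_analytic_curveD(5)[OF \<gamma>(1) t] dphi[OF g] by simp
qed

text \<open>A regular curve in the nodal set passes straight through \<open>0\<close>, so it cannot change from one
  line to another.\<close>

lemma curve_in_L:
  assumes \<gamma>: "regular_analytic_curve I \<gamma>" "\<gamma> ` I \<subseteq> N"
  obtains k where "k < n" "\<gamma> ` I \<subseteq> L k"
proof -
  define P where "P = (\<lambda>k t. k < n \<and> eventually (\<lambda>s. \<gamma> s \<in> L k) (nhds t))"
  note gd = regular_analytic_curveD[OF \<gamma>(1)]
  have inI: "eventually (\<lambda>s. s \<in> I) (nhds t)" if "t \<in> I" for t using that gd(2) by (rule eventually_nhds_in_open[rotated])
  have ex: "\<exists>k. P k t" if t: "t \<in> I" for t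
  proof -
    have gN: "\<gamma> s \<in> ball 0 R" "Re (\<phi> (\<gamma> s) ^ n) = 0" if "s \<in> I" for s using \<gamma>(2) that N_iff by blast+
    have cont: "((\<lambda>s. \<phi> (\<gamma> s)) \<longlongrightarrow> \<phi> (\<gamma> t)) (nhds t)"
      using has_vector_derivative_continuous[OF phi_along_curve(1)[OF \<gamma> t]] by (simp add: continuous_at_imp_continuous_within isCont_def tendsto_nhds_iff continuous_within)
    show ?thesis
    proof (cases "\<phi> (\<gamma> t) = 0")
      case False
      obtain k where k: "k < n" "eventually (\<lambda>y. Re (y ^ n) = 0 \<longrightarrow> y \<in> nodal_line n k) (nhds (\<phi> (\<gamma> t)))"
        using nodal_line_locally[OF n gN(2)[OF t] False] by blast
      have "eventually (\<lambda>s. Re (\<phi> (\<gamma> s) ^ n) = 0 \<longrightarrow> \<phi> (\<gamma> s) \<in> nodal_line n k) (nhds t)"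
        using filterlim_iff[THEN iffD1, OF cont] k(2) by blast
      with inI[OF t] have "eventually (\<lambda>s. \<gamma> s \<in> L k) (nhds t)"
        by eventually_elim (use gN in \<open>auto simp: L_def\<close>)
      then show ?thesis using k(1) by (auto simp: P_def)
    next
      case True
      define w where "w = velocity \<gamma> t * deriv \<phi> (\<gamma> t)"
      have w0: "w \<noteq> 0" using phi_along_curve(2)[OF \<gamma> t] by (simp add: w_def)
      \<comment> \<open>At a zero of \<phi> the difference quotient takes the place of \<phi>: it is
        a real multiple of \<phi> (\<gamma> s), hence on the same line, and it has the nonzero limit
        w, to which \<open>nodal_line_locally\<close> applies.\<close>
      define q where "q = (\<lambda>s. (\<phi> (\<gamma> s) - \<phi> (\<gamma> t)) /\<^sub>R (s - t))"
      have ql: "(q \<longlongrightarrow> w) (at t)"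
        using has_vector_derivative_quotient[OF phi_along_curve(1)[OF \<gamma> t]]
        by (simp add: w_def q_def scaleR_conv_of_real divide_inverse mult.commute)
      have qe: "q s = of_real (1 / (s - t)) * \<phi> (\<gamma> s)" for s
        by (simp add: q_def True scaleR_conv_of_real inverse_eq_divide)
      have inI': "eventually (\<lambda>s. s \<in> I) (at t)" using inI[OF t] by (simp add: eventually_nhds_conv_at)
      have q0: "Re (q s ^ n) = 0" if "s \<in> I" for s
      proof -
        have "q s ^ n = of_real ((1 / (s - t)) ^ n) * \<phi> (\<gamma> s) ^ n" unfolding qe power_mult_distrib by simp
        moreover have "Re (complex_of_real c * y) = c * Re y" for c y by simp
        ultimately show ?thesis using gN(2)[OF that] by simp
      qed
      have "((\<lambda>s. Re (q s ^ n)) \<longlongrightarrow> Re (w ^ n)) (at t)" by (intro tendsto_intros ql)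
      moreover have "((\<lambda>s. Re (q s ^ n)) \<longlongrightarrow> 0) (at t)"
        by (rule tendsto_eventually) (use inI' q0 in \<open>auto elim: eventually_mono\<close>)
      ultimately have "Re (w ^ n) = 0" using tendsto_unique[OF at_neq_bot] by blast
      then obtain k where k: "k < n" "eventually (\<lambda>y. Re (y ^ n) = 0 \<longrightarrow> y \<in> nodal_line n k) (nhds w)"
        using nodal_line_locally[OF n _ w0] by blast
      have "eventually (\<lambda>s. Re (q s ^ n) = 0 \<longrightarrow> q s \<in> nodal_line n k) (at t)"
        using filterlim_iff[THEN iffD1, OF ql] k(2) by blast
      moreover have "eventually (\<lambda>s. s \<noteq> t) (at t)" by (simp add: eventually_at_filter)
      ultimately have "eventually (\<lambda>s. \<gamma> s \<in> L k) (at t)" using inI'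
      proof eventually_elim
        case (elim s)
        then obtain x where "q s = of_real x * nodal_dir n k" using q0 by (auto simp: nodal_line_def)
        then have "\<phi> (\<gamma> s) = of_real ((s - t) * x) * nodal_dir n k"
          using elim unfolding qe by (simp add: field_simps)
        then have "\<phi> (\<gamma> s) \<in> nodal_line n k" by (rule nodal_lineI)
        then show ?case using gN(1) elim by (simp add: L_def)
      qed
      moreover have "\<gamma> t \<in> L k"
        using True gN(1)[OF t] phinz zero_in_L by metis
      ultimately show ?thesis using k(1) by (auto simp: P_def eventually_nhds_conv_at)
    qed
  qed
  \<comment> \<open>A curve in two of the preimages at once would have \<phi> = 0 on an interval,
    against the nonzero derivative of \<phi> along it.\<close>
  have uniq: "k = l" if "P k t" "P l t" "t \<in> I" for k l t
  proof (rule ccontr)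
    assume "k \<noteq> l"
    have "eventually (\<lambda>s. \<gamma> s \<in> L k \<and> \<gamma> s \<in> L l) (nhds t)" using that by (auto simp: P_def intro: eventually_conj)
    then have "eventually (\<lambda>s. \<phi> (\<gamma> s) = 0) (nhds t)"
      by eventually_elim (use L_disjoint[of k l] \<open>k \<noteq> l\<close> that phi0 in \<open>force simp: P_def\<close>)
    then obtain S where S: "open S" "t \<in> S" "\<And>s. s \<in> S \<Longrightarrow> \<phi> (\<gamma> s) = 0" unfolding eventually_nhds by blast
    have "((\<lambda>s. 0) has_vector_derivative velocity \<gamma> t * deriv \<phi> (\<gamma> t)) (at t)"
      by (rule has_vector_derivative_transform_within_open[OF phi_along_curve(1)[OF \<gamma> that(3)] S(1,2)]) (use S in auto)
    then show False using phi_along_curve(2)[OF \<gamma> that(3)] vector_derivative_unique_at[of "\<lambda>_. 0" _ t 0] by fastforce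
  qed
  define \<kappa> where "\<kappa> = (\<lambda>t. SOME k. P k t)"
  have \<kappa>: "P (\<kappa> t) t" if "t \<in> I" for t unfolding \<kappa>_def using ex[OF that] by (rule someI_ex)
  obtain t0 where t0: "t0 \<in> I" using gd(1) by blast
  have const: "\<kappa> t0 = \<kappa> t" if "t \<in> I" for t
  proof (rule connected_local_const[OF gd(3) t0 that], rule ballI)
    fix a assume a: "a \<in> I"
    obtain S where S: "open S" "a \<in> S" "\<And>s. s \<in> S \<Longrightarrow> \<gamma> s \<in> L (\<kappa> a)"
      using \<kappa>[OF a] unfolding P_def eventually_nhds by blast
    have "P (\<kappa> a) b" if "b \<in> S" for b
      using that S \<kappa>[OF a] unfolding P_def eventually_nhds by blast
    then have "\<kappa> a = \<kappa> b" if "b \<in> S" "b \<in> I" for b using uniq \<kappa> that by blast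
    then show "eventually (\<lambda>b. \<kappa> a = \<kappa> b) (at a within I)"
      unfolding eventually_at_topological using S by blast
  qed
  have "\<gamma> t \<in> L (\<kappa> t0)" if "t \<in> I" for t
    using \<kappa>[OF that] const[OF that] by (auto simp: P_def dest: eventually_nhds_x_imp_x)
  then show ?thesis using that \<kappa>[OF t0] by (auto simp: P_def)
qed

text \<open>The coordinate \<open>X\<close> of \<phi> (\<gamma> t) along the line has a nonzero
  derivative, since the derivative of \<phi> along the curve is nonzero and points in the direction
  of the line. By Rolle it is injective, and its inverse is the change of parameter.\<close>

lemma curve_to_lift:
  assumes \<gamma>: "regular_analytic_curve I \<gamma>" "\<gamma> ` I \<subseteq> L k"
  obtains J s where "lift k J s" "s ` J = \<gamma> ` I"
proof -
  note gd = regular_analytic_curveD[OF \<gamma>(1)]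
  have gN: "\<gamma> ` I \<subseteq> N" using \<gamma>(2) L_subset_N by blast
  define E where "E = nodal_dir n k"
  define X where "X = (\<lambda>t. Re (\<phi> (\<gamma> t) / E))"
  have phiX: "\<phi> (\<gamma> t) = of_real (X t) * E" if "t \<in> I" for t
    using \<gamma>(2) that by (auto simp: L_def nodal_line_def X_def E_def image_subset_iff)
  have Xd: "\<exists>x'. (X has_real_derivative x') (at t) \<and> x' \<noteq> 0" if t: "t \<in> I" for t
  proof -
    define w where "w = velocity \<gamma> t * deriv \<phi> (\<gamma> t) / E"
    have d: "((\<lambda>s. \<phi> (\<gamma> s) / E) has_vector_derivative w) (at t)"
      unfolding w_def using phi_along_curve(1)[OF \<gamma>(1) gN t] by (rule has_vector_derivative_divide)
    have "((\<lambda>s. Im (\<phi> (\<gamma> s) / E)) has_vector_derivative Im w) (at t)"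
      by (rule bounded_linear.has_vector_derivative[OF bounded_linear_Im d])
    then have "((\<lambda>s. 0) has_vector_derivative Im w) (at t)"
      by (rule has_vector_derivative_transform_within_open[OF _ gd(2) t]) (simp add: phiX E_def)
    then have "Im w = 0" using vector_derivative_unique_at[of "\<lambda>_. 0" _ t 0] by fastforce
    moreover have "w \<noteq> 0" using phi_along_curve(2)[OF \<gamma>(1) gN t] by (simp add: w_def E_def)
    ultimately have "Re w \<noteq> 0" by (simp add: complex_eq_iff)
    moreover have "(X has_real_derivative Re w) (at t)"
      using bounded_linear.has_vector_derivative[OF bounded_linear_Re d]
      by (simp add: X_def has_real_derivative_iff_has_vector_derivative)
    ultimately show ?thesis by blast
  qed
  have Xc: "continuous_on I X"
    using Xd by (intro continuous_at_imp_continuous_on ballI) (blast intro: DERIV_isCont)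
  have inj: "inj_on X I"
  proof -
    have "X a \<noteq> X b" if ab: "a \<in> I" "b \<in> I" "a < b" for a b
    proof
      assume eq: "X a = X b"
      have sub: "{a..b} \<subseteq> I" using gd(3) ab by (meson connected_contains_Icc)
      obtain c where "a < c" "c < b" "(X has_real_derivative 0) (at c)"
      proof -
        have "X differentiable (at x)" if "a < x" "x < b" for x
        proof -
          have "x \<in> I" using sub that by auto
          then show ?thesis using Xd by (auto simp: real_differentiable_def)
        qed
        then show ?thesis using Rolle[OF ab(3) eq continuous_on_subset[OF Xc sub]] that by blast
      qed
      then show False using Xd[of c] sub DERIV_unique by (metis atLeastAtMost_iff less_imp_le subsetD)
    qed
    then show ?thesis by (metis inj_onI linorder_neqE_linordered_idom)
  qed
  define J where "J = X ` I"
  define s where "s = (\<lambda>x. \<gamma> (inv_into I X x))"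
  have "open J" unfolding J_def using Xc gd(2) inj by (rule invariance_of_domain)
  moreover have "connected J" unfolding J_def using Xc gd(3) by (rule connected_continuous_image)
  moreover have "continuous_on J (inv_into I X)"
    unfolding J_def using gd(2) Xc inj by (intro continuous_on_inverse_open) auto
  then have "continuous_on J s" unfolding s_def
    by (intro continuous_on_compose2[OF gd(7)]) (auto simp: J_def inv_into_into)
  moreover have sX: "s (X t) = \<gamma> t" if "t \<in> I" for t using inj that by (simp add: s_def)
  moreover have "s x \<in> ball 0 R \<and> \<phi> (s x) = of_real x * E" if "x \<in> J" for x
  proof -
    have "\<exists>t\<in>I. x = X t" using \<open>x \<in> J\<close> by (auto simp: J_def)
    then obtain t where t: "t \<in> I" "x = X t" by blast
    have "\<gamma> t \<in> L k" using \<gamma>(2) t by blast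
    then show ?thesis using t sX phiX by (auto simp: L_def)
  qed
  ultimately have "lift k J s" using gd(1) by (auto simp: lift_def J_def E_def)
  moreover have "s ` J = \<gamma> ` I" unfolding J_def image_image by (rule image_cong[OF refl sX])
  ultimately show ?thesis using that by blast
qed

text \<open>The set of agreement is open, because \<phi> is injective near a common value, and
  closed by continuity; the parameter interval J1 \<inter> J2 is connected.\<close>

lemma lift_unique:
  assumes s1: "lift k J1 s1" and s2: "lift k J2 s2" and x0: "x0 \<in> J1" "x0 \<in> J2" "s1 x0 = s2 x0" and x: "x \<in> J1" "x \<in> J2"
  shows "s1 x = s2 x"
proof -
  have "connected (J1 \<inter> J2)"
    using s1 s2 unfolding lift_def by (meson is_interval_Int is_interval_connected_1)
  then have "(s1 x0 = s2 x0) = (s1 x = s2 x)"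
  proof (rule connected_local_const[where f="\<lambda>x. s1 x = s2 x"], safe)
    fix a assume a: "a \<in> J1" "a \<in> J2"
    have c: "isCont s1 a" "isCont s2 a" using s1 s2 a unfolding lift_def by (metis continuous_on_eq_continuous_at)+
    have o: "open (J1 \<inter> J2)" using s1 s2 by (auto simp: lift_def)
    show "eventually (\<lambda>b. (s1 a = s2 a) = (s1 b = s2 b)) (at a within J1 \<inter> J2)"
    proof (cases "s1 a = s2 a")
      case True
      have "s1 a \<in> N" using lift_regular(2)[OF s1] a L_subset_N by blast
  then obtain r g where r: "r > 0" "ball (s1 a) r \<subseteq> ball 0 R" "inj_on \<phi> (ball (s1 a) r)" "open (\<phi> ` ball (s1 a) r)"
    "g holomorphic_on \<phi> ` ball (s1 a) r" "\<forall>z\<in>ball (s1 a) r. g (\<phi> z) = z \<and> deriv \<phi> z * deriv g (\<phi> z) = 1"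
    using local_inverse[OF \<open>s1 a \<in> N\<close>] by (elim exE conjE) (rule that)
      have "eventually (\<lambda>b. s1 b \<in> ball (s1 a) r) (at a)" "eventually (\<lambda>b. s2 b \<in> ball (s1 a) r) (at a)"
        using c r(1) True unfolding isCont_def by (auto intro!: topological_tendstoD simp del: mem_ball)
      moreover have "eventually (\<lambda>b. b \<in> J1 \<inter> J2) (at a)" using o a by (intro eventually_at_in_open') auto
      ultimately have "eventually (\<lambda>b. (s1 a = s2 a) = (s1 b = s2 b)) (at a)"
        by eventually_elim (use r(3) s1 s2 True in \<open>auto simp: lift_def inj_on_def\<close>)
      then show ?thesis by (rule filter_leD[OF at_le, rotated]) simp
    next
      case False
      have "((\<lambda>b. s1 b - s2 b) \<longlongrightarrow> s1 a - s2 a) (at a)" using c unfolding isCont_def by (intro tendsto_intros)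
      then have "eventually (\<lambda>b. s1 b - s2 b \<noteq> 0) (at a)" by (rule tendsto_imp_eventually_ne) (use False in simp)
      then have "eventually (\<lambda>b. (s1 a = s2 a) = (s1 b = s2 b)) (at a)" by eventually_elim (use False in simp)
      then show ?thesis by (rule filter_leD[OF at_le, rotated]) simp
    qed
  qed (use x0 x in auto)
  then show ?thesis using x0 by simp
qed

lemma lift_glue:
  assumes s1: "lift k J1 s1" and s2: "lift k J2 s2" and x0: "x0 \<in> J1" "x0 \<in> J2" "s1 x0 = s2 x0"
  shows "lift k (J1 \<union> J2) (\<lambda>x. if x \<in> J1 then s1 x else s2 x)" (is "lift k _ ?s")
  unfolding lift_def
proof (intro conjI)
  have eq2: "?s x = s2 x" if "x \<in> J2" for x using lift_unique[OF s1 s2 x0] that by auto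
  show "continuous_on (J1 \<union> J2) ?s"
  proof (rule continuous_on_open_Un)
    show "continuous_on J1 ?s" using s1 by (simp add: lift_def)
    have "continuous_on J2 ?s \<longleftrightarrow> continuous_on J2 s2" by (rule continuous_on_cong[OF refl eq2])
    then show "continuous_on J2 ?s" using s2 by (simp add: lift_def)
  qed (use s1 s2 in \<open>auto simp: lift_def\<close>)
  show "connected (J1 \<union> J2)" using s1 s2 x0 by (intro connected_Un) (auto simp: lift_def)
qed (use s1 s2 in \<open>auto simp: lift_def\<close>)

end

lemma nodal_curveD:
  assumes "nodal_curve u D C"
  shows "C \<subseteq> nodal_set u D" "\<exists>I \<gamma>. regular_analytic_curve I \<gamma> \<and> \<gamma> ` I = C"
    "\<And>C' J \<delta>. parametrizes J \<delta> C' \<Longrightarrow> C' \<subseteq> nodal_set u D \<Longrightarrow> C \<subseteq> C' \<Longrightarrow> C' = C"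
proof -
  show "C \<subseteq> nodal_set u D" "\<exists>I \<gamma>. regular_analytic_curve I \<gamma> \<and> \<gamma> ` I = C"
    using assms by (simp_all add: nodal_curve_def parametrizes_def)
  show "C' = C" if "parametrizes J \<delta> C'" "C' \<subseteq> nodal_set u D" "C \<subseteq> C'" for C' J \<delta>
    using assms that unfolding nodal_curve_def by blast
qed

context nodal_root
begin

lemma lift_parametrizes: "lift k J s \<Longrightarrow> parametrizes J s (s ` J)"
  unfolding parametrizes_def using lift_regular(1) by blast

lemma nodal_curve_lift:
  assumes "nodal_curve u (ball 0 R) C" "C \<subseteq> L k"
  obtains J s where "lift k J s" "s ` J = C"
proof -
  obtain I \<gamma> where g: "regular_analytic_curve I \<gamma>" "\<gamma> ` I = C"
    using nodal_curveD(2)[OF assms(1)] by (elim exE conjE) (rule that)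
  then have "\<gamma> ` I \<subseteq> L k" using assms(2) by simp
  from curve_to_lift[OF g(1) this] show ?thesis using that g(2) by metis
qed

lemma lift_at_zero:
  assumes s: "lift k J s" and 0: "0 \<in> s ` J"
  shows "0 \<in> J" "s 0 = 0"
proof -
  obtain x where x: "x \<in> J" "s x = 0" using 0 by (metis imageE)
  have "of_real x * nodal_dir n k = 0" using s x phi0 unfolding lift_def by metis
  then have "x = 0" by simp
  then show "0 \<in> J" "s 0 = 0" using x by auto
qed

text \<open>Both lifts take the value 0 at the parameter 0, so they glue to one regular curve
  containing both traces; maximality makes each trace equal to the union.\<close>

lemma nodal_curve_unique:
  assumes C1: "nodal_curve u (ball 0 R) C1" "C1 \<subseteq> L k" "0 \<in> C1"
    and C2: "nodal_curve u (ball 0 R) C2" "C2 \<subseteq> L k" "0 \<in> C2"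
  shows "C1 = C2"
proof -
  obtain J1 s1 where s1: "lift k J1 s1" "s1 ` J1 = C1" using nodal_curve_lift[OF C1(1,2)] .
  obtain J2 s2 where s2: "lift k J2 s2" "s2 ` J2 = C2" using nodal_curve_lift[OF C2(1,2)] .
  have z: "0 \<in> J1" "s1 0 = 0" "0 \<in> J2" "s2 0 = 0"
    using lift_at_zero[OF s1(1)] lift_at_zero[OF s2(1)] s1 s2 C1 C2 by auto
  define s where "s = (\<lambda>x. if x \<in> J1 then s1 x else s2 x)"
  have l: "lift k (J1 \<union> J2) s" unfolding s_def using lift_glue[OF s1(1) s2(1) z(1,3)] z by simp
  have eq2: "s x = s2 x" if "x \<in> J2" for x
    using lift_unique[OF s1(1) s2(1) z(1,3)] z that by (auto simp: s_def)
  have im: "s ` (J1 \<union> J2) = C1 \<union> C2"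
  proof -
    have "s ` J1 = s1 ` J1" by (rule image_cong) (auto simp: s_def)
    moreover have "s ` J2 = s2 ` J2" by (rule image_cong) (auto simp: eq2)
    ultimately show ?thesis by (simp add: image_Un s1 s2)
  qed
  have p: "parametrizes (J1 \<union> J2) s (C1 \<union> C2)" using lift_parametrizes[OF l] im by simp
  have sub: "C1 \<union> C2 \<subseteq> N" using C1 C2 L_subset_N by blast
  have "C1 \<union> C2 = C1" using nodal_curveD(3)[OF C1(1) p sub] by simp
  moreover have "C1 \<union> C2 = C2" using nodal_curveD(3)[OF C2(1) p sub] by simp
  ultimately show ?thesis by simp
qed

lemma nodal_curve_in_L:
  assumes "nodal_curve u (ball 0 R) C"
  obtains k where "k < n" "C \<subseteq> L k"
proof -
  obtain I \<gamma> where g: "regular_analytic_curve I \<gamma>" "\<gamma> ` I = C"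
    using nodal_curveD(2)[OF assms(1)] by (elim exE conjE) (rule that)
  have "\<gamma> ` I \<subseteq> N" using nodal_curveD(1)[OF assms(1)] g(2) by simp
  from curve_in_L[OF g(1) this] show ?thesis using that g(2) by metis
qed

text \<open>Each nonzero point of \<open>L k\<close> lies on a nodal curve, which stays in a single
  preimage, namely \<open>L k\<close>, and passes through 0; by \<open>nodal_curve_unique\<close>
  this is always the same curve. Counting then identifies the number of curves with the exponent of
  the root.\<close>

lemma nodal_curves_eq_lines:
  assumes "only_nodal_curves_through_0 u (ball 0 R) m"
  shows "{C. nodal_curve u (ball 0 R) C} = L ` {..<n}" "m = n"
proof -
  have a: "card {C. nodal_curve u (ball 0 R) C} = m" "N = \<Union> {C. nodal_curve u (ball 0 R) C}"
    "\<And>C. nodal_curve u (ball 0 R) C \<Longrightarrow> 0 \<in> C"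
    using assms unfolding only_nodal_curves_through_0_def by blast+
  have cover: "\<exists>C. nodal_curve u (ball 0 R) C \<and> C \<subseteq> L k \<and> z \<in> C" if k: "k < n" "z \<in> L k" "z \<noteq> 0" for k z
  proof -
    have "z \<in> N" using that L_subset_N by blast
    then obtain C where C: "nodal_curve u (ball 0 R) C" "z \<in> C" using a(2) by blast
    obtain l where l: "l < n" "C \<subseteq> L l" using nodal_curve_in_L[OF C(1)] .
    then have "l = k" using L_disjoint[of l k z] C that by blast
    then show ?thesis using C l by blast
  qed
  have eqL: "C = L k" if C: "nodal_curve u (ball 0 R) C" "C \<subseteq> L k" "k < n" for C k
  proof
    show "L k \<subseteq> C"
    proof
      fix z assume z: "z \<in> L k"
      show "z \<in> C"
      proof (cases "z = 0")
        case True then show ?thesis using a(3)[OF C(1)] by simp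
      next
        case False
        then obtain C' where C': "nodal_curve u (ball 0 R) C'" "C' \<subseteq> L k" "z \<in> C'" using cover C z by blast
        then show ?thesis using nodal_curve_unique[OF C(1,2) a(3)[OF C(1)] C'(1,2) a(3)[OF C'(1)]] by simp
      qed
    qed
  qed (use C in simp)
  show eq: "{C. nodal_curve u (ball 0 R) C} = L ` {..<n}"
  proof (intro equalityI subsetI)
    fix C assume "C \<in> {C. nodal_curve u (ball 0 R) C}"
    then have C: "nodal_curve u (ball 0 R) C" by simp
    obtain k where "k < n" "C \<subseteq> L k" using nodal_curve_in_L[OF C] .
    then show "C \<in> L ` {..<n}" using eqL[OF C] by blast
  next
    fix C assume "C \<in> L ` {..<n}"
    then obtain k where k: "k < n" "C = L k" by blast
    obtain z where "z \<in> L k" "z \<noteq> 0" using L_nontrivial by blast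
    then obtain C' where "nodal_curve u (ball 0 R) C'" "C' \<subseteq> L k" using cover k by blast
    then show "C \<in> {C. nodal_curve u (ball 0 R) C}" using eqL k by auto
  qed
  show "m = n" using a(1) unfolding eq by (simp add: card_image[OF L_inj])
qed

text \<open>Maximality comes from \<open>curve_in_L\<close>: a regular curve containing
  \<open>L k\<close> stays in one \<open>L l\<close>, and since the two share a nonzero point, l =
  k.\<close>

lemma only_nodal_curves_if_lifts:
  assumes lifts: "\<And>k. k < n \<Longrightarrow> \<exists>J s. lift k J s \<and> s ` J = L k"
  shows "only_nodal_curves_through_0 u (ball 0 R) n" "\<And>k. k < n \<Longrightarrow> nodal_curve u (ball 0 R) (L k)"
proof -
  have par: "\<exists>I \<gamma>. parametrizes I \<gamma> (L k)" if "k < n" for k using lifts[OF that] lift_parametrizes by metis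
  show nc: "nodal_curve u (ball 0 R) (L k)" if k: "k < n" for k
    unfolding nodal_curve_def
  proof (intro conjI allI impI)
    fix C' J \<delta> assume C': "parametrizes J \<delta> C' \<and> C' \<subseteq> N \<and> L k \<subseteq> C'"
    then have d: "regular_analytic_curve J \<delta>" "\<delta> ` J = C'" "\<delta> ` J \<subseteq> N" by (auto simp: parametrizes_def)
    obtain l where l: "l < n" "C' \<subseteq> L l" using curve_in_L[OF d(1,3)] d(2) by metis
    obtain z where "z \<in> L k" "z \<noteq> 0" using L_nontrivial by blast
    then have "k = l" using L_disjoint[OF k l(1)] C' l by blast
    then show "C' = L k" using C' l by blast
  qed (use L_subset_N par[OF k] in blast)+
  have eq: "{C. nodal_curve u (ball 0 R) C} = L ` {..<n}"
  proof (intro equalityI subsetI)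
    fix C assume "C \<in> {C. nodal_curve u (ball 0 R) C}"
    then have C: "nodal_curve u (ball 0 R) C" by simp
    obtain k where k: "k < n" "C \<subseteq> L k" using nodal_curve_in_L[OF C] .
    obtain I \<gamma> where "parametrizes I \<gamma> (L k)" using par[OF k(1)] by blast
    then have "L k = C" using nodal_curveD(3)[OF C _ L_subset_N k(2)] by blast
    then show "C \<in> L ` {..<n}" using k by blast
  qed (use nc in blast)
  show "only_nodal_curves_through_0 u (ball 0 R) n"
    unfolding only_nodal_curves_through_0_def
  proof (intro conjI allI impI)
    show "0 \<in> C" if "nodal_curve u (ball 0 R) C" for C
    proof -
      have "C \<in> L ` {..<n}" using eq that by blast
      then show ?thesis using zero_in_L by blast
    qed
  qed (use eq N_eq card_image[OF L_inj] in auto)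
qed

text \<open>\<open>L k\<close> is closed in the disc, so a nodal curve filling it leaves every compact subset of the
  disc at both ends.\<close>

lemma nodal_curve_tails:
  assumes C: "nodal_curve u (ball 0 R) (L k)" and \<rho>: "0 < \<rho>" "\<rho> < R"
  obtains A B \<rho>' where "connected A" "connected B" "\<rho>' < R" "A \<union> B \<subseteq> {z\<in>L k. \<rho> < cmod z}"
    "{z\<in>L k. \<rho>' < cmod z} \<subseteq> A \<union> B"
proof -
  obtain J s where s: "lift k J s" "s ` J = L k" using nodal_curve_lift[OF C] by blast
  define E where "E = nodal_dir n k"
  define X where "X = (\<lambda>z. Re (\<phi> z / E))"
  have Xs: "X (s x) = x" if "x \<in> J" for x using s(1) that by (simp add: lift_def X_def E_def)
  have sc: "continuous_on J s" and J: "connected J" "open J" using s(1) by (auto simp: lift_def)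
  define K where "K = {x\<in>J. cmod (s x) \<le> \<rho>}"
  have "compact K"
  proof -
    have pc: "continuous_on (cball 0 \<rho>) \<phi>"
      by (rule continuous_on_subset[OF holomorphic_on_imp_continuous_on[OF hol]]) (use \<rho> in auto)
    have "L k \<inter> cball 0 \<rho> = cball 0 \<rho> \<inter> \<phi> -` nodal_line n k" using \<rho> by (auto simp: L_def)
    moreover have "closed (cball 0 \<rho> \<inter> \<phi> -` nodal_line n k)"
      by (rule continuous_closed_preimage[OF pc closed_cball closed_nodal_line])
    ultimately have c: "compact (L k \<inter> cball 0 \<rho>)"
      by (metis bounded_cball bounded_subset compact_eq_bounded_closed inf_le2)
    have "continuous_on (L k \<inter> cball 0 \<rho>) X" unfolding X_def E_def
      by (intro continuous_intros continuous_on_subset[OF pc]) auto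
    then have "compact (X ` (L k \<inter> cball 0 \<rho>))" using c by (rule compact_continuous_image)
    also have "X ` (L k \<inter> cball 0 \<rho>) = K"
    proof -
      have "L k \<inter> cball 0 \<rho> = s ` K" unfolding s(2)[symmetric] by (auto simp: K_def)
      moreover have "X ` s ` K = K" unfolding image_image using Xs by (auto simp: K_def intro!: image_eqI)
      ultimately show ?thesis by simp
    qed
    finally show ?thesis .
  qed
  have z0: "0 \<in> J" "s 0 = 0" using lift_at_zero[OF s(1)] s(2) zero_in_L by auto
  then have K0: "0 \<in> K" using \<rho> by (simp add: K_def)
  \<comment> \<open>The first and the last parameter at which the curve is within radius \<rho>; the
    two ends of the curve are what comes before a and after b.\<close>
  obtain a where a: "a \<in> K" "\<And>x. x \<in> K \<Longrightarrow> a \<le> x" using \<open>compact K\<close> K0 compact_attains_inf[of K] by blast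
  obtain b where b: "b \<in> K" "\<And>x. x \<in> K \<Longrightarrow> x \<le> b" using \<open>compact K\<close> K0 compact_attains_sup[of K] by blast
  have ab: "a \<in> J" "b \<in> J" "a \<le> b" using a b by (auto simp: K_def)
  have abJ: "{a..b} \<subseteq> J" using J(1) ab by (meson connected_contains_Icc)
  define A where "A = s ` (J \<inter> {..<a})"
  define B where "B = s ` (J \<inter> {b<..})"
  have iv: "is_interval J" using J(1) by (simp add: is_interval_connected_1)
  have "connected (J \<inter> {..<a})" "connected (J \<inter> {b<..})"
    using iv by (simp_all add: is_interval_connected_1[symmetric] is_interval_Int)
  then have "connected A" "connected B" unfolding A_def B_def
    by (auto intro!: connected_continuous_image continuous_on_subset[OF sc])
  moreover have "A \<union> B \<subseteq> {z\<in>L k. \<rho> < cmod z}"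
  proof -
    have "\<rho> < cmod (s x)" if "x \<in> J" "x < a \<or> b < x" for x
      using a(2)[of x] b(2)[of x] that by (force simp: K_def)
    then show ?thesis using s(2) by (auto simp: A_def B_def)
  qed
  moreover have "compact (s ` {a..b})" by (intro compact_continuous_image continuous_on_subset[OF sc abJ]) auto
  then obtain z where z: "z \<in> s ` {a..b}" "\<And>y. y \<in> s ` {a..b} \<Longrightarrow> cmod y \<le> cmod z"
    using continuous_attains_sup[of "s ` {a..b}" cmod] ab by (auto intro: continuous_intros)
  \<comment> \<open>Beyond the largest modulus on the compact middle piece only the two ends
    remain.\<close>
  define \<rho>' where "\<rho>' = cmod z"
  have "z \<in> L k" using z(1) abJ s(2) by blast
  then have "\<rho>' < R" by (simp add: \<rho>'_def L_def)
  moreover have "{z\<in>L k. \<rho>' < cmod z} \<subseteq> A \<union> B"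
  proof
    fix y assume y: "y \<in> {z\<in>L k. \<rho>' < cmod z}"
    then obtain x where x: "x \<in> J" "y = s x" using s(2) by blast
    have "x \<notin> {a..b}" using z(2)[of y] y x by (auto simp: \<rho>'_def)
    then show "y \<in> A \<union> B" using x by (auto simp: A_def B_def)
  qed
  ultimately show ?thesis using that by blast
qed

end

subsection \<open>Connectedness of the nodal set\<close>

locale harmonic_disc =
  fixes f :: "complex \<Rightarrow> complex" and R :: real
  assumes hol: "f holomorphic_on ball 0 R" and nc: "\<not> f constant_on ball 0 R"
begin

definition Z :: "complex set" where "Z = {z \<in> ball 0 R. Re (f z) = 0}"

text \<open>On the frontier of a region enclosed by K the real part of f vanishes. The maximum
  principle for exp f and exp (- f) makes it vanish inside as well, against the open mapping
  theorem.\<close>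

lemma connected_Compl_compact_nodal:
  assumes K: "compact K" "K \<subseteq> Z"
  shows "connected (- K)"
proof -
  have "inside K = {}"
  proof (rule ccontr)
    assume ne: "inside K \<noteq> {}"
    define S where "S = inside K"
    have cl: "closed K" using K(1) by (rule compact_imp_closed)
    have S: "open S" "bounded S" "frontier S \<subseteq> K"
      using open_inside[OF cl] bounded_inside[OF compact_imp_bounded[OF K(1)]] frontier_inside_subset[OF cl]
      by (auto simp: S_def)
    have KD: "K \<subseteq> ball 0 R" using K(2) by (auto simp: Z_def)
    have "- ball 0 R \<subseteq> outside K" using KD by (intro outside_subset_convex) auto
    then have SD: "S \<subseteq> ball 0 R" unfolding S_def inside_outside by blast
    have clD: "closure S \<subseteq> ball 0 R"
      using S(3) SD KD S(1) by (metis closure_Un_frontier sup.boundedI order_trans)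
    have le: "Re (c * f z) \<le> 0" if z: "z \<in> S" and c: "c = 1 \<or> c = -1" for z and c :: complex
    proof -
      have "norm (exp (c * f z)) \<le> 1"
      proof (rule maximum_modulus_frontier[where f="\<lambda>z. exp (c * f z)" and S=S])
        show "(\<lambda>z. exp (c * f z)) holomorphic_on interior S"
          using hol SD S(1) by (intro holomorphic_intros) (auto simp: interior_open intro: holomorphic_on_subset)
        show "continuous_on (closure S) (\<lambda>z. exp (c * f z))"
          by (intro continuous_intros continuous_on_subset[OF holomorphic_on_imp_continuous_on[OF hol] clD])
        show "norm (exp (c * f z)) \<le> 1" if "z \<in> frontier S" for z
        proof -
          have "Re (f z) = 0" using that S(3) K(2) by (auto simp: Z_def)
          then show ?thesis using c by auto
        qed
      qed (use z S in auto)
      then show ?thesis by simp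
    qed
    have zero: "Re (f z) = 0" if "z \<in> S" for z using le[OF that, of 1] le[OF that, of "-1"] by simp
    have "open (f ` S)" by (rule open_mapping_thm[OF hol open_ball connected_ball S(1) SD nc])
    moreover obtain z where z: "z \<in> S" using ne by (auto simp: S_def)
    ultimately obtain e where e: "e > 0" "ball (f z) e \<subseteq> f ` S" by (meson imageI openE)
    have "f z + of_real (e / 2) \<in> ball (f z) e" using e(1) by (simp add: dist_norm)
    then obtain y where "y \<in> S" "f z + of_real (e / 2) = f y" using e(2) by blast
    then have "Re (f z) + e / 2 = Re (f y)" by (metis Re_complex_of_real plus_complex.simps(1))
    then show False using zero z \<open>y \<in> S\<close> e(1) by simp
  qed
  then have "- K = outside K" using inside_Un_outside[of K] by blast
  then show ?thesis using connected_outside[OF compact_imp_bounded[OF K(1)]] by simp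
qed

text \<open>The absence of loops in usable form: by Janiszewski's theorem two continua whose union
  does not separate the plane have a connected intersection.\<close>

lemma connected_Int_nodal:
  assumes "compact S" "connected S" "S \<subseteq> Z" "compact T" "connected T" "T \<subseteq> Z"
  shows "connected (S \<inter> T)"
  using assms by (intro Janiszewski_dual connected_Compl_compact_nodal) auto

end

lemma real_analytic_locally_injective:
  assumes "real_analytic_at \<gamma> t" "velocity \<gamma> t \<noteq> 0"
  obtains d where "d > 0" "inj_on \<gamma> (ball t d)"
proof -
  obtain F e where F: "e > 0" "F holomorphic_on ball 0 e" "\<And>s. \<bar>s\<bar> < e \<Longrightarrow> \<gamma> (t + s) = F (of_real s)"
    using assms(1) unfolding real_analytic_at_iff_holomorphic by blast
  have "deriv F 0 \<noteq> 0" using complexification_velocity(2)[OF F, of 0] F(1) assms(2) by simp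
  then obtain r where r: "r > 0" "ball (0::complex) r \<subseteq> ball 0 e" "inj_on F (ball 0 r)"
    using has_complex_derivative_locally_injective[OF F(2) _ open_ball] F(1) by (metis centre_in_ball)
  have "inj_on \<gamma> (ball t (min r e))"
  proof (rule inj_onI)
    fix x y assume xy: "x \<in> ball t (min r e)" "y \<in> ball t (min r e)" "\<gamma> x = \<gamma> y"
    then have "F (of_real (x - t)) = F (of_real (y - t))"
      using F(3)[of "x - t"] F(3)[of "y - t"] by (simp add: dist_real_def abs_minus_commute)
    moreover have "complex_of_real (x - t) \<in> ball 0 r" "complex_of_real (y - t) \<in> ball 0 r"
      using xy by (simp_all add: dist_real_def abs_minus_commute del: of_real_diff)
    ultimately have "complex_of_real (x - t) = complex_of_real (y - t)" using r(3) by (meson inj_onD)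
    then show "x = y" by simp
  qed
  then show ?thesis using that[of "min r e"] r(1) F(1) by simp
qed

context harmonic_disc
begin

text \<open>A shortest parameter interval with equal end values would be a simple loop. Cut at its
  midpoint, it gives two arcs that meet in exactly two points, so their intersection is
  disconnected, against \<open>connected_Int_nodal\<close>.\<close>

lemma nodal_curve_injective:
  assumes \<gamma>: "regular_analytic_curve I \<gamma>" "\<gamma> ` I \<subseteq> Z"
  shows "inj_on \<gamma> I"
proof -
  note gd = regular_analytic_curveD[OF \<gamma>(1)]
  have "\<gamma> a \<noteq> \<gamma> b" if ab: "a \<in> I" "b \<in> I" "a < b" for a b
  proof
    assume eq: "\<gamma> a = \<gamma> b"
    have sub: "{a..b} \<subseteq> I" using gd(3) ab by (meson connected_contains_Icc)
    \<comment> \<open>A Lebesgue number of this cover by balls of injectivity bounds the distance of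
      distinct parameters with equal values from below. The pairs of such parameters thus form a
      compact set, and a shortest one exists.\<close>
    define G where "G = {ball t d | t d. inj_on \<gamma> (ball t d)}"
    have "{a..b} \<subseteq> \<Union> G"
    proof
      fix t assume "t \<in> {a..b}"
      then have "t \<in> I" using sub by blast
      then obtain d where "d > 0" "inj_on \<gamma> (ball t d)" using real_analytic_locally_injective[OF gd(4,5)] by blast
      then show "t \<in> \<Union> G" unfolding G_def using centre_in_ball by blast
    qed
    moreover have "open B" if "B \<in> G" for B using that by (auto simp: G_def)
    ultimately obtain e where e: "e > 0" "\<And>x. x \<in> {a..b} \<Longrightarrow> \<exists>B\<in>G. ball x e \<subseteq> B"
      by (rule Heine_Borel_lemma[OF compact_Icc]) (assumption, erule that, blast)
    have far: "e \<le> y - x" if xy: "x \<in> {a..b}" "x < y" "\<gamma> x = \<gamma> y" for x y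
    proof (rule ccontr)
      assume "\<not> e \<le> y - x"
      then have "x \<in> ball x e" "y \<in> ball x e" using e(1) that by (auto simp: dist_real_def)
      moreover obtain B where "inj_on \<gamma> B" "ball x e \<subseteq> B" using e(2)[OF xy(1)] by (auto simp: G_def)
      ultimately have "x = y" using that(3) by (meson inj_onD subsetD)
      then show False using that by simp
    qed
    define P where "P = {p \<in> {a..b} \<times> {a..b}. e \<le> snd p - fst p \<and> \<gamma> (fst p) - \<gamma> (snd p) = 0}"
    have cg: "continuous_on {a..b} \<gamma>" using gd(7) sub continuous_on_subset by blast
    have "closed P"
    proof -
      have c: "continuous_on ({a..b} \<times> {a..b}) (\<lambda>p. \<gamma> (fst p) - \<gamma> (snd p))"
        by (intro continuous_intros continuous_on_compose2[OF cg]) auto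
      have cl: "closed ({a..b} \<times> {a..b})" by (intro closed_Times closed_real_atLeastAtMost)
      have "closed (({a..b} \<times> {a..b}) \<inter> (\<lambda>p. \<gamma> (fst p) - \<gamma> (snd p)) -` {0})"
        by (rule continuous_closed_preimage[OF c cl]) simp
      moreover have "closed {p. e \<le> snd p - fst p}" by (intro closed_Collect_le continuous_intros)
      moreover have "P = (({a..b} \<times> {a..b}) \<inter> (\<lambda>p. \<gamma> (fst p) - \<gamma> (snd p)) -` {0}) \<inter> {p. e \<le> snd p - fst p}"
        by (auto simp: P_def)
      ultimately show ?thesis by (simp only: closed_Int)
    qed
    moreover have "bounded P" by (rule bounded_subset[of "{a..b} \<times> {a..b}"]) (auto simp: P_def bounded_Times)
    ultimately have "compact P" by (simp add: compact_eq_bounded_closed)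
    moreover have "(a, b) \<in> P" using far[of a b] ab eq by (auto simp: P_def)
    ultimately obtain p where p: "p \<in> P" "\<And>q. q \<in> P \<Longrightarrow> snd p - fst p \<le> snd q - fst q"
    proof -
      assume P: "compact P" "(a, b) \<in> P"
      have "continuous_on P (\<lambda>p. snd p - fst p)" by (intro continuous_intros)
      then have "\<exists>p\<in>P. \<forall>q\<in>P. snd p - fst p \<le> snd q - fst q" using P by (intro continuous_attains_inf) auto
      then show ?thesis using that by blast
    qed
    define x where "x = fst p"
    define y where "y = snd p"
    have xy: "x \<in> {a..b}" "y \<in> {a..b}" "x < y" "\<gamma> x = \<gamma> y" using p(1) e(1) by (auto simp: P_def x_def y_def)
    have only: "x' = x \<and> y' = y" if "x' \<in> {x..y}" "y' \<in> {x..y}" "x' < y'" "\<gamma> x' = \<gamma> y'" for x' y'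
    proof -
      have "(x', y') \<in> P" using that xy far[of x' y'] by (auto simp: P_def)
      then have "y - x \<le> y' - x'" using p(2) by (force simp: x_def y_def)
      then show ?thesis using that by auto
    qed
    define c where "c = (x + y) / 2"
    have c: "x < c" "c < y" using xy by (auto simp: c_def)
    have subs: "{x..c} \<subseteq> {a..b}" "{c..y} \<subseteq> {a..b}" using xy c by auto
    have "connected (\<gamma> ` {x..c} \<inter> \<gamma> ` {c..y})"
      using \<gamma>(2) sub subs by (intro connected_Int_nodal compact_continuous_image connected_continuous_image
          continuous_on_subset[OF cg]) (auto simp: image_subset_iff subset_iff)
    moreover have "\<gamma> ` {x..c} \<inter> \<gamma> ` {c..y} = {\<gamma> x, \<gamma> c}"
    proof
      show "\<gamma> ` {x..c} \<inter> \<gamma> ` {c..y} \<subseteq> {\<gamma> x, \<gamma> c}"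
      proof
        fix w assume "w \<in> \<gamma> ` {x..c} \<inter> \<gamma> ` {c..y}"
        then obtain x' y' where w: "x' \<in> {x..c}" "y' \<in> {c..y}" "w = \<gamma> x'" "w = \<gamma> y'" by blast
        show "w \<in> {\<gamma> x, \<gamma> c}"
        proof (cases "x' < y'")
          case True then show ?thesis using only[of x' y'] w c by auto
        next
          case False
          then have "x' = c" using w by auto
          then show ?thesis using w by simp
        qed
      qed
      have "\<gamma> x \<in> \<gamma> ` {x..c}" "\<gamma> c \<in> \<gamma> ` {x..c}" "\<gamma> c \<in> \<gamma> ` {c..y}" "\<gamma> y \<in> \<gamma> ` {c..y}"
        using c by (auto intro!: imageI)
      then show "{\<gamma> x, \<gamma> c} \<subseteq> \<gamma> ` {x..c} \<inter> \<gamma> ` {c..y}" unfolding xy(4) by simp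
    qed
    ultimately have "connected {\<gamma> x, \<gamma> c}" by simp
    moreover have "\<gamma> x \<noteq> \<gamma> c" using only[of x c] c by auto
    ultimately show False using connected_finite_iff_sing[of "{\<gamma> x, \<gamma> c}"] by (auto simp: doubleton_eq_iff)
  qed
  then show ?thesis by (metis inj_onI linorder_neqE_linordered_idom)
qed

text \<open>\<open>\<psi>\<close> stands for a local coordinate in which the nodal set is a union of rays; \<open>sgn (\<psi> z)\<close> is
  the ray on which \<open>z\<close> lies.\<close>

lemma curve_one_sided_direction:
  assumes \<gamma>: "regular_analytic_curve I \<gamma>" "inj_on \<gamma> I" and I: "a \<in> I" "t \<in> I" "a \<noteq> t" "\<gamma> t = p"
    and \<psi>: "(\<psi> has_field_derivative c) (at p)" "\<psi> p = 0" "c \<noteq> 0"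
  shows "((\<lambda>z. sgn (\<psi> z)) \<longlongrightarrow> of_real (sgn (a - t)) * sgn (velocity \<gamma> t * c)) (at p within \<gamma> ` closed_segment a t)"
proof -
  note gd = regular_analytic_curveD[OF \<gamma>(1)]
  define S where "S = closed_segment a t"
  define w where "w = velocity \<gamma> t * c"
  have w: "w \<noteq> 0" using gd(5)[OF I(2)] \<psi>(3) by (simp add: w_def)
  have SI: "S \<subseteq> I" unfolding S_def
    using \<gamma>(1) I by (intro closed_segment_subset) (auto simp: regular_analytic_curve_def is_interval_convex_1)
  have cg: "continuous_on S \<gamma>" using gd(7) SI continuous_on_subset by blast
  have injS: "inj_on \<gamma> S" using \<gamma>(2) SI inj_on_subset by blast
  have tS: "t \<in> S" by (simp add: S_def)
  \<comment> \<open>The inverse of \<gamma> on the compact segment is continuous, so the limit along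
    the image can be computed in the parameter. There s - t has the sign of a - t, which is the
    scalar factor of the limit.\<close>
  define \<tau> where "\<tau> = inv_into S \<gamma>"
  have \<tau>: "\<tau> (\<gamma> s) = s" if "s \<in> S" for s using injS that by (simp add: \<tau>_def)
  have "compact S" by (simp add: S_def)
  then have "continuous_on (\<gamma> ` S) \<tau>" using cg \<tau> by (intro continuous_on_inv) auto
  then have "(\<tau> \<longlongrightarrow> \<tau> p) (at p within \<gamma> ` S)" using tS I(4) by (auto simp: continuous_on_def)
  moreover have "\<tau> p = t" using \<tau>[OF tS] I(4) by simp
  moreover have "eventually (\<lambda>z. \<tau> z \<in> S \<and> \<tau> z \<noteq> t) (at p within \<gamma> ` S)"
  proof -
    have "eventually (\<lambda>z. z \<in> \<gamma> ` S \<and> z \<noteq> p) (at p within \<gamma> ` S)" by (simp add: eventually_at_filter)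
    then show ?thesis by eventually_elim (use \<tau> I(4) in auto)
  qed
  ultimately have fl: "filterlim \<tau> (at t within S) (at p within \<gamma> ` S)"
    unfolding filterlim_at by auto
  have "((\<lambda>s. \<psi> (\<gamma> s)) has_vector_derivative w) (at t)"
    using field_vector_diff_chain_at[OF gd(6)[OF I(2)], of \<psi> c] \<psi>(1) I(4) by (simp add: o_def w_def)
  from has_vector_derivative_quotient[OF this] have "((\<lambda>s. \<psi> (\<gamma> s) / of_real (s - t)) \<longlongrightarrow> w) (at t)"
    by (simp add: I(4) \<psi>(2))
  then have "((\<lambda>s. \<psi> (\<gamma> s) / of_real (s - t)) \<longlongrightarrow> w) (at t within S)"
    by (rule tendsto_within_subset) simp
  then have "((\<lambda>s. of_real (sgn (a - t)) * sgn (\<psi> (\<gamma> s) / of_real (s - t))) \<longlongrightarrow> of_real (sgn (a - t)) * sgn w) (at t within S)"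
    by (intro tendsto_intros w)
  moreover have "eventually (\<lambda>s. of_real (sgn (a - t)) * sgn (\<psi> (\<gamma> s) / of_real (s - t)) = sgn (\<psi> (\<gamma> s))) (at t within S)"
  proof -
    have "eventually (\<lambda>s. s \<in> S \<and> s \<noteq> t) (at t within S)" by (simp add: eventually_at_filter)
    then show ?thesis
    proof eventually_elim
      case (elim s)
      have "sgn (s - t) = sgn (a - t)"
        using elim by (auto simp: S_def closed_segment_eq_real_ivl sgn_if split: if_splits)
      moreover have "\<psi> (\<gamma> s) = of_real (s - t) * (\<psi> (\<gamma> s) / of_real (s - t))" using elim by simp
      then have "sgn (\<psi> (\<gamma> s)) = sgn (complex_of_real (s - t)) * sgn (\<psi> (\<gamma> s) / of_real (s - t))"
        by (metis sgn_mult)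
      ultimately show ?case by (simp add: sgn_of_real del: of_real_diff)
    qed
  qed
  ultimately have "((\<lambda>s. sgn (\<psi> (\<gamma> s))) \<longlongrightarrow> of_real (sgn (a - t)) * sgn w) (at t within S)"
    by (rule Lim_transform_eventually)
  then have "((\<lambda>z. sgn (\<psi> (\<gamma> (\<tau> z)))) \<longlongrightarrow> of_real (sgn (a - t)) * sgn w) (at p within \<gamma> ` S)"
    using fl by (rule filterlim_compose)
  moreover have "eventually (\<lambda>z. sgn (\<psi> (\<gamma> (\<tau> z))) = sgn (\<psi> z)) (at p within \<gamma> ` S)"
  proof -
    have "eventually (\<lambda>z. z \<in> \<gamma> ` S) (at p within \<gamma> ` S)" by (simp add: eventually_at_filter)
    then show ?thesis by eventually_elim (use \<tau> in auto)
  qed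
  ultimately show ?thesis unfolding S_def w_def by (rule Lim_transform_eventually)
qed

text \<open>The local normal form of a holomorphic function: with k the order of the zero of f - f p
  at p, a k-th root \<psi> of f - f p is a local coordinate, and h is its inverse near 0. If Re (f
  p) = 0, the nodal set near p looks like that of Re (w ^ k), with at least two lines at a critical
  point.\<close>

lemma local_power_coordinate:
  assumes p: "p \<in> ball 0 R" and r0: "r0 > 0"
  obtains k \<psi> h r \<epsilon> where "k > 0" "\<epsilon> > 0" "r > 0" "r \<le> r0" "ball p r \<subseteq> ball 0 R" "\<psi> p = 0"
    "(\<psi> has_field_derivative deriv \<psi> p) (at p)" "deriv \<psi> p \<noteq> 0"
    "\<And>z. z \<in> ball p r \<Longrightarrow> f z = f p + \<psi> z ^ k" "continuous_on (ball 0 \<epsilon>) h" "h 0 = p"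
    "\<And>w. w \<in> ball 0 \<epsilon> \<Longrightarrow> h w \<in> ball p r \<and> \<psi> (h w) = w" "deriv f p = 0 \<Longrightarrow> k \<ge> 2"
proof -
  have "\<exists>k>0. (deriv ^^ k) f p \<noteq> 0"
  proof (rule ccontr)
    assume "\<not> ?thesis"
    then have d0: "(deriv ^^ i) f p = 0" if "0 < i" for i using that by blast
    have "f w = f p" if "w \<in> ball 0 R" for w
      by (rule holomorphic_fun_eq_const_on_connected[OF hol open_ball connected_ball d0 p that])
    then show False using nc unfolding constant_on_def by blast
  qed
  then obtain k where k: "k > 0" "(deriv ^^ k) f p \<noteq> 0" "\<And>i. 0 < i \<Longrightarrow> i < k \<Longrightarrow> (deriv ^^ i) f p = 0"
    using exists_least_iff[of "\<lambda>k. k > 0 \<and> (deriv ^^ k) f p \<noteq> 0"] by blast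
  obtain g r1 where g: "r1 > 0" "g holomorphic_on ball p r1"
      "\<And>w. w \<in> ball p r1 \<Longrightarrow> f w - f p = ((w - p) * g w) ^ k" "\<And>w. w \<in> ball p r1 \<Longrightarrow> g w \<noteq> 0"
    by (rule holomorphic_factor_order_of_zero_strong[OF hol open_ball p k]) (assumption, assumption, rule that)
  obtain r2 where r2: "r2 > 0" "ball p r2 \<subseteq> ball 0 R" using p open_ball openE by blast
  define r3 where "r3 = min r0 (min r1 r2)"
  have r3: "r3 > 0" "r3 \<le> r0" "r3 \<le> r1" "r3 \<le> r2" using r0 g(1) r2(1) by (auto simp: r3_def)
  define \<psi> where "\<psi> = (\<lambda>w. (w - p) * g w)"
  have hpsi: "\<psi> holomorphic_on ball p r3" unfolding \<psi>_def
    by (intro holomorphic_intros holomorphic_on_subset[OF g(2)]) (use r3 in auto)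
  have dpsi: "(\<psi> has_field_derivative deriv \<psi> p) (at p)" using hpsi r3(1) by (intro holomorphic_derivI) auto
  moreover have "(\<psi> has_field_derivative g p) (at p)"
  proof -
    have "(g has_field_derivative deriv g p) (at p)" using g(1,2) by (intro holomorphic_derivI) auto
    then show ?thesis unfolding \<psi>_def by (auto intro!: derivative_eq_intros)
  qed
  ultimately have "deriv \<psi> p = g p" by (rule DERIV_unique)
  then have dn: "deriv \<psi> p \<noteq> 0" using g(1,4) by simp
  have "p \<in> ball p r3" using r3(1) by simp
  then obtain r where r: "r > 0" "ball p r \<subseteq> ball p r3" "open (\<psi> ` ball p r)" "inj_on \<psi> (ball p r)"
    by (rule has_complex_derivative_locally_invertible[OF hpsi _ open_ball dn]) (rule that)
  have rr: "r \<le> r3" using r(1,2) by (auto simp: ball_subset_ball_iff)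
  have hp: "\<psi> holomorphic_on ball p r" using hpsi r(2) holomorphic_on_subset by blast
  obtain h where h: "h holomorphic_on \<psi> ` ball p r" "\<And>z. z \<in> ball p r \<Longrightarrow> h (\<psi> z) = z"
    by (rule holomorphic_has_inverse[OF hp open_ball r(4)]) (rule that)
  have psi0: "\<psi> p = 0" by (simp add: \<psi>_def)
  then have "0 \<in> \<psi> ` ball p r" using r(1) by (metis centre_in_ball imageI)
  then obtain \<epsilon> where \<epsilon>: "\<epsilon> > 0" "ball 0 \<epsilon> \<subseteq> \<psi> ` ball p r" using r(3) openE by blast
  show ?thesis
  proof (rule that[of k \<epsilon> r \<psi> h])
    show "f z = f p + \<psi> z ^ k" if "z \<in> ball p r" for z
      using g(3)[of z] that rr r3 by (simp add: \<psi>_def algebra_simps)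
    show "continuous_on (ball 0 \<epsilon>) h"
      using holomorphic_on_imp_continuous_on[OF h(1)] \<epsilon>(2) continuous_on_subset by blast
    show "h 0 = p" using h(2)[of p] r(1) psi0 by simp
    show "h w \<in> ball p r \<and> \<psi> (h w) = w" if w: "w \<in> ball 0 \<epsilon>" for w
    proof -
      obtain z where "z \<in> ball p r" "w = \<psi> z" using \<epsilon>(2) w by blast
      then show ?thesis using h(2) by simp
    qed
    show "k \<ge> 2" if "deriv f p = 0"
    proof (rule ccontr)
      assume "\<not> k \<ge> 2"
      then have "k = 1" using k(1) by simp
      then show False using k(2) that by simp
    qed
    show "ball p r \<subseteq> ball 0 R" using r2 rr r3 by (meson order_trans subset_ball)
  qed (use k \<epsilon> r rr r3 psi0 dpsi dn in auto)
qed

text \<open>At a critical point \<open>p \<noteq> 0\<close> of the nodal set at least two lines cross. The curve joining \<open>0\<close>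
  to a point of one of the rays at \<open>p\<close> either avoids \<open>p\<close> or passes it straight on; in both cases \<open>0\<close> is
  joined to \<open>p\<close> by an arc that arrives along the line of this ray. Since the nodal set contains no
  loops, two such arcs arrive along the same ray.\<close>

lemma nodal_regular_away_from_0:
  assumes H: "\<And>q. q \<in> Z \<Longrightarrow> \<exists>I \<gamma> t0 tq. regular_analytic_curve I \<gamma> \<and> \<gamma> ` I \<subseteq> Z \<and> t0 \<in> I \<and> tq \<in> I \<and> \<gamma> t0 = 0 \<and> \<gamma> tq = q"
    and p: "p \<in> Z" "p \<noteq> 0"
  shows "deriv f p \<noteq> 0"
proof
  assume crit: "deriv f p = 0"
  have pD: "p \<in> ball 0 R" and fp: "Re (f p) = 0" using p by (auto simp: Z_def)
  obtain k \<psi> h r \<epsilon> where c: "k > 0" "\<epsilon> > 0" "r > 0" "r \<le> cmod p" "ball p r \<subseteq> ball 0 R" "\<psi> p = 0"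
    "(\<psi> has_field_derivative deriv \<psi> p) (at p)" "deriv \<psi> p \<noteq> 0"
    "\<And>z. z \<in> ball p r \<Longrightarrow> f z = f p + \<psi> z ^ k" "continuous_on (ball 0 \<epsilon>) h" "h 0 = p"
    "\<And>w. w \<in> ball 0 \<epsilon> \<Longrightarrow> h w \<in> ball p r \<and> \<psi> (h w) = w" "deriv f p = 0 \<Longrightarrow> k \<ge> 2"
    using local_power_coordinate[OF pD, of "cmod p"] p(2) by (metis zero_less_norm_iff)
  have k2: "k \<ge> 2" using c(13) crit by blast
  define \<delta> where "\<delta> = \<epsilon> / 2"
  have \<delta>: "\<delta> > 0" "\<delta> < \<epsilon>" using c(2) by (auto simp: \<delta>_def)
  have main: "\<exists>A d. compact A \<and> connected A \<and> A \<subseteq> Z \<and> 0 \<in> A \<and> p \<in> A \<and> (d = e \<or> d = - e) \<and>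
      ((\<lambda>z. sgn (\<psi> z)) \<longlongrightarrow> d) (at p within A)" if e: "cmod e = 1" "Re (e ^ k) = 0" for e
  proof -
    \<comment> \<open>A piece of the ray at p in the direction e of the coordinate \<psi>; its outer
      end is q.\<close>
    define T where "T = (\<lambda>s. h (of_real s * e)) ` {0..\<delta>}"
    have inb: "of_real s * e \<in> ball 0 \<epsilon>" if "s \<in> {0..\<delta>}" for s using that \<delta> e by (simp add: norm_mult)
    have ch: "continuous_on {0..\<delta>} (\<lambda>s. h (of_real s * e))"
      by (intro continuous_on_compose2[OF c(10)] continuous_intros) (use inb in auto)
    have T: "compact T" "connected T" unfolding T_def
      using ch by (auto intro: compact_continuous_image connected_continuous_image)
    have TE: "\<exists>s\<in>{0..\<delta>}. z = h (of_real s * e) \<and> \<psi> z = of_real s * e \<and> z \<in> ball p r" if "z \<in> T" for z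
      using that c(12)[OF inb] unfolding T_def by blast
    have TZ: "T \<subseteq> Z"
    proof
      fix z assume "z \<in> T"
      then obtain s where s: "\<psi> z = of_real s * e" "z \<in> ball p r" using TE by blast
      have "f z = f p + of_real (s ^ k) * e ^ k" using c(9)[OF s(2)] s(1) by (simp add: power_mult_distrib)
      then have "Re (f z) = 0" using fp e(2) by simp
      then show "z \<in> Z" using s(2) c(5) by (auto simp: Z_def)
    qed
    have pT: "p \<in> T" unfolding T_def using \<delta> c(11) by (intro image_eqI[of _ _ 0]) auto
    have sgnT: "sgn (\<psi> z) = e" if "z \<in> T" "z \<noteq> p" for z
    proof -
      obtain s where s: "s \<in> {0..\<delta>}" "z = h (of_real s * e)" "\<psi> z = of_real s * e" using TE \<open>z \<in> T\<close> by blast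
      have "s \<noteq> 0" using s(2) that(2) c(11) by auto
      then have "s > 0" using s(1) by simp
      then show ?thesis using e(1) unfolding s(3) sgn_mult by (simp add: sgn_of_real sgn_eq)
    qed
    define q where "q = h (of_real \<delta> * e)"
    have qT: "q \<in> T" unfolding q_def T_def using \<delta> by auto
    have psiq: "\<psi> q = of_real \<delta> * e" using c(12)[OF inb[of \<delta>]] \<delta> by (simp add: q_def)
    have e0: "e \<noteq> 0" using e(1) by auto
    have qp: "q \<noteq> p" using psiq c(6) \<delta> e0 by auto
    obtain I \<gamma> t0 tq where g: "regular_analytic_curve I \<gamma>" "\<gamma> ` I \<subseteq> Z" "t0 \<in> I" "tq \<in> I" "\<gamma> t0 = 0" "\<gamma> tq = q"
      using H[of q] qT TZ by blast
    note gd = regular_analytic_curveD[OF g(1)]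
    have inj: "inj_on \<gamma> I" by (rule nodal_curve_injective[OF g(1,2)])
    have seg: "closed_segment a b \<subseteq> I" if "a \<in> I" "b \<in> I" for a b
      using g(1) that by (intro closed_segment_subset) (auto simp: regular_analytic_curve_def is_interval_convex_1)
    have arc: "compact (\<gamma> ` closed_segment a b) \<and> connected (\<gamma> ` closed_segment a b) \<and> \<gamma> ` closed_segment a b \<subseteq> Z"
      if "a \<in> I" "b \<in> I" for a b
    proof (intro conjI)
      show "compact (\<gamma> ` closed_segment a b)" "connected (\<gamma> ` closed_segment a b)"
        using continuous_on_subset[OF gd(7) seg[OF that]]
        by (auto intro: compact_continuous_image connected_continuous_image)
      show "\<gamma> ` closed_segment a b \<subseteq> Z" using g(2) seg[OF that] by blast
    qed
    define S where "S = \<gamma> ` closed_segment t0 tq"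
    have S: "compact S" "connected S" "S \<subseteq> Z" using arc[OF g(3,4)] by (auto simp: S_def)
    have 0: "0 \<in> S" "q \<in> S" unfolding S_def using g(5,6) by (auto intro: image_eqI[of _ _ t0] image_eqI[of _ _ tq])
    show ?thesis
    proof (cases "p \<in> S")
      case False
      \<comment> \<open>Here the arc from 0 to q misses p, so appending T leads to p along the ray
        e, and near p nothing but T is present.\<close>
      have "eventually (\<lambda>z. z \<in> - S) (nhds p)"
        using False compact_imp_closed[OF S(1)] by (intro eventually_nhds_in_open) auto
      then have "eventually (\<lambda>z. z \<in> - S) (at p within S \<union> T)" by (simp add: eventually_at_filter eventually_mono)
      moreover have "eventually (\<lambda>z. z \<in> S \<union> T \<and> z \<noteq> p) (at p within S \<union> T)" by (simp add: eventually_at_filter)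
      ultimately have "eventually (\<lambda>z. sgn (\<psi> z) = e) (at p within S \<union> T)"
        by eventually_elim (use sgnT in auto)
      then have "((\<lambda>z. sgn (\<psi> z)) \<longlongrightarrow> e) (at p within S \<union> T)" by (rule tendsto_eventually)
      moreover have "compact (S \<union> T)" "connected (S \<union> T)"
        using S T 0 qT by (auto intro: compact_Un connected_Un)
      ultimately show ?thesis using S TZ 0 pT by (intro exI[of _ "S \<union> T"] exI[of _ e]) auto
    next
      case True
      then obtain tp where tp: "tp \<in> closed_segment t0 tq" "\<gamma> tp = p" by (auto simp: S_def)
      have tpI: "tp \<in> I" using tp(1) seg[OF g(3,4)] by blast
      have ne: "tp \<noteq> t0" "tp \<noteq> tq" using tp(2) g(5,6) p(2) qp by auto
      define P where "P = \<gamma> ` closed_segment tq tp"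
      define Q where "Q = \<gamma> ` closed_segment t0 tp"
      define w where "w = velocity \<gamma> tp * deriv \<psi> p"
      have P: "compact P" "connected P" "P \<subseteq> Z" using arc[OF g(4) tpI] by (auto simp: P_def)
      have Q: "compact Q" "connected Q" "Q \<subseteq> Z" using arc[OF g(3) tpI] by (auto simp: Q_def)
      have limP: "((\<lambda>z. sgn (\<psi> z)) \<longlongrightarrow> of_real (sgn (tq - tp)) * sgn w) (at p within P)"
        unfolding P_def w_def by (rule curve_one_sided_direction[OF g(1) inj g(4) tpI _ tp(2) c(7,6,8)]) (use ne in auto)
      have limQ: "((\<lambda>z. sgn (\<psi> z)) \<longlongrightarrow> of_real (sgn (t0 - tp)) * sgn w) (at p within Q)"
        unfolding Q_def w_def by (rule curve_one_sided_direction[OF g(1) inj g(3) tpI _ tp(2) c(7,6,8)]) (use ne in auto)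
      \<comment> \<open>The intersection of T and P is connected and contains both ends p and q of
        T, so it is all of T. Hence the curve leaves p towards q along the ray e.\<close>
      have TP: "T \<subseteq> P"
      proof -
        have "connected (T \<inter> P)" by (rule connected_Int_nodal) (use T TZ P in auto)
        moreover have "continuous_on (T \<inter> P) (\<lambda>z. Re (\<psi> z / e))"
        proof -
          have "continuous_on T (\<lambda>z. Re (\<psi> z / e))"
          proof -
            have inv: "(\<lambda>z. Re (\<psi> z / e)) (h (of_real s * e)) = s" if "s \<in> {0..\<delta>}" for s
              using c(12)[OF inb[OF that]] e0 by simp
            show ?thesis unfolding T_def by (rule continuous_on_inv[OF ch]) (use inv in auto)
          qed
          then show ?thesis by (rule continuous_on_subset) auto
        qed
        ultimately have con: "connected ((\<lambda>z. Re (\<psi> z / e)) ` (T \<inter> P))" by (intro connected_continuous_image)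
        have pP: "p \<in> P" "q \<in> P" unfolding P_def using tp(2) g(6) by (auto intro: image_eqI[of _ _ tp] image_eqI[of _ _ tq])
        have "0 \<in> (\<lambda>z. Re (\<psi> z / e)) ` (T \<inter> P)" by (rule image_eqI[of _ _ p]) (use c(6) pT pP in auto)
        moreover have "\<delta> \<in> (\<lambda>z. Re (\<psi> z / e)) ` (T \<inter> P)" by (rule image_eqI[of _ _ q]) (use psiq e0 qT pP in auto)
        ultimately have sub: "{0..\<delta>} \<subseteq> (\<lambda>z. Re (\<psi> z / e)) ` (T \<inter> P)" using con connected_contains_Icc by blast
        show "T \<subseteq> P"
        proof
          fix z assume "z \<in> T"
          then obtain s where s: "s \<in> {0..\<delta>}" "z = h (of_real s * e)" using TE by blast
          then obtain z' where z': "z' \<in> T" "z' \<in> P" "s = Re (\<psi> z' / e)" using sub by blast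
          obtain s' where s': "z' = h (of_real s' * e)" "\<psi> z' = of_real s' * e" using TE[OF z'(1)] by blast
          have "s = s'" using z'(3) s'(2) e0 by simp
          then show "z \<in> P" using s s' z' by simp
        qed
      qed
      have "p islimpt T" using T(2) pT qT qp by (intro connected_imp_perfect) auto
      then have nb: "at p within T \<noteq> bot" by (simp add: trivial_limit_within)
      have "((\<lambda>z. sgn (\<psi> z)) \<longlongrightarrow> of_real (sgn (tq - tp)) * sgn w) (at p within T)"
        using limP TP by (rule tendsto_within_subset)
      moreover have "((\<lambda>z. sgn (\<psi> z)) \<longlongrightarrow> e) (at p within T)"
        by (rule tendsto_eventually) (use sgnT in \<open>auto simp: eventually_at_filter\<close>)
      ultimately have ee: "of_real (sgn (tq - tp)) * sgn w = e" using tendsto_unique[OF nb] by blast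
      \<comment> \<open>The parameters of 0 and q lie on opposite sides of that of p, so the arc
        from 0 arrives along the opposite ray.\<close>
      have "sgn (t0 - tp) = - sgn (tq - tp)"
        using tp(1) ne by (auto simp: closed_segment_eq_real_ivl sgn_if split: if_splits)
      then have "of_real (sgn (t0 - tp)) * sgn w = - e" using ee by simp
      then have "((\<lambda>z. sgn (\<psi> z)) \<longlongrightarrow> - e) (at p within Q)" using limQ by simp
      moreover have "0 \<in> Q" "p \<in> Q" unfolding Q_def using tp(2) g(5) by (auto intro: image_eqI[of _ _ t0] image_eqI[of _ _ tp])
      ultimately show ?thesis using Q by (intro exI[of _ Q] exI[of _ "- e"]) auto
    qed
  qed
  have dir: "cmod (nodal_dir k i) = 1" "Re (nodal_dir k i ^ k) = 0" for i
    using Re_nodal_dir_power[of k 1 i] c(1) by auto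
  obtain A d where A: "compact A" "connected A" "A \<subseteq> Z" "0 \<in> A" "p \<in> A" "d = nodal_dir k 0 \<or> d = - nodal_dir k 0"
    "((\<lambda>z. sgn (\<psi> z)) \<longlongrightarrow> d) (at p within A)" using main[OF dir, of 0] by blast
  obtain A' d' where A': "compact A'" "connected A'" "A' \<subseteq> Z" "0 \<in> A'" "p \<in> A'" "d' = nodal_dir k 1 \<or> d' = - nodal_dir k 1"
    "((\<lambda>z. sgn (\<psi> z)) \<longlongrightarrow> d') (at p within A')" using main[OF dir, of 1] by blast
  \<comment> \<open>The intersection is connected and contains the distinct points 0 and p, so p is
    a limit point of it and the two directions have to agree. They lie on different lines because k
    \<ge> 2.\<close>
  have con: "connected (A \<inter> A')" by (rule connected_Int_nodal) (use A A' in auto)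
  have in0: "0 \<in> A \<inter> A'" and inp: "p \<in> A \<inter> A'" using A A' by auto
  have "A \<inter> A' \<noteq> {x}" for x
  proof
    assume eq: "A \<inter> A' = {x}"
    show False using in0 inp p(2) unfolding eq by simp
  qed
  then have "p islimpt (A \<inter> A')" by (rule connected_imp_perfect[OF con inp])
  then have "at p within (A \<inter> A') \<noteq> bot" by (simp add: trivial_limit_within)
  moreover have "((\<lambda>z. sgn (\<psi> z)) \<longlongrightarrow> d) (at p within (A \<inter> A'))" using A(7) by (rule tendsto_within_subset) auto
  moreover have "((\<lambda>z. sgn (\<psi> z)) \<longlongrightarrow> d') (at p within (A \<inter> A'))" using A'(7) by (rule tendsto_within_subset) auto
  ultimately have dd: "d = d'" by (rule tendsto_unique)
  obtain x where x: "d = of_real x * nodal_dir k 0" "x \<noteq> 0" using A(6) by (auto intro: that[of 1] that[of "-1"])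
  obtain y where y: "d' = of_real y * nodal_dir k 1" using A'(6) by (auto intro: that[of 1] that[of "-1"])
  show False using nodal_line_unique[of 0 k 1 x y] x y dd k2 by simp
qed

end

text \<open>The m-th root of z^m h z requires that h has no zero. A zero p \<noteq> 0 of f would be
  joined to 0 by a nodal curve, and Rolle's theorem for Im f along it would give a critical point of
  f on the nodal set away from 0.\<close>

theorem nodal_root_exists:
  assumes R: "R > 0" and h: "h holomorphic_on ball 0 R" "h 0 \<noteq> 0" and m: "m \<ge> 1"
    and f: "\<And>z. z \<in> ball 0 R \<Longrightarrow> f z = z ^ m * h z" and u: "\<And>z. z \<in> ball 0 R \<Longrightarrow> u z = Re (f z)"
    and on: "only_nodal_curves_through_0 u (ball 0 R) n"
  obtains \<phi> where "nodal_root \<phi> R m u"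
proof -
  have hf: "f holomorphic_on ball 0 R"
    using f by (subst holomorphic_cong[OF refl, of _ _ "\<lambda>z. z ^ m * h z"]) (auto intro!: holomorphic_intros h)
  have nc: "\<not> f constant_on ball 0 R"
  proof
    assume "f constant_on ball 0 R"
    then obtain c where c: "\<And>z. z \<in> ball 0 R \<Longrightarrow> f z = c" unfolding constant_on_def by blast
    have "c = 0" using c[of 0] f[of 0] R m by (cases m) auto
    then have hz: "h z = 0" if "z \<in> ball 0 R - {0}" for z using c[of z] f[of z] that by simp
    have "(h \<longlongrightarrow> h 0) (at 0)"
      using holomorphic_on_imp_continuous_on[OF h(1)] R by (simp add: continuous_on_eq_continuous_at isCont_def)
    moreover have "eventually (\<lambda>z. h z = 0) (at 0)"
      using hz R unfolding eventually_at by (intro exI[of _ R]) auto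
    then have "(h \<longlongrightarrow> 0) (at 0)" by (rule tendsto_eventually)
    ultimately have "h 0 = 0" using tendsto_unique[OF at_neq_bot] by blast
    then show False using h(2) by simp
  qed
  interpret harmonic_disc f R by unfold_locales (fact hf nc)+
  have ZN: "Z = nodal_set u (ball 0 R)" using u by (auto simp: Z_def nodal_set_def)
  have H: "\<exists>I \<gamma> t0 tq. regular_analytic_curve I \<gamma> \<and> \<gamma> ` I \<subseteq> Z \<and> t0 \<in> I \<and> tq \<in> I \<and> \<gamma> t0 = 0 \<and> \<gamma> tq = q"
    if q: "q \<in> Z" for q
  proof -
    have "q \<in> \<Union> {C. nodal_curve u (ball 0 R) C}" using q on unfolding ZN only_nodal_curves_through_0_def by simp
    then obtain C where C: "nodal_curve u (ball 0 R) C" "q \<in> C" by blast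
    have "0 \<in> C" using C(1) on unfolding only_nodal_curves_through_0_def by simp
    moreover obtain I \<gamma> where "regular_analytic_curve I \<gamma>" "\<gamma> ` I = C"
      using nodal_curveD(2)[OF C(1)] by (elim exE conjE) (rule that)
    moreover have "C \<subseteq> Z" using nodal_curveD(1)[OF C(1)] ZN by simp
    ultimately show ?thesis using C(2) by (metis imageE)
  qed
  have fd: "(f has_field_derivative deriv f z) (at z)" if "z \<in> ball 0 R" for z
    using holomorphic_derivI[OF hf open_ball that] .
  have f0: "f 0 = 0" using f[of 0] R m by simp
  have fnz: "f p \<noteq> 0" if p: "p \<in> ball 0 R" "p \<noteq> 0" for p
  proof
    assume fp: "f p = 0"
    then have "p \<in> Z" using p by (simp add: Z_def)
    then obtain I \<gamma> t0 tp where g: "regular_analytic_curve I \<gamma>" "\<gamma> ` I \<subseteq> Z" "t0 \<in> I" "tp \<in> I" "\<gamma> t0 = 0" "\<gamma> tp = p"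
      using H by blast
    note gd = regular_analytic_curveD[OF g(1)]
    have inj: "inj_on \<gamma> I" by (rule nodal_curve_injective[OF g(1,2)])
    have vd: "((\<lambda>t. f (\<gamma> t)) has_vector_derivative velocity \<gamma> t * deriv f (\<gamma> t)) (at t)" if "t \<in> I" for t
    proof -
      have "\<gamma> t \<in> ball 0 R" using g(2) that by (auto simp: Z_def)
      from field_vector_diff_chain_at[OF gd(6)[OF that] fd[OF this]] show ?thesis by (simp add: o_def)
    qed
    have Re0: "Re (velocity \<gamma> t * deriv f (\<gamma> t)) = 0" if t: "t \<in> I" for t
    proof -
      have "((\<lambda>t. Re (f (\<gamma> t))) has_vector_derivative Re (velocity \<gamma> t * deriv f (\<gamma> t))) (at t)"
        by (rule bounded_linear.has_vector_derivative[OF bounded_linear_Re vd[OF t]])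
      then have "((\<lambda>t. 0) has_vector_derivative Re (velocity \<gamma> t * deriv f (\<gamma> t))) (at t)"
        by (rule has_vector_derivative_transform_within_open[OF _ gd(2) t]) (use g(2) in \<open>auto simp: Z_def\<close>)
      then show ?thesis using vector_derivative_unique_at[of "\<lambda>_. 0" _ t 0] by fastforce
    qed
    have Vd: "((\<lambda>t. Im (f (\<gamma> t))) has_real_derivative Im (velocity \<gamma> t * deriv f (\<gamma> t))) (at t)" if "t \<in> I" for t
      using bounded_linear.has_vector_derivative[OF bounded_linear_Im vd[OF that]]
      by (simp add: has_real_derivative_iff_has_vector_derivative)
    define a where "a = min t0 tp"
    define b where "b = max t0 tp"
    have "t0 \<noteq> tp" using g(5,6) p(2) by auto
    then have ab: "a < b" "a \<in> I" "b \<in> I" using g(3,4) by (auto simp: a_def b_def min_def max_def)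
    have sub: "{a..b} \<subseteq> I" using gd(3) ab by (meson connected_contains_Icc)
    \<comment> \<open>Along the curve Re f is constant, so at a critical point of Im f the whole
      derivative vanishes. Since z is strictly between a and b, injectivity keeps this point
      different from 0.\<close>
    have "\<exists>z. a < z \<and> z < b \<and> ((\<lambda>t. Im (f (\<gamma> t))) has_real_derivative 0) (at z)"
    proof (rule Rolle[OF ab(1)])
      show "Im (f (\<gamma> a)) = Im (f (\<gamma> b))" using g(5,6) fp f0 by (auto simp: a_def b_def min_def max_def)
      show "continuous_on {a..b} (\<lambda>t. Im (f (\<gamma> t)))"
        using Vd sub by (intro continuous_at_imp_continuous_on ballI) (blast intro: DERIV_isCont)
      show "(\<lambda>t. Im (f (\<gamma> t))) differentiable (at x)" if "a < x" "x < b" for x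
      proof -
        have "x \<in> I" using sub that by auto
        then show ?thesis using Vd real_differentiable_def by blast
      qed
    qed
    then obtain z where z: "a < z" "z < b" "((\<lambda>t. Im (f (\<gamma> t))) has_real_derivative 0) (at z)" by blast
    have zI: "z \<in> I" using sub z by auto
    have "Im (velocity \<gamma> z * deriv f (\<gamma> z)) = 0" using DERIV_unique[OF Vd[OF zI] z(3)] .
    then have "velocity \<gamma> z * deriv f (\<gamma> z) = 0" using Re0[OF zI] by (simp add: complex_eq_iff)
    then have dz: "deriv f (\<gamma> z) = 0" using gd(5)[OF zI] by simp
    moreover have "\<gamma> z \<in> Z" using g(2) zI by blast
    ultimately have "\<gamma> z = 0" using nodal_regular_away_from_0[OF H] by blast
    then have "z = t0" using inj_onD[OF inj, of z t0] zI g(3,5) by simp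
    then show False using z by (auto simp: a_def b_def min_def max_def split: if_splits)
  qed
  have hnz: "h z \<noteq> 0" if "z \<in> ball 0 R" for z
    using fnz[OF that] f[OF that] h(2) m by (cases "z = 0") auto
  obtain l where l: "l holomorphic_on ball 0 R" "\<And>z. z \<in> ball 0 R \<Longrightarrow> h z = exp (l z)"
    using contractible_imp_holomorphic_log[OF h(1) convex_imp_contractible[OF convex_ball] hnz] by blast
  define \<phi> where "\<phi> = (\<lambda>z. z * exp (l z / of_nat m))"
  have phim: "\<phi> z ^ m = f z" if "z \<in> ball 0 R" for z
  proof -
    have "exp (l z / of_nat m) ^ m = exp (of_nat m * (l z / of_nat m))" by (rule exp_of_nat_mult[symmetric])
    also have "\<dots> = h z" using m l(2)[OF that] by simp
    finally show ?thesis using f[OF that] by (simp add: \<phi>_def power_mult_distrib)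
  qed
  have hphi: "\<phi> holomorphic_on ball 0 R" unfolding \<phi>_def by (intro holomorphic_intros l) (use m in auto)
  have "nodal_root \<phi> R m u"
  proof
    show "deriv \<phi> z \<noteq> 0" if z: "z \<in> ball 0 R" "Re (\<phi> z ^ m) = 0" for z
    proof (cases "z = 0")
      case True
      have ld: "(l has_field_derivative deriv l 0) (at 0)" using holomorphic_derivI[OF l(1)] R by simp
      have "(\<phi> has_field_derivative exp (l 0 / of_nat m)) (at 0)"
        unfolding \<phi>_def using m by (auto intro!: derivative_eq_intros ld)
      then show ?thesis using True m by (simp add: DERIV_imp_deriv)
    next
      case False
      have "z \<in> Z" using z phim by (simp add: Z_def)
      then have "deriv f z \<noteq> 0" using nodal_regular_away_from_0[OF H] False by blast
      moreover have "(f has_field_derivative of_nat m * (deriv \<phi> z * \<phi> z ^ (m - 1))) (at z)"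
      proof (rule has_field_derivative_transform_within_open[OF _ open_ball z(1)])
        have "(\<phi> has_field_derivative deriv \<phi> z) (at z)" using holomorphic_derivI[OF hphi open_ball z(1)] .
        then show "((\<lambda>z. \<phi> z ^ m) has_field_derivative of_nat m * (deriv \<phi> z * \<phi> z ^ (m - 1))) (at z)"
          by (auto intro!: derivative_eq_intros)
      qed (rule phim)
      then have "deriv f z = of_nat m * (deriv \<phi> z * \<phi> z ^ (m - 1))" by (rule DERIV_imp_deriv)
      ultimately show ?thesis by auto
    qed
  qed (use R m hphi u phim in \<open>auto simp: \<phi>_def\<close>)
  then show ?thesis using that by blast
qed

subsection \<open>Boundary sign changes\<close>

text \<open>The two rays cut the punctured plane into two sectors. After rotation by - a the
  argument is continuous off the first ray; on a connected set with points in both sectors it takes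
  the value b - a, that is, the set meets the second ray.\<close>

lemma connected_avoiding_two_rays:
  fixes T :: "complex set"
  assumes T: "connected T" "0 \<notin> T" and ab: "a < b" "b < a + 2 * pi"
    and a: "\<And>r. r > 0 \<Longrightarrow> of_real r * cis a \<notin> T" and b: "\<And>r. r > 0 \<Longrightarrow> of_real r * cis b \<notin> T"
    and x: "r1 > 0" "a < x" "x < b" "of_real r1 * cis x \<in> T"
    and y: "r2 > 0" "b < y" "y < a + 2 * pi" "of_real r2 * cis y \<in> T"
  shows False
proof -
  define rot where "rot = (\<lambda>z. z * cis (- a))"
  have rot: "rot (of_real r * cis t) = of_real r * exp (\<i> * of_real (t - a))" for r t
  proof -
    have "rot (of_real r * cis t) = of_real r * cis (t - a)" by (simp add: rot_def mult.assoc cis_mult)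
    then show ?thesis by (simp only: cis_conv_exp)
  qed
  define F where "F = (\<lambda>z. Arg2pi (rot z))"
  have "continuous_on T F"
    unfolding continuous_on_eq_continuous_within
  proof
    fix z assume z: "z \<in> T"
    have "rot z \<notin> \<real>\<^sub>\<ge>\<^sub>0"
    proof
      assume "rot z \<in> \<real>\<^sub>\<ge>\<^sub>0"
      then obtain r where r: "rot z = of_real r" "0 \<le> r" by (auto simp: nonneg_Reals_def)
      have "z = rot z * cis a" by (simp add: rot_def mult.assoc cis_mult)
      then have "z = of_real r * cis a" using r(1) by simp
      moreover have "r \<noteq> 0" using \<open>z = of_real r * cis a\<close> z T(2) by auto
      ultimately show False using a[of r] r(2) z by simp
    qed
    then have "continuous (at (rot z)) Arg2pi" by (rule continuous_at_Arg2pi)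
    moreover have "continuous (at z) rot" unfolding rot_def by (intro continuous_intros)
    ultimately have "continuous (at z) (Arg2pi \<circ> rot)" by (intro continuous_at_compose)
    then show "continuous (at z within T) F"
      unfolding F_def o_def by (rule continuous_at_imp_continuous_at_within)
  qed
  then have con: "connected (F ` T)" using T(1) by (rule connected_continuous_image)
  have "F (of_real r1 * cis x) = x - a" unfolding F_def rot
    by (rule Arg2pi_unique[of r1]) (use x ab in auto)
  moreover have "F (of_real r2 * cis y) = y - a" unfolding F_def rot
    by (rule Arg2pi_unique[of r2]) (use y ab in auto)
  ultimately have "x - a \<in> F ` T" "y - a \<in> F ` T" using x(4) y(4) by (metis imageI)+
  then have "{x - a..y - a} \<subseteq> F ` T" by (rule connected_contains_Icc[OF con])
  then have "b - a \<in> F ` T" using x y by (auto simp: subset_iff)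
  then obtain z where z: "z \<in> T" "F z = b - a" by force
  have "rot z = of_real (cmod (rot z)) * exp (\<i> * of_real (b - a))"
    using Arg2pi_eq[of "rot z"] z(2) by (simp add: F_def)
  then have "rot z = rot (of_real (cmod (rot z)) * cis b)" unfolding rot .
  then have "z = of_real (cmod (rot z)) * cis b" by (simp add: rot_def)
  moreover have "cmod (rot z) > 0" using z(1) T(2) by (auto simp: rot_def)
  ultimately show False using b z(1) by metis
qed

context nodal_root
begin

text \<open>On a circle close to the boundary, u has a zero in each of the 2 n + 2 sectors between
  the given radii. All these zeros lie on the 2 n ends of the nodal curves, so two of them share an
  end; it is connected, yet it avoids the radii that separate them.\<close>

lemma no_alternating_radii:
  assumes nodal: "\<And>k. k < n \<Longrightarrow> nodal_curve u (ball 0 R) (L k)"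
    and th: "\<And>i. i < 2 * n + 1 \<Longrightarrow> \<theta> i < \<theta> (Suc i)" "\<And>i. i \<le> 2 * n + 1 \<Longrightarrow> \<theta> i \<in> {0<..<2*pi}"
    and \<rho>: "\<rho> < R" and sgn: "\<And>i r. i \<le> 2 * n + 1 \<Longrightarrow> \<rho> < r \<Longrightarrow> r < R \<Longrightarrow> 0 < s * (-1) ^ i * u (of_real r * cis (\<theta> i))"
  shows False
proof -
  define \<rho>0 where "\<rho>0 = max \<rho> (R / 2)"
  have r0: "0 < \<rho>0" "\<rho>0 < R" "\<rho> \<le> \<rho>0" using \<rho> R by (auto simp: \<rho>0_def)
  define P where "P = (\<lambda>k A B \<rho>'. connected A \<and> connected B \<and> \<rho>' < R \<and> A \<union> B \<subseteq> {z\<in>L k. \<rho>0 < cmod z} \<and>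
      {z\<in>L k. \<rho>' < cmod z} \<subseteq> A \<union> B)"
  have "\<exists>A B \<rho>'. P k A B \<rho>'" if k: "k < n" for k
  proof -
    obtain A B \<rho>' where "connected A" "connected B" "\<rho>' < R" "A \<union> B \<subseteq> {z\<in>L k. \<rho>0 < cmod z}"
      "{z\<in>L k. \<rho>' < cmod z} \<subseteq> A \<union> B"
      by (rule nodal_curve_tails[OF nodal[OF k] r0(1,2)])
    then show ?thesis unfolding P_def by (intro exI conjI)
  qed
  then obtain A B \<rho>' where P: "\<And>k. k < n \<Longrightarrow> P k (A k) (B k) (\<rho>' k)" by metis
  then have AB: "\<forall>k\<in>{..<n}. connected (A k) \<and> connected (B k) \<and> \<rho>' k < R \<and> A k \<union> B k \<subseteq> {z\<in>L k. \<rho>0 < cmod z} \<and>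
      {z\<in>L k. \<rho>' k < cmod z} \<subseteq> A k \<union> B k" unfolding P_def by simp
  \<comment> \<open>The two ends of \<open>L k\<close> carry the indices 2 k and 2 k + 1.\<close>
  define Tl where "Tl = (\<lambda>j. if even j then A (j div 2) else B (j div 2))"
  have Tl: "connected (Tl j)" "Tl j \<subseteq> {z\<in>N. \<rho>0 < cmod z}" if "j < 2 * n" for j
  proof -
    have "j div 2 < n" using that by simp
    then have k: "connected (A (j div 2))" "connected (B (j div 2))"
      "A (j div 2) \<union> B (j div 2) \<subseteq> {z\<in>L (j div 2). \<rho>0 < cmod z}" using AB by simp_all
    then show "connected (Tl j)" by (simp add: Tl_def)
    have "Tl j \<subseteq> {z\<in>L (j div 2). \<rho>0 < cmod z}" using k(3) by (simp add: Tl_def)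
    then show "Tl j \<subseteq> {z\<in>N. \<rho>0 < cmod z}" using L_subset_N[of "j div 2"] by blast
  qed
  define \<rho>m where "\<rho>m = Max (insert \<rho>0 (\<rho>' ` {..<n}))"
  have "\<rho>m < R" unfolding \<rho>m_def using AB r0 by (subst Max_less_iff) auto
  then obtain r where r: "\<rho>m < r" "r < R" using dense by blast
  have rr: "\<rho>0 < r" "\<And>k. k < n \<Longrightarrow> \<rho>' k < r" using r(1) unfolding \<rho>m_def by (auto simp: Max_less_iff)
  \<comment> \<open>The index 2 n + 2 closes the circle; as it is even, the sign at \<theta> 0 + 2
    pi continues the alternation.\<close>
  define \<theta>' where "\<theta>' = (\<lambda>i. if i = 2 * n + 2 then \<theta> 0 + 2 * pi else \<theta> i)"
  have mono: "\<theta>' i < \<theta>' (Suc i)" if "i < 2 * n + 2" for i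
  proof (cases "i = 2 * n + 1")
    case True
    then show ?thesis using th(2)[of 0] th(2)[of "2 * n + 1"] by (simp add: \<theta>'_def)
  qed (use that th(1) in \<open>auto simp: \<theta>'_def\<close>)
  have monole: "\<theta>' i \<le> \<theta>' j" if "i \<le> j" "j \<le> 2 * n + 2" for i j
    using that
  proof (induction j rule: dec_induct)
    case (step j) then show ?case using mono[of j] by simp
  qed simp
  define U where "U = (\<lambda>t. u (of_real r * cis t))"
  have rb: "of_real r * cis t \<in> ball 0 R" for t using r(2) rr(1) r0(1) by (simp add: norm_mult)
  have Uc: "continuous_on UNIV U"
  proof -
    have "continuous_on UNIV (\<lambda>t. Re (\<phi> (of_real r * cis t) ^ n))"
      by (intro continuous_intros continuous_on_compose2[OF holomorphic_on_imp_continuous_on[OF hol]]) (use rb in auto)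
    moreover have "U = (\<lambda>t. Re (\<phi> (of_real r * cis t) ^ n))" unfolding U_def using u[OF rb] by (rule ext)
    ultimately show ?thesis by simp
  qed
  have Us: "0 < s * (-1) ^ i * U (\<theta>' i)" if "i \<le> 2 * n + 2" for i
  proof (cases "i = 2 * n + 2")
    case True
    have "cis (\<theta> 0 + 2 * pi) = cis (\<theta> 0)" by (simp add: complex_eq_iff)
    then show ?thesis using sgn[of 0 r] rr r0 r True by (simp add: U_def \<theta>'_def)
  next
    case False
    then show ?thesis using sgn[of i r] rr r0 r that by (simp add: U_def \<theta>'_def)
  qed
  have "\<exists>\<eta>. \<theta>' i < \<eta> \<and> \<eta> < \<theta>' (Suc i) \<and> U \<eta> = 0" if i: "i < 2 * n + 2" for i
  proof -
    define c where "c = s * (-1) ^ i"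
    have p: "0 < c * U (\<theta>' i)" "c * U (\<theta>' (Suc i)) < 0" using Us[of i] Us[of "Suc i"] i by (auto simp: c_def)
    have "\<exists>x\<ge>\<theta>' i. x \<le> \<theta>' (Suc i) \<and> c * U x = 0"
      by (rule IVT2') (use p mono[OF i] in \<open>auto intro!: continuous_intros continuous_on_subset[OF Uc]\<close>)
    then obtain x where x: "\<theta>' i \<le> x" "x \<le> \<theta>' (Suc i)" "c * U x = 0" by blast
    have "x \<noteq> \<theta>' i" "x \<noteq> \<theta>' (Suc i)" "c \<noteq> 0" using p x by auto
    then show ?thesis using x by (intro exI[of _ x]) auto
  qed
  then obtain \<eta> where \<eta>: "\<And>i. i < 2 * n + 2 \<Longrightarrow> \<theta>' i < \<eta> i \<and> \<eta> i < \<theta>' (Suc i) \<and> U (\<eta> i) = 0" by metis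
  have "\<exists>j<2 * n. of_real r * cis (\<eta> i) \<in> Tl j" if i: "i < 2 * n + 2" for i
  proof -
    define z where "z = of_real r * cis (\<eta> i)"
    have zr: "cmod z = r" using rr(1) r0(1) by (simp add: z_def norm_mult)
    have "z \<in> N" using \<eta>[OF i] rb by (simp add: z_def U_def nodal_set_def)
    then obtain k where k: "k < n" "z \<in> L k" using N_eq by blast
    then have "z \<in> A k \<union> B k" using AB rr(2)[OF k(1)] zr by auto
    then have "z \<in> Tl (2 * k) \<or> z \<in> Tl (2 * k + 1)" by (auto simp: Tl_def)
    moreover have "2 * k < 2 * n" "2 * k + 1 < 2 * n" using k by auto
    ultimately show ?thesis unfolding z_def by blast
  qed
  then obtain j where j: "\<And>i. i < 2 * n + 2 \<Longrightarrow> j i < 2 * n \<and> of_real r * cis (\<eta> i) \<in> Tl (j i)" by metis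
  have "\<not> inj_on j {..<2 * n + 2}"
    by (rule pigeonhole) (use j card_mono[of "{..<2*n}" "j ` {..<2*n+2}"] in fastforce)
  then obtain i1 i2 where i12: "i1 < 2 * n + 2" "i2 < 2 * n + 2" "i1 < i2" "j i1 = j i2"
    unfolding inj_on_def by (metis lessThan_iff nat_neq_iff)
  define T where "T = Tl (j i1)"
  have T: "connected T" "T \<subseteq> {z\<in>N. \<rho>0 < cmod z}" using Tl j i12 by (auto simp: T_def)
  have th_eq: "\<theta>' i = \<theta> i" if "i < 2 * n + 2" for i using that by (simp add: \<theta>'_def)
  \<comment> \<open>The ends lie beyond the radius \<rho>0, where u has a strict sign on each of the
    given radii.\<close>
  have avoid: "of_real x * cis (\<theta>' i) \<notin> T" if i: "i < 2 * n + 2" and x: "x > 0" for i x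
  proof
    assume "of_real x * cis (\<theta>' i) \<in> T"
    then have m: "of_real x * cis (\<theta> i) \<in> N" "\<rho>0 < x" using T(2) x i by (auto simp: norm_mult th_eq)
    then have "x < R" "u (of_real x * cis (\<theta> i)) = 0" using x by (auto simp: nodal_set_def norm_mult)
    then show False using sgn[of i x] m r0 i by simp
  qed
  show False
  proof (rule connected_avoiding_two_rays[of T "\<theta>' i1" "\<theta>' i2" r "\<eta> i1" r "\<eta> i2"])
    show "\<theta>' i1 < \<theta>' i2" using mono[OF i12(1)] monole[of "Suc i1" i2] i12 by simp
    show "\<theta>' i2 < \<theta>' i1 + 2 * pi" using th(2)[of i1] th(2)[of i2] i12 by (simp add: th_eq)
    show "\<eta> i1 < \<theta>' i2" using \<eta>[OF i12(1)] monole[of "Suc i1" i2] i12 by simp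
    show "\<eta> i2 < \<theta>' i1 + 2 * pi"
    proof -
      have "\<theta>' (Suc i2) \<le> \<theta>' (2 * n + 2)" using i12 by (intro monole) auto
      also have "\<dots> = \<theta>' 0 + 2 * pi" by (simp add: \<theta>'_def)
      also have "\<dots> \<le> \<theta>' i1 + 2 * pi" using monole[of 0 i1] i12 by simp
      finally show ?thesis using \<eta>[OF i12(2)] by simp
    qed
    show "of_real r * cis (\<eta> i1) \<in> T" "of_real r * cis (\<eta> i2) \<in> T"
      using j[OF i12(1)] j[OF i12(2)] i12(4) unfolding T_def by simp_all
  qed (use T r0 rr \<eta> i12 avoid in auto)
qed

end

subsection \<open>The upper bound\<close>

text \<open>\<open>F m\<close> is the series without its first m terms, divided by z^m. By the
  recursion its value and derivative at 0 are the coefficients m and m + 1, the two that enter the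
  curvature.\<close>

lemma shifted_power_series:
  fixes c :: "nat \<Rightarrow> complex"
  assumes "\<And>z. z \<in> ball 0 R \<Longrightarrow> (\<lambda>k. c k * z ^ k) sums f z"
  obtains F where "\<And>m. F m holomorphic_on ball 0 R" "\<And>m. F m 0 = c m"
    "\<And>m z. z \<in> ball 0 R \<Longrightarrow> F m z = c m + z * F (Suc m) z" "\<And>z. z \<in> ball 0 R \<Longrightarrow> F 0 z = f z"
proof -
  have sm: "summable (\<lambda>k. c (k + m) * z ^ k)" if z: "z \<in> ball 0 R" for m z
  proof (induction m)
    case 0 then show ?case using assms[OF z] by (simp add: sums_iff)
  next
    case (Suc m) then show ?case using powser_split_head(3)[of "\<lambda>k. c (k + m)" z] by simp
  qed
  define F where "F = (\<lambda>m z. \<Sum>k. c (k + m) * z ^ k)"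
  show ?thesis
  proof (rule that[of F])
    show "F m holomorphic_on ball 0 R" for m
      by (rule power_series_holomorphic[where a="\<lambda>k. c (k + m)"]) (use sm in \<open>auto simp: F_def summable_sums\<close>)
    show "F m 0 = c m" for m by (simp add: F_def powser_zero)
    show "F m z = c m + z * F (Suc m) z" if "z \<in> ball 0 R" for m z
      using powser_split_head(1)[OF sm[OF that, of m]] by (simp add: F_def mult.commute)
    show "F 0 z = f z" if "z \<in> ball 0 R" for z using assms[OF that] by (simp add: F_def sums_iff)
  qed
qed

lemma Poisson_integral_kernel:
  assumes "r > 0"
  shows "(LINT t:{0..2*pi}|lebesgue. poisson_kernel \<rho> \<theta> t * g (complex_of_real r * cis t)) =
    2 * pi * Poisson_integral r g (of_real (r * \<rho>) * cis \<theta>)"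
proof -
  have "poisson_kernel \<rho> \<theta> t = (r\<^sup>2 - (cmod (of_real (r * \<rho>) * cis \<theta>))\<^sup>2) / (cmod (complex_of_real r * cis t - of_real (r * \<rho>) * cis \<theta>))\<^sup>2" for t
  proof -
    have "complex_of_real r * cis t - of_real (r * \<rho>) * cis \<theta> = of_real r * (cis t - of_real \<rho> * cis \<theta>)"
      by (simp add: algebra_simps)
    then have "(cmod (complex_of_real r * cis t - of_real (r * \<rho>) * cis \<theta>))\<^sup>2 = r\<^sup>2 * (cmod (cis t - of_real \<rho> * cis \<theta>))\<^sup>2"
      by (simp add: norm_mult power_mult_distrib)
    moreover have "r\<^sup>2 - (cmod (of_real (r * \<rho>) * cis \<theta>))\<^sup>2 = r\<^sup>2 * (1 - \<rho>\<^sup>2)"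
      by (simp add: norm_mult power_mult_distrib abs_mult right_diff_distrib)
    ultimately show ?thesis using assms by (simp add: poisson_kernel_def)
  qed
  then show ?thesis unfolding Poisson_integral_def by simp
qed

lemma AE_radial_sign:
  assumes g: "L1_circle r g" and r: "r > 0"
  shows "AE \<theta> in lebesgue. \<theta> \<in> {0<..<2*pi} \<and> 0 < \<sigma> * g (complex_of_real r * cis \<theta>) \<longrightarrow>
    (\<exists>\<rho><1. \<forall>x. \<rho> < x \<and> x < 1 \<longrightarrow> 0 < \<sigma> * Poisson_integral r g (of_real (r * x) * cis \<theta>))"
proof -
  have "set_integrable lebesgue {0..2*pi} (\<lambda>\<theta>. \<sigma> * g (complex_of_real r * cis \<theta>))"
    using g unfolding L1_circle_def by (rule set_integrable_mult_right)
  from AE_poisson_integral_pos[OF this] show ?thesis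
  proof eventually_elim
    case (elim \<theta>)
    have "(LINT t:{0..2*pi}|lebesgue. poisson_kernel x \<theta> t * (\<sigma> * g (complex_of_real r * cis t))) =
      2 * pi * (\<sigma> * Poisson_integral r g (of_real (r * x) * cis \<theta>))" for x
      using Poisson_integral_kernel[OF r, of x \<theta> g] by (simp add: mult.left_commute)
    then show ?case using elim by (simp add: zero_less_mult_iff)
  qed
qed

text \<open>Up to the factor 2 / (n r), the curvature is a quotient of the Fourier moments of order
  n + 1 and n after rotation by the tangent direction. \<open>moment_inequality\<close> bounds the
  quotient in terms of the angles t j of the sign changes, and \<tau> j = t j - \<alpha> measures
  them from the tangent.\<close>

lemma curvature_bound_by_angles:
  assumes adm: "admissible n r u" and n: "n \<ge> 1" and r: "r > 0"
    and C: "nodal_curve u (ball 0 r) C" and \<gamma>: "parametrizes I \<gamma> C" "t0 \<in> I" "\<gamma> t0 = 0"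
  obtains \<tau> where "\<bar>curvature \<gamma> t0\<bar> \<le> 2 / (n * r) * (\<bar>\<Sum>j<2*n. sin (\<tau> j)\<bar> + 2 * \<bar>sin ((\<Sum>j<2*n. \<tau> j) / 2)\<bar>)"
proof -
  obtain g where g: "L1_circle r g" "\<And>z. z \<in> ball 0 r \<Longrightarrow> u z = Poisson_integral r g z"
    using adm unfolding admissible_def has_L1_boundary_value_def by blast
  have u0: "u 0 = 0" and unc: "\<not> u constant_on ball 0 r" and on: "only_nodal_curves_through_0 u (ball 0 r) n"
    using adm unfolding admissible_def by simp_all
  define G where "G = (\<lambda>\<theta>. g (complex_of_real r * cis \<theta>))"
  define M where "M = (\<lambda>k::int. LINT \<theta>:{0..2*pi}|lebesgue. complex_of_real (G \<theta>) * cis (- of_int k * \<theta>))"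
  define c where "c = (\<lambda>k. if k = 0 then M 0 / complex_of_real (2 * pi) else M (int k) / complex_of_real (pi * r ^ k))"
  have Meq: "M k = (LINT \<theta>:{0..2*pi}|lebesgue. complex_of_real (g (complex_of_real r * cis \<theta>)) * cis (- of_int k * \<theta>))" for k
    by (simp only: M_def G_def)
  obtain f where f: "\<And>z. z \<in> ball 0 r \<Longrightarrow> (\<lambda>k. c k * z ^ k) sums f z"
    "\<And>z. z \<in> ball 0 r \<Longrightarrow> Poisson_integral r g z = Re (f z)"
    by (rule Poisson_integral_series[OF g(1) r Meq]) (rule that, simp only: c_def)
  have uf: "u z = Re (f z)" if "z \<in> ball 0 r" for z using g(2) f(2) that by simp
  have cnjM: "M (- k) = cnj (M k)" for k
  proof -
    have "cnj (M k) = (LINT \<theta>:{0..2*pi}|lebesgue. cnj (complex_of_real (G \<theta>) * cis (- of_int k * \<theta>)))"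
      unfolding M_def set_lebesgue_integral_def
      by (subst integral_bounded_linear'[OF bounded_linear_cnj bounded_linear_cnj, symmetric]) (auto simp: scaleR_conv_of_real)
    also have "\<dots> = M (- k)" unfolding M_def by (simp add: cis_cnj)
    finally show ?thesis by simp
  qed
  \<comment> \<open>The condition u 0 = 0 kills the real part, and M 0 is real because g is.\<close>
  have M0: "M 0 = 0"
  proof -
    have "M 0 = of_real (Re (M 0))" using cnjM[of 0] by (simp add: complex_eq_iff)
    moreover have "f 0 = c 0" using f(1)[of 0] r powser_sums_zero_iff[of c "f 0"] by simp
    then have "Re (M 0 / complex_of_real (2 * pi)) = 0" using uf[of 0] u0 r by (simp add: c_def)
    then have "Re (M 0) = 0" by (simp only: Re_divide_of_real) simp
    ultimately show ?thesis by simp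
  qed
  obtain F where F: "\<And>m. F m holomorphic_on ball 0 r" "\<And>m. F m 0 = c m"
    "\<And>m z. z \<in> ball 0 r \<Longrightarrow> F m z = c m + z * F (Suc m) z" "\<And>z. z \<in> ball 0 r \<Longrightarrow> F 0 z = f z"
    by (rule shifted_power_series[OF f(1)]) (assumption, rule that)
  have "\<exists>k. c k \<noteq> 0"
  proof (rule ccontr)
    assume "\<nexists>k. c k \<noteq> 0"
    then have "f z = 0" if "z \<in> ball 0 r" for z using f(1)[OF that] by (simp add: sums_iff)
    then have "u z = 0" if "z \<in> ball 0 r" for z using uf that by simp
    then show False using unc unfolding constant_on_def by blast
  qed
  \<comment> \<open>The vanishing order at 0; it is identified with n once the nodal curves are
    counted.\<close>
  then obtain m where m: "c m \<noteq> 0" "\<And>k. k < m \<Longrightarrow> c k = 0"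
    using exists_least_iff[of "\<lambda>k. c k \<noteq> 0"] by blast
  have m1: "m \<ge> 1" using m(1) M0 by (cases m) (auto simp: c_def)
  have fm: "f z = z ^ k * F k z" if "z \<in> ball 0 r" "k \<le> m" for z k
    using that(2)
  proof (induction k)
    case 0 then show ?case using F(4) that by simp
  next
    case (Suc k)
    then have "f z = z ^ k * F k z" by simp
    also have "F k z = z * F (Suc k) z" using F(3)[OF that(1), of k] m(2)[of k] Suc by simp
    finally show ?case by simp
  qed
  have hF0: "F m 0 \<noteq> 0" using F(2) m(1) by simp
  obtain \<phi> where "nodal_root \<phi> r m u"
    by (rule nodal_root_exists[OF r F(1) hF0 m1 fm[OF _ order_refl] uf on])
  then interpret nodal_root \<phi> r m u .
  have mn: "m = n" using nodal_curves_eq_lines(2)[OF on] by simp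
  have n: "n \<ge> 1" using m1 mn by simp
  have nodalL: "nodal_curve u (ball 0 r) (L k)" if "k < m" for k
    using nodal_curves_eq_lines(1)[OF on] that by blast
  define pos where "pos = (\<lambda>\<sigma> \<theta>. 0 < \<sigma> * G \<theta> \<longrightarrow>
    (\<exists>\<rho><1. \<forall>x. \<rho> < x \<and> x < 1 \<longrightarrow> 0 < \<sigma> * Poisson_integral r g (of_real (r * x) * cis \<theta>)))"
  \<comment> \<open>Angles at which a nonzero sign of the boundary value is also the sign of u on
    the last piece of the radius; they fill the interval up to a null set.\<close>
  define E where "E = {\<theta>\<in>{0<..<2*pi}. pos 1 \<theta> \<and> pos (-1) \<theta>}"
  have AE: "AE \<theta> in lebesgue. \<theta> \<in> {0..2*pi} \<longrightarrow> \<theta> \<in> E"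
  proof -
    have "negligible {0, 2 * pi}" by (intro negligible_finite) auto
    then have "AE \<theta> in lebesgue. \<theta> \<notin> {0, 2 * pi}" by (intro AE_not_in) (simp add: negligible_iff_null_sets)
    then show ?thesis using AE_radial_sign[OF g(1) r, of 1] AE_radial_sign[OF g(1) r, of "-1"]
    proof eventually_elim
      case (elim \<theta>)
      show ?case
      proof
        assume "\<theta> \<in> {0..2*pi}"
        then have "\<theta> \<in> {0<..<2*pi}" using elim(1) by auto
        then show "\<theta> \<in> E" using elim(2,3) unfolding E_def pos_def G_def by blast
      qed
    qed
  qed
  have noalt: "\<not> alternating G E s (2 * n + 1)" if s: "s = 1 \<or> s = -1" for s
  proof
    assume "alternating G E s (2 * n + 1)"
    then obtain \<theta> where th: "\<And>i. i < 2 * n + 1 \<Longrightarrow> \<theta> i < \<theta> (Suc i)"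
      "\<And>i. i \<le> 2 * n + 1 \<Longrightarrow> \<theta> i \<in> E" "\<And>i. i \<le> 2 * n + 1 \<Longrightarrow> 0 < s * (-1) ^ i * G (\<theta> i)"
      unfolding alternating_def by blast
    have "\<exists>\<rho><1. \<forall>x. \<rho> < x \<and> x < 1 \<longrightarrow> 0 < s * (-1) ^ i * Poisson_integral r g (of_real (r * x) * cis (\<theta> i))"
      if i: "i \<le> 2 * n + 1" for i
    proof -
      have "s * (-1) ^ i = 1 \<or> s * (-1) ^ i = -1" using s by (cases "even i") auto
      then have "pos (s * (-1) ^ i) (\<theta> i)" using th(2)[OF i] by (auto simp: E_def)
      then show ?thesis using th(3)[OF i] by (simp add: pos_def)
    qed
    then obtain \<rho> where \<rho>: "\<And>i. i \<le> 2 * n + 1 \<Longrightarrow> \<rho> i < 1 \<and> (\<forall>x. \<rho> i < x \<and> x < 1 \<longrightarrow>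
        0 < s * (-1) ^ i * Poisson_integral r g (of_real (r * x) * cis (\<theta> i)))" by metis
    \<comment> \<open>For finitely many angles there is a common radius beyond which all the signs
      are settled.\<close>
    define \<rho>m where "\<rho>m = Max (insert 0 (\<rho> ` {..2 * n + 1}))"
    have \<rho>m: "\<rho>m < 1" "0 \<le> \<rho>m" "\<And>i. i \<le> 2 * n + 1 \<Longrightarrow> \<rho> i \<le> \<rho>m"
    proof -
      show "\<rho>m < 1" unfolding \<rho>m_def by (subst Max_less_iff) (use \<rho> in auto)
      show "0 \<le> \<rho>m" unfolding \<rho>m_def by (rule Max_ge) auto
      show "\<rho> i \<le> \<rho>m" if "i \<le> 2 * n + 1" for i unfolding \<rho>m_def by (rule Max_ge) (use that in auto)
    qed
    show False
    proof (rule no_alternating_radii[OF nodalL, of \<theta> "r * \<rho>m" s])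
      show "r * \<rho>m < r" using \<rho>m r by simp
      show "\<theta> i \<in> {0<..<2 * pi}" if "i \<le> 2 * m + 1" for i using th(2)[of i] that mn by (auto simp: E_def)
      show "0 < s * (-1) ^ i * u (of_real x * cis (\<theta> i))" if "i \<le> 2 * m + 1" "r * \<rho>m < x" "x < r" for i x
      proof -
        define y where "y = x / r"
        have y: "\<rho>m < y" "y < 1" "x = r * y" using that r by (auto simp: y_def field_simps)
        have "0 \<le> x" using that(2) \<rho>m(2) r by (smt (verit) mult_nonneg_nonneg)
        then have "of_real x * cis (\<theta> i) \<in> ball 0 r" using that by (simp add: norm_mult)
        then show ?thesis using \<rho>[of i] \<rho>m(3)[of i] y that(1) mn g(2) by simp
      qed
    qed (use th mn in auto)
  qed
  have "E \<subseteq> {0..2*pi}" by (auto simp: E_def)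
  then obtain \<sigma> t where st: "\<sigma> = 1 \<or> \<sigma> = -1" "\<And>\<theta>. \<theta> \<in> E \<Longrightarrow> 0 \<le> \<sigma> * G \<theta> * (\<Prod>i<2*n. sin ((\<theta> - t i) / 2))"
    using sign_pattern_even[of E G n] noalt[of 1] noalt[of "-1"] by auto
  have Mk0: "M k = 0" if "\<bar>k\<bar> < int n" for k
  proof -
    have *: "M (int j) = 0" if "j < n" for j
      using m(2)[of j] that mn M0 r by (cases "j = 0") (auto simp: c_def)
    show ?thesis
    proof (cases "k \<ge> 0")
      case True then show ?thesis using *[of "nat k"] that by simp
    next
      case False
      then have "M (- k) = 0" using *[of "nat (- k)"] that by simp
      then show ?thesis using cnjM[of "- k"] by simp
    qed
  qed
  have key: "cmod (M (int n + 1) - (\<Sum>j<2*n. cis (- t j)) * M (int n)) \<le> 2 * \<bar>Re (cis ((\<Sum>j<2*n. t j) / 2) * M (int n))\<bar>"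
  proof (rule moment_inequality[where g=G and A="{0..2*pi}" and \<sigma>=\<sigma>])
    show "set_integrable lebesgue {0..2*pi} G" using g(1) unfolding L1_circle_def G_def .
    show "AE \<theta> in lebesgue. \<theta> \<in> {0..2*pi} \<longrightarrow> 0 \<le> \<sigma> * G \<theta> * (\<Prod>j<2*n. sin ((\<theta> - t j) / 2))"
      using AE by eventually_elim (use st(2) in blast)
  qed (use Mk0 n st(1) in \<open>auto simp: M_def\<close>)
  have reg: "regular_analytic_curve I \<gamma>" "\<gamma> ` I = C" using \<gamma>(1) by (auto simp: parametrizes_def)
  note gd = regular_analytic_curveD[OF reg(1)]
  have CN: "C \<subseteq> N" using nodal_curveD(1)[OF C] .
  obtain d where d: "d > 0" "ball t0 d \<subseteq> I" using gd(2) \<gamma>(2) openE by blast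
  have vanish: "Re (\<gamma> s ^ n * F m (\<gamma> s)) = 0" if "\<bar>s - t0\<bar> < d" for s
  proof -
    have "s \<in> I" using d(2) that by (auto simp: dist_real_def abs_minus_commute)
    then have "\<gamma> s \<in> N" using CN reg(2) by blast
    then have "\<gamma> s \<in> ball 0 r" "u (\<gamma> s) = 0" by (auto simp: nodal_set_def)
    then show ?thesis using uf fm[of "\<gamma> s" m] mn by simp
  qed
  define e where "e = velocity \<gamma> t0 / cmod (velocity \<gamma> t0)"
  have curv: "cmod e = 1" "Re (F m 0 * e ^ n) = 0"
    "curvature \<gamma> t0 = 2 * Re (deriv (F m) 0 * e ^ (n + 1)) / (n * Im (F m 0 * e ^ n))"
    unfolding e_def by (rule curvature_nodal[OF gd(4)[OF \<gamma>(2)] \<gamma>(3) gd(5)[OF \<gamma>(2)] F(1) r hF0 d(1) vanish n], assumption)+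
  have dF: "deriv (F m) 0 = c (Suc m)"
  proof (rule DERIV_imp_deriv)
    have "(F (Suc m) has_field_derivative deriv (F (Suc m)) 0) (at 0)"
      using holomorphic_derivI[OF F(1), of 0] r by simp
    then have "((\<lambda>z. c m + z * F (Suc m) z) has_field_derivative c (Suc m)) (at 0)"
      by (auto intro!: derivative_eq_intros simp: F(2))
    then show "(F m has_field_derivative c (Suc m)) (at 0)"
    proof (rule has_field_derivative_transform_within_open[OF _ open_ball[of 0 r]])
      show "c m + z * F (Suc m) z = F m z" if "z \<in> ball 0 r" for z using F(3)[OF that, of m] by (rule sym)
    qed (use r in simp)
  qed
  have a: "F m 0 = M (int n) / of_real (pi * r ^ n)" using F(2) n mn by (simp add: c_def)
  have b: "deriv (F m) 0 = M (int n + 1) / of_real (pi * r ^ (n + 1))"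
    unfolding dF using mn by (simp add: c_def add.commute)
  define \<alpha> where "\<alpha> = Arg e"
  have e: "e = cis \<alpha>" using curv(1) unfolding \<alpha>_def by (metis mult_1 of_real_1 rcis_cmod_Arg rcis_def)
  \<comment> \<open>Since e is tangent to a nodal curve, M n e^n is \<i> \<mu>, so M n is known up
    to the real factor \<mu> and the angle \<alpha>.\<close>
  define \<mu> where "\<mu> = Im (M (int n) * e ^ n)"
  have "Re (M (int n) * e ^ n) = 0"
  proof -
    have "F m 0 * e ^ n = M (int n) * e ^ n / of_real (pi * r ^ n)" by (simp add: a)
    then have "Re (M (int n) * e ^ n) / (pi * r ^ n) = 0" using curv(2) by (simp only: Re_divide_of_real)
    then show ?thesis using r by simp
  qed
  then have Me: "M (int n) * e ^ n = \<i> * of_real \<mu>" by (simp add: complex_eq_iff \<mu>_def)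
  have Mn: "M (int n) = \<i> * of_real \<mu> * cis (- (real n * \<alpha>))"
  proof -
    have "M (int n) = M (int n) * e ^ n * cis (- (real n * \<alpha>))"
      by (simp add: e Complex.DeMoivre mult.assoc cis_mult)
    then show ?thesis unfolding Me .
  qed
  have mu0: "\<mu> \<noteq> 0"
  proof
    assume "\<mu> = 0"
    then have "M (int n) = 0" using Mn by simp
    then show False using hF0 a by simp
  qed
  define X where "X = Re (M (int n + 1) * e ^ (n + 1))"
  have curvX: "curvature \<gamma> t0 = 2 / (n * r) * (X / \<mu>)"
  proof -
    have "deriv (F m) 0 * e ^ (n + 1) = M (int n + 1) * e ^ (n + 1) / of_real (pi * r ^ (n + 1))" by (simp add: b)
    then have 1: "Re (deriv (F m) 0 * e ^ (n + 1)) = X / (pi * r ^ (n + 1))" by (simp only: Re_divide_of_real X_def)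
    have "F m 0 * e ^ n = M (int n) * e ^ n / of_real (pi * r ^ n)" by (simp add: a)
    then have 2: "Im (F m 0 * e ^ n) = \<mu> / (pi * r ^ n)" by (simp only: Im_divide_of_real \<mu>_def)
    show ?thesis unfolding curv(3) 1 2 using r mu0 n by (simp add: field_simps)
  qed
  define \<tau> where "\<tau> = (\<lambda>j. t j - \<alpha>)"
  have S: "(\<Sum>j<2*n. \<tau> j) / 2 = (\<Sum>j<2*n. t j) / 2 - real n * \<alpha>" by (simp add: \<tau>_def sum_subtractf field_simps)
  have R1: "Re (cis ((\<Sum>j<2*n. t j) / 2) * M (int n)) = - \<mu> * sin ((\<Sum>j<2*n. \<tau> j) / 2)"
  proof -
    have "cis ((\<Sum>j<2*n. t j) / 2) * M (int n) = \<i> * of_real \<mu> * cis ((\<Sum>j<2*n. \<tau> j) / 2)"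
      unfolding Mn S by (simp add: mult_ac cis_mult)
    then show ?thesis by simp
  qed
  \<comment> \<open>The unimodular factor e^(n+1) does not affect the modulus. It turns each
    \<open>cis (- t j)\<close> into \<open>cis (- \<tau> j)\<close> and isolates X, the numerator of
    the curvature.\<close>
  have R2: "Re ((M (int n + 1) - (\<Sum>j<2*n. cis (- t j)) * M (int n)) * e ^ (n + 1)) = X - \<mu> * (\<Sum>j<2*n. sin (\<tau> j))"
  proof -
    have "(\<Sum>j<2*n. cis (- t j)) * M (int n) * e ^ (n + 1) = (\<Sum>j<2*n. cis (- t j)) * (M (int n) * e ^ n) * e"
      by simp
    also have "\<dots> = \<i> * of_real \<mu> * (\<Sum>j<2*n. cis (- \<tau> j))"
    proof -
      have "cis (- \<tau> j) = cis (- t j) * e" for j by (simp add: e \<tau>_def cis_mult)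
      then have "(\<Sum>j<2*n. cis (- \<tau> j)) = (\<Sum>j<2*n. cis (- t j)) * e" by (simp add: sum_distrib_right)
      then show ?thesis unfolding Me by (simp only: mult_ac)
    qed
    finally have "Re ((\<Sum>j<2*n. cis (- t j)) * M (int n) * e ^ (n + 1)) = \<mu> * (\<Sum>j<2*n. sin (\<tau> j))"
      by (simp add: Im_sum sum_negf)
    then show ?thesis by (simp add: left_diff_distrib X_def)
  qed
  have "\<bar>X - \<mu> * (\<Sum>j<2*n. sin (\<tau> j))\<bar> \<le> cmod ((M (int n + 1) - (\<Sum>j<2*n. cis (- t j)) * M (int n)) * e ^ (n + 1))"
    unfolding R2[symmetric] by (rule abs_Re_le_cmod)
  also have "\<dots> = cmod (M (int n + 1) - (\<Sum>j<2*n. cis (- t j)) * M (int n))"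
    using curv(1) by (simp only: norm_mult norm_power power_one mult_1_right)
  also have "\<dots> \<le> 2 * (\<bar>\<mu>\<bar> * \<bar>sin ((\<Sum>j<2*n. \<tau> j) / 2)\<bar>)" using key unfolding R1 by (simp only: abs_mult abs_minus_cancel)
  finally have "\<bar>X\<bar> \<le> \<bar>\<mu>\<bar> * \<bar>\<Sum>j<2*n. sin (\<tau> j)\<bar> + 2 * (\<bar>\<mu>\<bar> * \<bar>sin ((\<Sum>j<2*n. \<tau> j) / 2)\<bar>)"
    using abs_mult[of \<mu> "\<Sum>j<2*n. sin (\<tau> j)"] by linarith
  then have "\<bar>X\<bar> / \<bar>\<mu>\<bar> \<le> \<bar>\<Sum>j<2*n. sin (\<tau> j)\<bar> + 2 * \<bar>sin ((\<Sum>j<2*n. \<tau> j) / 2)\<bar>"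
    using mu0 by (simp add: field_simps)
  then have "2 / (n * r) * (\<bar>X\<bar> / \<bar>\<mu>\<bar>) \<le> 2 / (n * r) * (\<bar>\<Sum>j<2*n. sin (\<tau> j)\<bar> + 2 * \<bar>sin ((\<Sum>j<2*n. \<tau> j) / 2)\<bar>)"
    using r by (intro mult_left_mono) auto
  moreover have "\<bar>curvature \<gamma> t0\<bar> = 2 / (n * r) * (\<bar>X\<bar> / \<bar>\<mu>\<bar>)"
    unfolding curvX using r by (simp add: abs_mult)
  ultimately show ?thesis using that[of \<tau>] by simp
qed

theorem nodal_curvature_bound_general:
  assumes n: "n \<ge> 1" and r: "r > 0"
  shows "nodal_curvature_bound n r (4 * (real n + 1) / (real n * r))"
  unfolding nodal_curvature_bound_def
proof (intro allI impI)
  fix u C I \<gamma> t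
  assume a: "admissible n r u \<and> nodal_curve u (ball 0 r) C \<and> parametrizes I \<gamma> C \<and> t \<in> I \<and> \<gamma> t = 0"
  obtain \<tau> where "\<bar>curvature \<gamma> t\<bar> \<le> 2 / (n * r) * (\<bar>\<Sum>j<2*n. sin (\<tau> j)\<bar> + 2 * \<bar>sin ((\<Sum>j<2*n. \<tau> j) / 2)\<bar>)"
    using curvature_bound_by_angles[OF _ n r, of u C I \<gamma> t] a by metis
  also have "\<dots> \<le> 2 / (n * r) * (2 * real n + 2 * 1)"
  proof (intro mult_left_mono add_mono)
    have "\<bar>\<Sum>j<2*n. sin (\<tau> j)\<bar> \<le> (\<Sum>j<2*n. 1)" by (rule order_trans[OF sum_abs sum_mono]) simp
    then show "\<bar>\<Sum>j<2*n. sin (\<tau> j)\<bar> \<le> 2 * real n" by simp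
  qed (use r in auto)
  also have "\<dots> = 4 * (real n + 1) / (real n * r)" using n r by (simp add: field_simps)
  finally show "\<bar>curvature \<gamma> t\<bar> \<le> 4 * (real n + 1) / (real n * r)" .
qed

theorem nodal_curvature_bound_even:
  assumes n: "n \<ge> 1" "even n" and r: "r > 0"
  shows "nodal_curvature_bound n r (4 * (real n + 1) / (real n * r) * cos (pi / (2 * (real n + 1))))"
  unfolding nodal_curvature_bound_def
proof (intro allI impI)
  fix u C I \<gamma> t
  assume a: "admissible n r u \<and> nodal_curve u (ball 0 r) C \<and> parametrizes I \<gamma> C \<and> t \<in> I \<and> \<gamma> t = 0"
  have n2: "n \<ge> 2" using n by (cases "n = 1") auto
  obtain \<tau> where "\<bar>curvature \<gamma> t\<bar> \<le> 2 / (n * r) * (\<bar>\<Sum>j<2*n. sin (\<tau> j)\<bar> + 2 * \<bar>sin ((\<Sum>j<2*n. \<tau> j) / 2)\<bar>)"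
    using curvature_bound_by_angles[OF _ n(1) r, of u C I \<gamma> t] a by metis
  also have "\<dots> \<le> 2 / (n * r) * ((2 * real n + 2) * cos (pi / (2 * real n + 2)))"
    using r by (intro mult_left_mono sum_sin_plus_sin_half_sum_le n n2) auto
  also have "\<dots> = 4 * (real n + 1) / (real n * r) * cos (pi / (2 * (real n + 1)))"
    using n r by (simp add: field_simps)
  finally show "\<bar>curvature \<gamma> t\<bar> \<le> 4 * (real n + 1) / (real n * r) * cos (pi / (2 * (real n + 1)))" .
qed

subsection \<open>An inequality for the extremal function\<close>

text \<open>The estimate cot T \<ge> 1 / T - T / 2 without a denominator; it makes the trigonometric
  condition in \<open>Re_extremal_pos\<close> algebraic. The auxiliary function \<open>p\<close> has
  derivative x^2 cos x / 2.\<close>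

lemma cos_ge_sin_mult:
  fixes T :: real
  assumes T: "0 < T" "T \<le> pi / 2"
  shows "sin T * (1 / T - T / 2) \<le> cos T"
proof -
  define p where "p = (\<lambda>T::real. T * cos T - sin T + T\<^sup>2 * sin T / 2)"
  have "p 0 \<le> p T"
  proof (rule DERIV_nonneg_imp_nondecreasing[OF less_imp_le[OF T(1)]])
    fix x assume x: "0 \<le> x" "x \<le> T"
    have "(p has_real_derivative x\<^sup>2 * cos x / 2) (at x)"
      unfolding p_def by (auto intro!: derivative_eq_intros simp: algebra_simps power2_eq_square)
    moreover have "0 \<le> cos x" using x T by (intro cos_ge_zero) auto
    ultimately show "\<exists>y. (p has_real_derivative y) (at x) \<and> 0 \<le> y" by (intro exI[of _ "x\<^sup>2 * cos x / 2"]) simp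
  qed
  then have "0 \<le> p T" by (simp add: p_def)
  then have "0 \<le> p T / T" using T by simp
  also have "p T / T = cos T - sin T * (1 / T - T / 2)"
    using T by (simp add: p_def field_simps power2_eq_square)
  finally show ?thesis by simp
qed

lemma complex_power_polar:
  fixes w :: complex
  assumes "Re w > 0"
  obtains r where "r > 0" "w ^ n = of_real r * cis (real n * arctan (Im w / Re w))"
proof -
  define \<psi> where "\<psi> = arctan (Im w / Re w)"
  define r where "r = Re w / cos \<psi>"
  have c: "cos \<psi> > 0" unfolding \<psi>_def by (intro cos_gt_zero_pi arctan_lbound arctan_ubound)
  have "sin \<psi> / cos \<psi> = Im w / Re w" using tan_arctan[of "Im w / Re w"] by (simp add: \<psi>_def tan_def)
  then have "r * sin \<psi> = Im w" using assms c by (simp add: r_def field_simps)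
  moreover have "r * cos \<psi> = Re w" using c by (simp add: r_def)
  ultimately have "w = of_real r * cis \<psi>" by (simp add: complex_eq_iff)
  then have "w ^ n = of_real (r ^ n) * cis (real n * \<psi>)" by (simp add: power_mult_distrib Complex.DeMoivre)
  moreover have "r > 0" using assms c by (simp add: r_def)
  ultimately show ?thesis using that[of "r ^ n"] by (simp add: \<psi>_def)
qed

lemma arctan_le_self: "0 \<le> x \<Longrightarrow> arctan x \<le> x" for x :: real
  by (metis abs_arctan_le abs_of_nonneg arctan_le_zero_iff linorder_not_le order_less_imp_le zero_le_arctan_iff)

text \<open>Here a stands for \<tau>^2, and M bounds |\<omega> + \<i>\<tau>|^2 on the region where a
  zero of the real part has to be excluded. The decimals are fitted to 1.55 < pi / 2 and 2.4 <
  1.55^2. The bound 3 / (n + 1)^2 equals tan (pi / 6)^2 for n = 2; the cases n = 2 and n = 4 satisfy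
  the first alternative at the end, the others the second.\<close>

lemma extremal_parameter_bounds:
  fixes a :: real
  assumes n: "n \<ge> 1" and a: "a = 0 \<or> (n = 2 \<or> n = 4 \<or> n \<ge> 6) \<and> 0 \<le> a \<and> a \<le> 3 / (real n + 1)\<^sup>2"
  defines "M \<equiv> (1 + a) / (2 * real n + 1)"
  shows "0 \<le> a" "M < 1" "real n * M < 1 - M"
    "a < 2 / real n * ((1 + 1 / (2 * real n)) - M * (1 + 1 / (2 * real n) + real n))"
    "((real n)\<^sup>2 + 2.4) * M \<le> 2.4 \<or> real n * (2 * M + a) \<le> 1.55 * (1 - M)"
proof -
  define N where "N = real n"
  have N: "N \<ge> 1" using n by (simp add: N_def)
  show a0: "0 \<le> a" using a by auto
  have M: "M = (1 + a) / (2 * N + 1)" by (simp add: M_def N_def)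
  have ab: "a * (N + 1)\<^sup>2 \<le> 3" if "a \<noteq> 0" using a that by (auto simp: N_def field_simps)
  have N2: "N \<ge> 2" if "a \<noteq> 0" using a that by (auto simp: N_def)
  have aN: "(N + 1) * a < N"
  proof (cases "a = 0")
    case False
    have "(N + 1) * ((N + 1) * a) \<le> 3" using ab[OF False] by (simp add: power2_eq_square algebra_simps)
    also have "3 < (N + 1) * N" using N2[OF False] mult_mono[of 3 "N + 1" 2 N] by simp
    finally show ?thesis using N by (simp add: mult_less_cancel_left_pos)
  qed (use N in simp)
  then have "(N + 1) * M < 1" unfolding M using N by (simp add: field_simps)
  then show "real n * M < 1 - M" by (simp add: N_def algebra_simps)
  have M0: "0 \<le> M" unfolding M using N a0 by simp
  then have "0 \<le> N * M" using N by simp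
  with \<open>(N + 1) * M < 1\<close> show "M < 1" by (simp add: algebra_simps)
  \<comment> \<open>The strict upper bound for a with denominators cleared. Expanding the required
    inequality at N = 2 leaves only positive coefficients.\<close>
  have key: "a * (2 * N^3 + 3 * N\<^sup>2 + 2 * N + 1) < 2 * N * (N + 1)"
  proof (cases "a = 0")
    case False
    have "3 * (2 * N^3 + 3 * N\<^sup>2 + 2 * N + 1) < 2 * N * (N + 1) * (N + 1)\<^sup>2"
    proof -
      define t where "t = N - 2"
      have t: "t \<ge> 0" "N = t + 2" using N2[OF False] by (auto simp: t_def)
      have "2 * N * (N + 1) * (N + 1)\<^sup>2 - 3 * (2 * N^3 + 3 * N\<^sup>2 + 2 * N + 1) = 2 * t^4 + 16 * t^3 + 45 * t\<^sup>2 + 48 * t + 9"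
        unfolding t(2) by (simp add: power2_eq_square power3_eq_cube power4_eq_xxxx algebra_simps)
      moreover have "0 < 2 * t^4 + 16 * t^3 + 45 * t\<^sup>2 + 48 * t + 9" using t(1) by (simp add: add_nonneg_pos)
      ultimately show ?thesis by linarith
    qed
    moreover have "a * (N + 1)\<^sup>2 * (2 * N^3 + 3 * N\<^sup>2 + 2 * N + 1) \<le> 3 * (2 * N^3 + 3 * N\<^sup>2 + 2 * N + 1)"
      using ab[OF False] N by (intro mult_right_mono) auto
    ultimately have "(a * (2 * N^3 + 3 * N\<^sup>2 + 2 * N + 1)) * (N + 1)\<^sup>2 < (2 * N * (N + 1)) * (N + 1)\<^sup>2"
      by (simp add: mult_ac)
    then show ?thesis using N by (simp add: mult_less_cancel_right_pos)
  qed (use N in simp)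
  show "a < 2 / real n * ((1 + 1 / (2 * real n)) - M * (1 + 1 / (2 * real n) + real n))"
  proof -
    have 1: "2 / N * (1 + 1 / (2 * N)) = (2 * N + 1) / N\<^sup>2"
      and 2: "2 / N * (1 + 1 / (2 * N) + N) = (2 * N + 1 + 2 * N\<^sup>2) / N\<^sup>2"
      using N by (simp_all add: field_simps power2_eq_square)
    have "2 / N * ((1 + 1 / (2 * N)) - M * (1 + 1 / (2 * N) + N)) - a =
      (2 * N + 1) / N\<^sup>2 - M * ((2 * N + 1 + 2 * N\<^sup>2) / N\<^sup>2) - a"
      unfolding 1[symmetric] 2[symmetric] by (simp add: algebra_simps)
    also have "\<dots> = (2 * N * (N + 1) - a * (2 * N^3 + 3 * N\<^sup>2 + 2 * N + 1)) / (N\<^sup>2 * (2 * N + 1))"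
      unfolding M using N by (simp add: divide_simps) (simp add: algebra_simps power2_eq_square power3_eq_cube)
    also have "\<dots> > 0" using key N by simp
    finally show ?thesis by (simp add: N_def)
  qed
  show "((real n)\<^sup>2 + 2.4) * M \<le> 2.4 \<or> real n * (2 * M + a) \<le> 1.55 * (1 - M)"
  proof (cases "a = 0")
    case True
    have "N * (2 * M) \<le> 1.55 * (1 - M)" unfolding M using True N by (simp add: field_simps)
    then show ?thesis using True by (simp add: N_def)
  next
    case False
    then consider "n = 2" | "n = 4" | "n \<ge> 6" using a by blast
    then show ?thesis
    proof cases
      case 1
      then have "a \<le> 1 / 3" using ab[OF False] by (simp add: N_def power2_eq_square)
      then show ?thesis using 1 by (simp add: M_def)
    next
      case 2
      then have "a \<le> 3 / 25" using ab[OF False] by (simp add: N_def power2_eq_square)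
      then show ?thesis using 2 by (simp add: M_def)
    next
      case 3
      have N6: "N \<ge> 6" using 3 by (simp add: N_def)
      have "a * 7\<^sup>2 \<le> a * (N + 1)\<^sup>2" using N6 a0 by (intro mult_left_mono power_mono) auto
      then have a1: "a \<le> 3 / 49" using ab[OF False] by simp
      have "N * a * (N + 1)\<^sup>2 \<le> 3 * N" using ab[OF False] N by (simp add: mult.assoc mult.commute mult_left_mono)
      also have "3 * N \<le> 18 / 49 * (N + 1)\<^sup>2"
      proof -
        have "18 / 49 * (N + 1)\<^sup>2 - 3 * N = (N - 6) * (18 * N - 3) / 49" by (simp add: power2_eq_square field_simps)
        also have "\<dots> \<ge> 0" using N6 by simp
        finally show ?thesis by simp
      qed
      finally have a2: "N * a \<le> 18 / 49" using N by (simp add: mult_le_cancel_right_pos)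
      have "(2 * N + 1.55) * M \<le> 1.11"
      proof -
        have "(2 * N + 1.55) * (1 + a) \<le> (2 * N + 1.55) * (52 / 49)" using N a1 by (intro mult_left_mono) auto
        also have "\<dots> \<le> 1.11 * (2 * N + 1)" using N6 by (simp add: field_simps)
        finally show ?thesis unfolding M using N by (simp add: field_simps)
      qed
      then have "N * (2 * M + a) \<le> 1.55 * (1 - M)" using a2 by (simp add: algebra_simps)
      then show ?thesis by (simp add: N_def)
    qed
  qed
qed

text \<open>With x = Re \<omega> and Y = - Im \<omega> the left side bounds n times the argument of
  1 - \<omega>^2, which must stay below pi / 2. One alternative for M is used through 4 Y^2 (1 -
  x^2) \<le> (1 - x^2 + Y^2)^2, the other through 2 x Y \<le> 2 M + \<tau>^2.\<close>

lemma extremal_angle_bound: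
  fixes x Y \<tau> :: real
  assumes n: "n \<ge> 1" and a: "\<tau>\<^sup>2 = 0 \<or> (n = 2 \<or> n = 4 \<or> n \<ge> 6) \<and> \<tau>\<^sup>2 \<le> 3 / (real n + 1)\<^sup>2"
    and x: "x > 0" and Y: "Y > 0" and le: "x\<^sup>2 + (\<tau> - Y)\<^sup>2 \<le> (1 + \<tau>\<^sup>2) / (2 * real n + 1)"
  shows "real n * (2 * x * Y / (1 - x\<^sup>2 + Y\<^sup>2)) \<le> 1.55"
proof -
  define M where "M = (1 + \<tau>\<^sup>2) / (2 * real n + 1)"
  define t where "t = real n * (2 * x * Y / (1 - x\<^sup>2 + Y\<^sup>2))"
  have a': "\<tau>\<^sup>2 = 0 \<or> (n = 2 \<or> n = 4 \<or> n \<ge> 6) \<and> 0 \<le> \<tau>\<^sup>2 \<and> \<tau>\<^sup>2 \<le> 3 / (real n + 1)\<^sup>2" using a by simp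
  note B = extremal_parameter_bounds[OF n a', folded M_def]
  have le: "x\<^sup>2 + (\<tau> - Y)\<^sup>2 \<le> M" using le by (simp add: M_def)
  have xM: "x\<^sup>2 \<le> M" using le zero_le_power2[of "\<tau> - Y"] by linarith
  have D1: "1 - x\<^sup>2 + Y\<^sup>2 \<ge> 1 - M" using xM zero_le_power2[of Y] by linarith
  have D0: "1 - x\<^sup>2 + Y\<^sup>2 > 0" using D1 B(2) by linarith
  have t0: "0 \<le> t" unfolding t_def using x Y D0 by simp
  from B(5) have "t \<le> 1.55"
  proof
    assume "((real n)\<^sup>2 + 2.4) * M \<le> 2.4"
    moreover have "((real n)\<^sup>2 + 2.4) * x\<^sup>2 \<le> ((real n)\<^sup>2 + 2.4) * M" using xM by (intro mult_left_mono) auto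
    ultimately have s: "(real n)\<^sup>2 * x\<^sup>2 \<le> 2.4 * (1 - x\<^sup>2)" by (simp add: algebra_simps)
    have "4 * Y\<^sup>2 * (1 - x\<^sup>2) \<le> (1 - x\<^sup>2 + Y\<^sup>2)\<^sup>2"
      using zero_le_power2[of "1 - x\<^sup>2 - Y\<^sup>2"] by (simp add: power2_eq_square algebra_simps)
    then have "2.4 * (4 * Y\<^sup>2 * (1 - x\<^sup>2)) \<le> 2.4 * (1 - x\<^sup>2 + Y\<^sup>2)\<^sup>2" by simp
    moreover have "4 * Y\<^sup>2 * ((real n)\<^sup>2 * x\<^sup>2) \<le> 4 * Y\<^sup>2 * (2.4 * (1 - x\<^sup>2))" using s by (intro mult_left_mono) auto
    ultimately have "4 * Y\<^sup>2 * ((real n)\<^sup>2 * x\<^sup>2) \<le> 2.4 * (1 - x\<^sup>2 + Y\<^sup>2)\<^sup>2" by linarith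
    moreover have "t\<^sup>2 = 4 * Y\<^sup>2 * ((real n)\<^sup>2 * x\<^sup>2) / (1 - x\<^sup>2 + Y\<^sup>2)\<^sup>2"
      by (simp add: t_def power_mult_distrib power_divide)
    ultimately have "t\<^sup>2 \<le> 2.4" using D0 by (simp add: divide_le_eq)
    also have "\<dots> \<le> 1.55\<^sup>2" by (simp add: power2_eq_square)
    finally show ?thesis by (rule power2_le_imp_le) simp
  next
    assume s: "real n * (2 * M + \<tau>\<^sup>2) \<le> 1.55 * (1 - M)"
    have s': "1.55 * (1 - M) \<le> 1.55 * (1 - x\<^sup>2 + Y\<^sup>2)" by (rule mult_left_mono[OF D1]) simp
    have "2 * x * \<tau> \<le> x\<^sup>2 + \<tau>\<^sup>2" using sum_squares_bound[of x \<tau>] by simp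
    moreover have "2 * x * (Y - \<tau>) \<le> x\<^sup>2 + (\<tau> - Y)\<^sup>2" using sum_squares_bound[of x "Y - \<tau>"] by (simp add: power2_commute)
    ultimately have "2 * x * Y \<le> 2 * M + \<tau>\<^sup>2" using xM le by (simp add: algebra_simps)
    then have "real n * (2 * x * Y) \<le> real n * (2 * M + \<tau>\<^sup>2)" by (intro mult_left_mono) auto
    also note s
    also note s'
    finally have "real n * (2 * x * Y) \<le> 1.55 * (1 - x\<^sup>2 + Y\<^sup>2)" .
    then show ?thesis using D0 by (simp add: t_def field_simps)
  qed
  then show ?thesis by (simp add: t_def)
qed

text \<open>As 1 - \<omega>^2 has real part D > 0, its n-th power has the argument -T or T with T =
  n arctan (2 x |y| / D). For Im \<omega> \<ge> 0 one has T \<le> 1 and both terms of the real part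
  are nonnegative. For Y = - Im \<omega> > 0 the claim is x cot T > \<tau> - Y, and
  \<open>cos_ge_sin_mult\<close> together with T \<le> t reduces it to a rational
  inequality.\<close>

lemma Re_extremal_pos:
  fixes \<omega> :: complex and \<tau> :: real
  assumes n: "n \<ge> 1" and a: "\<tau>\<^sup>2 = 0 \<or> (n = 2 \<or> n = 4 \<or> n \<ge> 6) \<and> \<tau>\<^sup>2 \<le> 3 / (real n + 1)\<^sup>2"
    and \<tau>: "\<tau> \<ge> 0" and \<omega>: "Re \<omega> > 0"
    and le: "(2 * real n + 1) * (cmod (\<omega> + \<i> * \<tau>))\<^sup>2 \<le> 1 + \<tau>\<^sup>2"
  shows "Re ((1 - \<omega>\<^sup>2) ^ n * (\<omega> + \<i> * \<tau>)) > 0"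
proof -
  define M where "M = (1 + \<tau>\<^sup>2) / (2 * real n + 1)"
  define x y where "x = Re \<omega>" and "y = Im \<omega>"
  define D where "D = 1 - x\<^sup>2 + y\<^sup>2"
  have a': "\<tau>\<^sup>2 = 0 \<or> (n = 2 \<or> n = 4 \<or> n \<ge> 6) \<and> 0 \<le> \<tau>\<^sup>2 \<and> \<tau>\<^sup>2 \<le> 3 / (real n + 1)\<^sup>2" using a by simp
  note B = extremal_parameter_bounds[OF n a', folded M_def]
  have x: "x > 0" using \<omega> by (simp add: x_def)
  have le: "x\<^sup>2 + (y + \<tau>)\<^sup>2 \<le> M"
    using le by (simp add: cmod_power2 x_def y_def M_def pos_le_divide_eq mult.commute)
  have xM: "x\<^sup>2 \<le> M" using le zero_le_power2[of "y + \<tau>"] by linarith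
  have D1: "D \<ge> 1 - M" unfolding D_def using xM zero_le_power2[of y] by linarith
  have D0: "D > 0" using D1 B(2) by linarith
  have wc: "Re (1 - \<omega>\<^sup>2) = D" "Im (1 - \<omega>\<^sup>2) = - (2 * x * y)"
    by (simp_all add: D_def x_def y_def power2_eq_square)
  note polar = complex_power_polar[of "1 - \<omega>\<^sup>2" n, unfolded wc]
  obtain r where r: "r > 0" "(1 - \<omega>\<^sup>2) ^ n = of_real r * cis (real n * arctan (- (2 * x * y) / D))"
    by (rule polar[OF D0]) (rule that)
  have Re: "Re ((1 - \<omega>\<^sup>2) ^ n * (\<omega> + \<i> * \<tau>)) =
    r * (x * cos (real n * arctan (- (2 * x * y) / D)) - (y + \<tau>) * sin (real n * arctan (- (2 * x * y) / D)))"
    unfolding r(2) by (simp add: x_def y_def algebra_simps)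
  show ?thesis
  proof (cases "y \<ge> 0")
    case True
    define T where "T = real n * arctan (2 * x * y / D)"
    have T0: "0 \<le> T" using x True D0 by (simp add: T_def)
    have "2 * x * y \<le> x\<^sup>2 + y\<^sup>2" using sum_squares_bound[of x y] by simp
    also have "y\<^sup>2 \<le> (y + \<tau>)\<^sup>2" using True \<tau> by (intro power_mono) auto
    finally have "2 * x * y \<le> M" using le by linarith
    then have "real n * (2 * x * y) \<le> real n * M" by (intro mult_left_mono) auto
    then have "real n * (2 * x * y) \<le> D" using B(3) D1 by linarith
    have "T \<le> real n * (2 * x * y / D)"
      unfolding T_def using x True D0 by (intro mult_left_mono arctan_le_self) auto
    also have "\<dots> \<le> 1" using \<open>real n * (2 * x * y) \<le> D\<close> D0 by (simp add: field_simps)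
    finally have T1: "T \<le> 1" .
    have "cos T > 0" using T0 T1 pi_gt3 by (intro cos_gt_zero_pi) auto
    moreover have "sin T \<ge> 0" using T0 T1 pi_gt3 by (intro sin_ge_zero) auto
    ultimately have "x * cos T + (y + \<tau>) * sin T > 0" using x True \<tau> by (intro add_pos_nonneg) auto
    then show ?thesis unfolding Re using r(1) by (simp add: T_def arctan_minus)
  next
    case False
    define Y where "Y = - y"
    define T where "T = real n * arctan (2 * x * Y / D)"
    define t where "t = real n * (2 * x * Y / D)"
    have Y: "Y > 0" using False by (simp add: Y_def)
    have D: "D = 1 - x\<^sup>2 + Y\<^sup>2" by (simp add: D_def Y_def)
    have t2: "t \<le> 1.55"
      unfolding t_def D by (rule extremal_angle_bound[OF n a x Y]) (use le in \<open>simp add: Y_def M_def add.commute\<close>)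
    have T0: "0 < T" using x Y D0 n by (simp add: T_def)
    have Tt: "T \<le> t" unfolding T_def t_def using x Y D0 by (intro mult_left_mono arctan_le_self) auto
    have Tpi: "T \<le> pi / 2" using Tt t2 pi_approx(1) by simp
    have sT: "sin T > 0" using T0 Tpi by (intro sin_gt_zero) auto
    have "1 / t - t / 2 \<le> 1 / T - T / 2" using T0 Tt by (intro diff_mono divide_left_mono) auto
    then have "sin T * (1 / t - t / 2) \<le> sin T * (1 / T - T / 2)" using sT by (intro mult_left_mono) auto
    also have "\<dots> \<le> cos T" by (rule cos_ge_sin_mult[OF T0 Tpi])
    finally have "x * (sin T * (1 / t - t / 2)) \<le> x * cos T" using x by (intro mult_left_mono) auto
    moreover have "x * (1 / t - t / 2) > \<tau> - Y"
    proof -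
      \<comment> \<open>One has x (1/t - t/2) \<ge> P / Y + Q Y - Y, so P / Y + Q Y > \<tau>
        remains: a quadratic inequality in Y whose discriminant \<tau>^2 - 4 P Q is
        negative.\<close>
      define P where "P = (1 - x\<^sup>2) / (2 * real n)"
      define Q where "Q = 1 + 1 / (2 * real n) - real n * x\<^sup>2 / (1 - x\<^sup>2)"
      have x1: "1 - x\<^sup>2 > 0" using xM B(2) by linarith
      have P: "P > 0" using x1 n by (simp add: P_def)
      have "4 * P * Q = 2 / real n * ((1 + 1 / (2 * real n)) - x\<^sup>2 * (1 + 1 / (2 * real n) + real n))"
        unfolding P_def Q_def using x1 n by (simp add: field_simps)
      moreover have "2 / real n * ((1 + 1 / (2 * real n)) - M * (1 + 1 / (2 * real n) + real n))
        \<le> 2 / real n * ((1 + 1 / (2 * real n)) - x\<^sup>2 * (1 + 1 / (2 * real n) + real n))"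
        using xM by (intro mult_left_mono diff_left_mono mult_right_mono) auto
      ultimately have PQ: "\<tau>\<^sup>2 < 4 * P * Q" using B(4) by linarith
      then have "0 < P * Q" using zero_le_power2[of \<tau>] by linarith
      then have Q: "Q > 0" using P by (simp add: zero_less_mult_iff)
      have "0 < (4 * P * Q - \<tau>\<^sup>2) + (2 * Q * Y - \<tau>)\<^sup>2" using PQ by (intro add_pos_nonneg) auto
      also have "\<dots> = 4 * Q * (P + Q * Y\<^sup>2 - \<tau> * Y)" by (simp add: power2_eq_square algebra_simps)
      finally have "0 < P + Q * Y\<^sup>2 - \<tau> * Y" using Q by (simp add: zero_less_mult_iff)
      then have "0 < (P + Q * Y\<^sup>2 - \<tau> * Y) / Y" using Y by simp
      then have 1: "\<tau> < P / Y + Q * Y" using Y by (simp add: field_simps power2_eq_square)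
      have "real n * x\<^sup>2 * Y / D \<le> real n * x\<^sup>2 * Y / (1 - x\<^sup>2)"
        using x1 D Y D0 by (intro divide_left_mono) auto
      moreover have "x * (1 / t) = P / Y + Y / (2 * real n)"
        unfolding t_def P_def using x Y D0 n D by (simp add: field_simps power2_eq_square)
      moreover have "x * (t / 2) = real n * x\<^sup>2 * Y / D" by (simp add: t_def power2_eq_square)
      moreover have "Q * Y = Y + Y / (2 * real n) - real n * x\<^sup>2 * Y / (1 - x\<^sup>2)"
        by (simp add: Q_def algebra_simps)
      ultimately show ?thesis using 1 by (simp add: right_diff_distrib)
    qed
    then have "sin T * (\<tau> - Y) < sin T * (x * (1 / t - t / 2))" using sT by (simp add: mult_strict_left_mono)
    ultimately have "sin T * (\<tau> - Y) < x * cos T" by (simp add: mult_ac)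
    then have "0 < x * cos T - (y + \<tau>) * sin T" by (simp add: Y_def algebra_simps)
    then show ?thesis unfolding Re using r(1) by (simp add: T_def Y_def)
  qed
qed

subsection \<open>Radially transversal nodal sets\<close>

text \<open>At the first return to the level c the function would come from above, whereas its
  positive derivative there forces smaller values just before.\<close>

lemma greater_after_upcrossing:
  fixes f :: "real \<Rightarrow> real"
  assumes d: "\<And>t. (f has_real_derivative f' t) (at t)" and pos: "\<And>t. f t = c \<Longrightarrow> f' t > 0"
    and a: "f a = c" and at: "a < t"
  shows "c < f t"
proof (rule ccontr)
  assume "\<not> c < f t"
  then have le: "f t \<le> c" by simp
  have cont: "continuous_on S f" for S using d by (meson DERIV_isCont continuous_at_imp_continuous_on)
  obtain e where e: "e > 0" "\<And>h. 0 < h \<Longrightarrow> h < e \<Longrightarrow> f a < f (a + h)"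
    using DERIV_pos_inc_right[OF d pos[OF a]] by blast
  define b where "b = a + min (e / 2) ((t - a) / 2)"
  have b: "a < b" "b < t" "b < a + e" using e(1) at by (auto simp: b_def min_def field_simps)
  have fb: "c < f b" using e(2)[of "b - a"] b a by simp
  define S where "S = {b..t} \<inter> f -` {..c}"
  have "compact S" unfolding S_def
    by (intro compact_Int_closed continuous_closed_vimage) (use d DERIV_isCont in auto)
  moreover have "t \<in> S" using b le by (simp add: S_def)
  ultimately obtain s where s: "s \<in> S" "\<And>y. y \<in> S \<Longrightarrow> s \<le> y" using compact_attains_inf[of S] by blast
  have sb: "b < s" using s(1) fb by (cases "b = s") (auto simp: S_def)
  have before: "c < f y" if "b \<le> y" "y < s" for y
  proof (rule ccontr)
    assume "\<not> c < f y"
    then have "y \<in> S" using that s(1) by (simp add: S_def)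
    then show False using s(2) that by fastforce
  qed
  have "f s = c"
  proof (rule antisym)
    show "f s \<le> c" using s(1) by (simp add: S_def)
    have "(f \<longlongrightarrow> f s) (at_left s)" using d DERIV_isCont isCont_def tendsto_within_subset by blast
    moreover have "eventually (\<lambda>y. c \<le> f y) (at_left s)"
      using eventually_at_left_real[OF sb] by eventually_elim (auto intro: less_imp_le before)
    ultimately show "c \<le> f s" by (rule tendsto_lowerbound) simp
  qed
  then obtain e' where e': "e' > 0" "\<And>h. 0 < h \<Longrightarrow> h < e' \<Longrightarrow> f (s - h) < f s"
    using DERIV_pos_inc_left[OF d pos] by blast
  define h where "h = min (e' / 2) (s - b)"
  have "0 < h" "h < e'" "h \<le> s - b" using e' sb by (auto simp: h_def min_def)
  then show False using e'(2)[of h] before[of "s - h"] \<open>f s = c\<close> by simp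
qed

text \<open>Equal values at a and b force an extremum strictly between them, but near any point
  local injectivity makes a continuous function strictly monotone.\<close>

lemma inj_on_if_locally_inj_on:
  fixes f :: "real \<Rightarrow> real"
  assumes I: "is_interval I" and cont: "continuous_on I f"
    and loc: "\<And>t. t \<in> I \<Longrightarrow> \<exists>d>0. inj_on f (I \<inter> ball t d)"
  shows "inj_on f I"
proof -
  have no_ext: False if ab: "a \<in> I" "b \<in> I" "c \<in> {a<..<b}"
    and ext: "(\<forall>y\<in>{a..b}. f y \<le> f c) \<or> (\<forall>y\<in>{a..b}. f c \<le> f y)" for a b c
  proof -
    have sub: "{a..b} \<subseteq> I" using I ab(1,2) by (meson atLeastAtMost_iff mem_is_interval_1_I subsetI)
    then have "c \<in> I" using ab(3) by auto
    then obtain d where d: "d > 0" "inj_on f (I \<inter> ball c d)" using loc by blast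
    define e where "e = min (d / 2) (min (c - a) (b - c))"
    have e: "0 < e" "e < d" "a \<le> c - e" "c + e \<le> b" using d(1) ab(3) by (auto simp: e_def min_def)
    have s2: "{c - e..c + e} \<subseteq> I \<inter> ball c d" using e sub by (auto simp: dist_real_def)
    have "(f (c - e) < f c \<and> f c < f (c + e)) \<or> (f (c + e) < f c \<and> f c < f (c - e))"
    proof (rule continuous_inj_imp_mono[of "c - e" c "c + e" f])
      show "continuous_on {c - e..c + e} f" using cont s2 continuous_on_subset by blast
      show "inj_on f {c - e..c + e}" using d(2) s2 inj_on_subset by blast
    qed (use e in auto)
    moreover have "c - e \<in> {a..b}" "c + e \<in> {a..b}" using e ab(3) by auto
    ultimately show False using ext by fastforce
  qed
  have neq: "f a \<noteq> f b" if ab: "a \<in> I" "b \<in> I" "a < b" for a b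
  proof
    assume eq: "f a = f b"
    have sub: "{a..b} \<subseteq> I" using I ab(1,2) by (meson atLeastAtMost_iff mem_is_interval_1_I subsetI)
    then have c: "continuous_on {a..b} f" using cont continuous_on_subset by blast
    obtain x where x: "x \<in> {a..b}" "\<forall>y\<in>{a..b}. f y \<le> f x"
      using continuous_attains_sup[OF compact_Icc _ c] ab by fastforce
    obtain z where z: "z \<in> {a..b}" "\<forall>y\<in>{a..b}. f z \<le> f y"
      using continuous_attains_inf[OF compact_Icc _ c] ab by fastforce
    show False
    proof (cases "x \<in> {a<..<b} \<or> z \<in> {a<..<b}")
      case True then show False using no_ext[OF ab(1,2), of x] no_ext[OF ab(1,2), of z] x(2) z(2) by (elim disjE) simp_all
    next
      case False
      then have "x = a \<or> x = b" "z = a \<or> z = b" using x(1) z(1) by auto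
      then have "f x = f a" "f z = f a" using eq by auto
      then have fa: "f y = f a" if "y \<in> {a..b}" for y using bspec[OF x(2) that] bspec[OF z(2) that] by linarith
      have mid: "(a + b) / 2 \<in> {a<..<b}" using ab(3) by simp
      then have "(a + b) / 2 \<in> {a..b}" by simp
      then have "\<forall>y\<in>{a..b}. f y \<le> f ((a + b) / 2)" using fa by (metis order_refl)
      then show False by (rule no_ext[OF ab(1,2) mid disjI1])
    qed
  qed
  show ?thesis by (rule linorder_inj_onI') (rule neq)
qed

text \<open>For z exp (l z) the quantity Re (1 + z l' z) is the derivative of the argument along the
  circle through z. The assumption says that on the nodal set this argument increases, so nodal
  curves cross the circles around 0 transversally.\<close>

locale transversal_root =
  fixes l :: "complex \<Rightarrow> complex" and R :: real and n :: nat
  assumes R: "R > 0" and n: "n \<ge> 1" and l: "l holomorphic_on ball 0 R"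
    and transversal: "\<And>z. z \<in> ball 0 R \<Longrightarrow> z \<noteq> 0 \<Longrightarrow> Re ((z * exp (l z)) ^ n) = 0 \<Longrightarrow> Re (1 + z * deriv l z) > 0"
begin

definition \<phi> :: "complex \<Rightarrow> complex" where "\<phi> z = z * exp (l z)"

lemma deriv_phi: "z \<in> ball 0 R \<Longrightarrow> deriv \<phi> z = exp (l z) * (1 + z * deriv l z)"
proof -
  assume z: "z \<in> ball 0 R"
  have "(l has_field_derivative deriv l z) (at z)" using holomorphic_derivI[OF l _ z] by simp
  then have "(\<phi> has_field_derivative exp (l z) * (1 + z * deriv l z)) (at z)"
    unfolding \<phi>_def by (auto intro!: derivative_eq_intros simp: algebra_simps)
  then show ?thesis by (rule DERIV_imp_deriv)
qed

sublocale nodal_root \<phi> R n "\<lambda>z. Re (\<phi> z ^ n)"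
proof
  show "\<phi> holomorphic_on ball 0 R" unfolding \<phi>_def using l by (intro holomorphic_intros)
  show "deriv \<phi> z \<noteq> 0" if "z \<in> ball 0 R" "Re (\<phi> z ^ n) = 0" for z
  proof (cases "z = 0")
    case False
    then have "Re (1 + z * deriv l z) > 0" using transversal that by (simp add: \<phi>_def)
    then have "1 + z * deriv l z \<noteq> 0" by (metis less_irrefl zero_complex.sel(1))
    then show ?thesis using deriv_phi[OF that(1)] by simp
  qed (use deriv_phi[OF that(1)] in simp)
qed (use R n in \<open>auto simp: \<phi>_def\<close>)

text \<open>\<open>\<Theta>\<close> is a continuous branch of the argument of \<phi> on the circle.
  It grows by exactly 2 pi in a full turn, because l is single valued, and passes each level \<beta>
  + 2 pi m only upwards; hence exactly one point of the circle is sent to the ray.\<close>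

lemma ray_meets_circle_once:
  assumes r: "0 < r" "r < R" and \<beta>: "cos (real n * \<beta>) = 0"
  shows "\<exists>!z. cmod z = r \<and> (\<exists>x>0. \<phi> z = of_real x * cis \<beta>)"
proof -
  define \<Theta> where "\<Theta> = (\<lambda>t. t + Im (l (of_real r * cis t)))"
  define \<Theta>' where "\<Theta>' = (\<lambda>t. 1 + Re (of_real r * cis t * deriv l (of_real r * cis t)))"
  have inb: "of_real r * cis t \<in> ball 0 R" for t using r by (simp add: norm_mult)
  have polar: "\<phi> (of_real r * cis t) = of_real (r * exp (Re (l (of_real r * cis t)))) * cis (\<Theta> t)" for t
    by (simp add: \<phi>_def \<Theta>_def exp_eq_polar[of "l _"] flip: cis_mult exp_of_real)
  have per: "\<Theta> (t + 2 * pi) = \<Theta> t + 2 * pi" for t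
    by (simp add: \<Theta>_def flip: cis_mult)
  have d: "(\<Theta> has_real_derivative \<Theta>' t) (at t)" for t
  proof -
    have 1: "((\<lambda>t. of_real r * cis t) has_vector_derivative of_real r * (\<i> * cis t)) (at t)"
      unfolding has_vector_derivative_def by (auto intro!: derivative_eq_intros simp: scaleR_conv_of_real)
    have 2: "(l has_field_derivative deriv l (of_real r * cis t)) (at (of_real r * cis t))"
      using holomorphic_derivI[OF l _ inb] by simp
    have "((\<lambda>t. l (of_real r * cis t)) has_vector_derivative of_real r * (\<i> * cis t) * deriv l (of_real r * cis t)) (at t)"
      using field_vector_diff_chain_at[OF 1 2] by (simp add: o_def)
    then have "((\<lambda>t. Im (l (of_real r * cis t))) has_vector_derivative Im (of_real r * (\<i> * cis t) * deriv l (of_real r * cis t))) (at t)"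
      by (rule bounded_linear.has_vector_derivative[OF bounded_linear_Im])
    also have "Im (of_real r * (\<i> * cis t) * deriv l (of_real r * cis t)) = \<Theta>' t - 1"
      by (simp add: \<Theta>'_def algebra_simps)
    finally have "((\<lambda>t. Im (l (of_real r * cis t))) has_real_derivative \<Theta>' t - 1) (at t)"
      by (simp add: has_real_derivative_iff_has_vector_derivative)
    from DERIV_add[OF DERIV_ident this] show ?thesis by (simp add: \<Theta>_def)
  qed
  have cosm: "cos (real n * (\<beta> + 2 * pi * of_int m)) = 0" for m :: int
  proof -
    have "real n * (\<beta> + 2 * pi * of_int m) = real n * \<beta> + of_int (int n * m) * (2 * pi)" by (simp add: algebra_simps)
    moreover have "cis (real n * \<beta> + of_int (int n * m) * (2 * pi)) = cis (real n * \<beta>)"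
      by (simp only: cis_mult[symmetric] mult.commute[of "of_int _" "2 * pi"] cis_multiple_2pi[OF Ints_of_int]) simp
    ultimately show ?thesis using \<beta> by (metis cis.sel(1))
  qed
  have pos: "\<Theta>' t > 0" if "\<Theta> t = \<beta> + 2 * pi * of_int m" for t m
  proof -
    define \<rho> where "\<rho> = r * exp (Re (l (of_real r * cis t)))"
    have "\<phi> (of_real r * cis t) ^ n = of_real (\<rho> ^ n) * cis (real n * \<Theta> t)"
      unfolding polar \<rho>_def by (simp add: power_mult_distrib Complex.DeMoivre)
    then have "Re (\<phi> (of_real r * cis t) ^ n) = 0" using cosm[of m] that by simp
    then show ?thesis using transversal[OF inb] r unfolding \<phi>_def \<Theta>'_def by simp
  qed
  have up: "\<beta> + 2 * pi * of_int m < \<Theta> t" if "\<Theta> a = \<beta> + 2 * pi * of_int m" "a < t" for a t m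
    using greater_after_upcrossing[OF d pos that] .
  have ray: "(\<exists>x>0. \<phi> (of_real r * cis t) = of_real x * cis \<beta>) \<longleftrightarrow> (\<exists>m::int. \<Theta> t = \<beta> + 2 * pi * of_int m)" for t
  proof
    assume "\<exists>x>0. \<phi> (of_real r * cis t) = of_real x * cis \<beta>"
    then obtain x where x: "x > 0" "\<phi> (of_real r * cis t) = of_real x * cis \<beta>" by blast
    define \<rho> where "\<rho> = r * exp (Re (l (of_real r * cis t)))"
    have \<rho>: "\<rho> > 0" "of_real \<rho> * cis (\<Theta> t) = of_real x * cis \<beta>" using x polar r by (auto simp: \<rho>_def)
    have "cmod (of_real \<rho> * cis (\<Theta> t)) = cmod (of_real x * cis \<beta>)" using \<rho>(2) by simp
    then have "\<rho> = x" using \<rho>(1) x(1) by (simp add: norm_mult)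
    then have "cis (\<Theta> t) = cis \<beta>" using \<rho> by simp
    then have "exp (\<i> * \<Theta> t) = exp (\<i> * \<beta>)" by (simp add: cis_conv_exp)
    then obtain m :: int where "\<i> * \<Theta> t = \<i> * \<beta> + (of_int (2 * m) * pi) * \<i>" unfolding exp_eq by blast
    then have "Im (\<i> * \<Theta> t) = Im (\<i> * \<beta> + (of_int (2 * m) * pi) * \<i>)" by simp
    then show "\<exists>m::int. \<Theta> t = \<beta> + 2 * pi * of_int m" by (intro exI[of _ m]) simp
  next
    assume "\<exists>m::int. \<Theta> t = \<beta> + 2 * pi * of_int m"
    then obtain m :: int where "\<Theta> t = \<beta> + 2 * pi * of_int m" by blast
    then have "cis (\<Theta> t) = cis \<beta>" by (simp only: cis_mult[symmetric] cis_multiple_2pi[OF Ints_of_int]) simp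
    then show "\<exists>x>0. \<phi> (of_real r * cis t) = of_real x * cis \<beta>" using polar r
      by (intro exI[of _ "r * exp (Re (l (of_real r * cis t)))"]) simp
  qed
  have ex: "\<exists>z. cmod z = r \<and> (\<exists>x>0. \<phi> z = of_real x * cis \<beta>)"
  proof -
    define m where "m = \<lceil>(\<Theta> 0 - \<beta>) / (2 * pi)\<rceil>"
    have "(\<Theta> 0 - \<beta>) / (2 * pi) \<le> of_int m" "of_int m \<le> (\<Theta> 0 - \<beta>) / (2 * pi) + 1" unfolding m_def by linarith+
    then have "\<Theta> 0 \<le> \<beta> + 2 * pi * of_int m" "\<beta> + 2 * pi * of_int m \<le> \<Theta> (2 * pi)"
      using per[of 0] by (simp_all add: field_simps)
    then obtain t where "\<Theta> t = \<beta> + 2 * pi * of_int m"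
      using IVT[of \<Theta> 0 _ "2 * pi"] d DERIV_isCont by (metis pi_ge_zero zero_le_mult_iff zero_le_numeral)
    then show ?thesis using ray[of t] r by (intro exI[of _ "of_real r * cis t"]) (auto simp: norm_mult)
  qed
  moreover have "z = w" if z: "cmod z = r" "\<exists>x>0. \<phi> z = of_real x * cis \<beta>" and w: "cmod w = r" "\<exists>x>0. \<phi> w = of_real x * cis \<beta>" for z w
  proof (rule ccontr)
    assume zw: "z \<noteq> w"
    define t1 where "t1 = Arg z"
    \<comment> \<open>The angle of w is counted from that of z, so t1 < t2 < t1 + 2 pi. Two hits
      would then give integers with m1 < m2 < m1 + 1.\<close>
    define t2 where "t2 = t1 + Arg2pi (w / z)"
    have z0: "z \<noteq> 0" "w \<noteq> 0" using z w r by auto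
    have zt: "z = of_real r * cis t1" using z(1) by (metis rcis_cmod_Arg rcis_def t1_def)
    have wz: "w / z = cis (Arg2pi (w / z))"
      using Arg2pi_eq[of "w / z"] z(1) w(1) r by (simp add: norm_divide cis_conv_exp)
    then have "w = z * cis (Arg2pi (w / z))" using z0 by (metis nonzero_mult_div_cancel_left times_divide_eq_right)
    then have wt: "w = of_real r * cis t2" unfolding t2_def zt by (simp add: cis_mult[symmetric] mult.assoc)
    have "Arg2pi (w / z) \<noteq> 0"
      using wz zw z0 by auto
    then have t12: "t1 < t2" "t2 < t1 + 2 * pi"
      using Arg2pi_ge_0[of "w / z"] Arg2pi_lt_2pi[of "w / z"] by (auto simp: t2_def)
    obtain m1 where m1: "\<Theta> t1 = \<beta> + 2 * pi * of_int m1" using z(2) ray unfolding zt by blast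
    obtain m2 where m2: "\<Theta> t2 = \<beta> + 2 * pi * of_int m2" using w(2) ray unfolding wt by blast
    have "m1 < m2" using up[OF m1 t12(1)] m2 by simp
    moreover have "\<beta> + 2 * pi * of_int m2 < \<beta> + 2 * pi * of_int (m1 + 1)"
      using up[OF m2 t12(2)] per[of t1] m1 by (simp add: algebra_simps)
    then have "m2 < m1 + 1" by simp
    ultimately show False by simp
  qed
  ultimately show ?thesis by blast
qed


text \<open>The sign of r selects the half of the line that the image of a point on the circle of
  radius |r| must meet. The resulting map is continuous because its graph over a compact interval is
  cut out by closed conditions, and the coordinate along the line, being injective in r, can replace
  r as parameter.\<close>

lemma lift_of_line: "\<exists>J s. lift k J s \<and> s ` J = L k"
proof -
  define E where "E = nodal_dir n k"
  define X where "X = (\<lambda>z. Re (\<phi> z / E))"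
  define \<beta> where "\<beta> = (2 * real k + 1) * pi / (2 * real n)"
  have E: "E = cis \<beta>" "- E = cis (\<beta> + pi)" by (simp_all add: E_def nodal_dir_def \<beta>_def cis_mult[symmetric])
  have E0: "E \<noteq> 0" by (simp add: E_def)
  have n\<beta>: "real n * \<beta> = real (Suc (2 * k)) * (pi / 2)" using n by (simp add: \<beta>_def field_simps)
  have "cos (real n * \<beta>) = 0" unfolding n\<beta> by (rule cos_zero_iff[THEN iffD2]) (rule disjI1, rule exI[of _ "Suc (2 * k)"], simp)
  moreover have "cos (real n * (\<beta> + pi)) = cos (real n * \<beta>) * cos (real n * pi) - sin (real n * \<beta>) * sin (real n * pi)"
    by (simp only: distrib_left cos_add)
  ultimately have cos0: "cos (real n * \<beta>) = 0" "cos (real n * (\<beta> + pi)) = 0" by simp_all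
  \<comment> \<open>The weak inequality keeps the condition closed; for r \<noteq> 0 it is strict
    automatically, since \<phi> vanishes only at 0.\<close>
  define P where "P = (\<lambda>r z. cmod z = \<bar>r\<bar> \<and> Im (\<phi> z / E) = 0 \<and> 0 \<le> r * X z)"
  have XE: "\<phi> z = of_real (X z) * E" if "Im (\<phi> z / E) = 0" for z
  proof -
    have "\<phi> z / E = of_real (X z)" using that by (simp add: complex_eq_iff X_def del: Re_divide Im_divide)
    then show ?thesis using E0 by (metis nonzero_divide_eq_eq)
  qed
  have ImE: "Im (\<phi> z / E) = 0" "X z = x" if "\<phi> z = of_real x * E" for z x
    using that E0 by (simp_all add: X_def)
  have ex1: "\<exists>!z. P r z" if r: "\<bar>r\<bar> < R" for r
  proof -
    consider "r = 0" | "0 < r" | "r < 0" by linarith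
    then show ?thesis
    proof cases
      case 1 then show ?thesis by (intro ex1I[of _ 0]) (auto simp: P_def phi0)
    next
      case 2
      have "P r z \<longleftrightarrow> cmod z = r \<and> (\<exists>x>0. \<phi> z = of_real x * cis \<beta>)" for z
      proof
        assume P: "P r z"
        then have "\<phi> z \<noteq> 0" using phinz[of z] 2 r by (auto simp: P_def)
        then have "X z \<noteq> 0" using XE[of z] P by (auto simp: P_def)
        moreover have "0 \<le> X z" using P 2 by (simp add: P_def zero_le_mult_iff)
        ultimately show "cmod z = r \<and> (\<exists>x>0. \<phi> z = of_real x * cis \<beta>)"
          using P XE[of z] 2 by (intro conjI exI[of _ "X z"]) (simp_all add: P_def E)
      next
        assume a: "cmod z = r \<and> (\<exists>x>0. \<phi> z = of_real x * cis \<beta>)"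
        then obtain x where "x > 0" "\<phi> z = of_real x * E" by (auto simp: E)
        then show "P r z" using ImE[of z x] a 2 by (simp add: P_def)
      qed
      then show ?thesis using ray_meets_circle_once[OF 2 _ cos0(1)] r by simp
    next
      case 3
      have "P r z \<longleftrightarrow> cmod z = - r \<and> (\<exists>x>0. \<phi> z = of_real x * cis (\<beta> + pi))" for z
      proof
        assume P: "P r z"
        then have "\<phi> z \<noteq> 0" using phinz[of z] 3 r by (auto simp: P_def)
        then have "X z \<noteq> 0" using XE[of z] P by (auto simp: P_def)
        moreover have "0 \<le> - X z" using P 3 by (simp add: P_def zero_le_mult_iff)
        ultimately show "cmod z = - r \<and> (\<exists>x>0. \<phi> z = of_real x * cis (\<beta> + pi))"
          using P XE[of z] 3 by (intro conjI exI[of _ "- X z"]) (simp_all add: P_def flip: E)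
      next
        assume a: "cmod z = - r \<and> (\<exists>x>0. \<phi> z = of_real x * cis (\<beta> + pi))"
        then obtain x where "x > 0" "\<phi> z = of_real (- x) * E" by (auto simp flip: E)
        then show "P r z" using ImE[of z "- x"] a 3 by (simp add: P_def mult_le_0_iff)
      qed
      then show ?thesis using ray_meets_circle_once[OF _ _ cos0(2), of "- r"] 3 r by simp
    qed
  qed
  define \<zeta> where "\<zeta> = (\<lambda>r. THE z. P r z)"
  have P\<zeta>: "P r (\<zeta> r)" if "\<bar>r\<bar> < R" for r unfolding \<zeta>_def using ex1[OF that] by (rule theI')
  have \<zeta>_eq: "\<zeta> r = z" if "\<bar>r\<bar> < R" "P r z" for r z
    unfolding \<zeta>_def using that by (intro the1_equality ex1)
  define I where "I = {- R<..<R}"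
  have in_ball: "\<zeta> r \<in> ball 0 R" if "r \<in> I" for r using P\<zeta>[of r] that by (auto simp: P_def I_def)
  have on_line: "\<phi> (\<zeta> r) = of_real (X (\<zeta> r)) * E" if "r \<in> I" for r
    using XE P\<zeta>[of r] that by (auto simp: P_def I_def)
  have \<zeta>_L: "\<zeta> r \<in> L k" if "r \<in> I" for r
    using in_ball[OF that] on_line[OF that] nodal_lineI[of _ _ n k] by (auto simp: L_def E_def)
  have image: "\<zeta> ` I = L k"
  proof
    show "L k \<subseteq> \<zeta> ` I"
    proof
      fix z assume z: "z \<in> L k"
      then obtain x where x: "\<phi> z = of_real x * E" "cmod z < R" by (auto simp: L_def nodal_line_def E_def)
      define r where "r = (if x \<ge> 0 then cmod z else - cmod z)"
      have "P r z" using ImE[OF x(1)] by (auto simp: P_def r_def mult_le_0_iff)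
      moreover have "\<bar>r\<bar> < R" using x by (simp add: r_def)
      ultimately show "z \<in> \<zeta> ` I" using \<zeta>_eq by (intro image_eqI[of _ _ r]) (auto simp: I_def)
    qed
  qed (use \<zeta>_L in blast)
  have cont_phi: "continuous_on (ball 0 R) \<phi>" using hol by (rule holomorphic_on_imp_continuous_on)
  have cont_on: "continuous_on {- \<rho>..\<rho>} \<zeta>" if \<rho>: "\<rho> < R" for \<rho>
  proof (rule continuous_from_closed_graph)
    show "compact (cball (0::complex) \<rho>)" by simp
    show "\<zeta> \<in> {- \<rho>..\<rho>} \<rightarrow> cball 0 \<rho>" using P\<zeta> \<rho> by (auto simp: P_def abs_le_iff abs_less_iff)
    have sub: "cball (0::complex) \<rho> \<subseteq> ball 0 R" using \<rho> by auto
    have c1: "continuous_on ({- \<rho>..\<rho>} \<times> cball 0 \<rho>) (\<lambda>p. \<phi> (snd p))"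
      by (rule continuous_on_compose2[OF continuous_on_subset[OF cont_phi sub]]) (auto intro: continuous_intros)
    define G where "G = (\<lambda>p. (cmod (snd p) - \<bar>fst p\<bar>, Im (\<phi> (snd p) / E), fst p * X (snd p)))"
    have "continuous_on ({- \<rho>..\<rho>} \<times> cball 0 \<rho>) G"
      unfolding G_def X_def using E0 by (intro continuous_intros c1) auto
    moreover have "closed ({0::real} \<times> {0::real} \<times> {0::real..})" by (intro closed_Times) auto
    ultimately have clo: "closedin (top_of_set ({- \<rho>..\<rho>} \<times> cball 0 \<rho>)) (({- \<rho>..\<rho>} \<times> cball 0 \<rho>) \<inter> G -` ({0::real} \<times> {0::real} \<times> {0::real..}))"
      by (rule continuous_closedin_preimage)
    have eq: "({- \<rho>..\<rho>} \<times> cball 0 \<rho>) \<inter> G -` ({0::real} \<times> {0::real} \<times> {0::real..}) = (\<lambda>x. (x, \<zeta> x)) ` {- \<rho>..\<rho>}"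
    proof (intro set_eqI iffI)
      fix p assume p: "p \<in> ({- \<rho>..\<rho>} \<times> cball 0 \<rho>) \<inter> G -` ({0::real} \<times> {0::real} \<times> {0::real..})"
      then have "P (fst p) (snd p)" "fst p \<in> {- \<rho>..\<rho>}" by (auto simp: G_def P_def simp del: Re_divide Im_divide)
      then have "\<zeta> (fst p) = snd p" by (intro \<zeta>_eq) (use \<rho> in auto)
      then have "p = (fst p, \<zeta> (fst p))" by simp
      then show "p \<in> (\<lambda>x. (x, \<zeta> x)) ` {- \<rho>..\<rho>}" using \<open>fst p \<in> {- \<rho>..\<rho>}\<close> by (rule image_eqI)
    next
      fix p assume "p \<in> (\<lambda>x. (x, \<zeta> x)) ` {- \<rho>..\<rho>}"
      then obtain r where r: "r \<in> {- \<rho>..\<rho>}" "p = (r, \<zeta> r)" by blast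
      then have "P r (\<zeta> r)" using P\<zeta>[of r] \<rho> by auto
      then show "p \<in> ({- \<rho>..\<rho>} \<times> cball 0 \<rho>) \<inter> G -` ({0::real} \<times> {0::real} \<times> {0::real..})"
        using r \<rho> by (auto simp: G_def P_def simp del: Re_divide Im_divide)
    qed
    show "closed ((\<lambda>x. (x, \<zeta> x)) ` {- \<rho>..\<rho>})"
      using clo unfolding eq by (rule closedin_closed_trans) (intro closed_Times closed_atLeastAtMost closed_cball)
  qed
  have isCont: "isCont \<zeta> r" if "r \<in> I" for r
  proof -
    define \<rho> where "\<rho> = (\<bar>r\<bar> + R) / 2"
    have "\<bar>r\<bar> < R" using that by (auto simp: I_def)
    then have "\<rho> < R" "\<bar>r\<bar> < \<rho>" by (simp_all add: \<rho>_def)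
    then have "\<rho> < R" "r \<in> {- \<rho><..<\<rho>}" by auto
    then have "continuous_on {- \<rho><..<\<rho>} \<zeta>"
      by (intro continuous_on_subset[OF cont_on[of \<rho>]] greaterThanLessThan_subseteq_atLeastAtMost_iff[THEN iffD2]) simp_all
    then show ?thesis using \<open>r \<in> {- \<rho><..<\<rho>}\<close> by (simp add: continuous_on_eq_continuous_at)
  qed
  define x where "x = (\<lambda>r. X (\<zeta> r))"
  have cont\<zeta>: "continuous_on I \<zeta>" using isCont continuous_at_imp_continuous_on by blast
  have contx: "continuous_on I x"
  proof -
    have "continuous_on I (\<lambda>r. \<phi> (\<zeta> r))"
      by (rule continuous_on_compose2[OF cont_phi cont\<zeta>]) (use in_ball in blast)
    then show ?thesis unfolding x_def X_def using E0 by (intro continuous_intros) auto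
  qed
  \<comment> \<open>Near a given point, equal coordinates give equal points by local injectivity of
    \<phi>, and the modulus of the point with the sign of its coordinate gives back the signed
    radius.\<close>
  have inj: "inj_on x I"
  proof (rule inj_on_if_locally_inj_on[OF _ contx])
    show "is_interval I" by (simp add: I_def is_interval_1)
    fix t assume t: "t \<in> I"
    then have "\<zeta> t \<in> N" using \<zeta>_L L_subset_N by blast
    then obtain r g where r: "r > 0" "inj_on \<phi> (ball (\<zeta> t) r)"
      using local_inverse[OF \<open>\<zeta> t \<in> N\<close>] by (elim exE conjE) (rule that)
    obtain d where d: "d > 0" "\<And>s. dist s t < d \<Longrightarrow> dist (\<zeta> s) (\<zeta> t) < r"
      using isCont[OF t] r(1) unfolding continuous_at_eps_delta by blast
    have "inj_on x (I \<inter> ball t d)"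
    proof (rule inj_onI)
      fix a b assume a: "a \<in> I \<inter> ball t d" and b: "b \<in> I \<inter> ball t d" and eq: "x a = x b"
      have "\<zeta> a \<in> ball (\<zeta> t) r" "\<zeta> b \<in> ball (\<zeta> t) r" using d(2)[of a] d(2)[of b] a b by (auto simp: dist_commute)
      moreover have "\<phi> (\<zeta> a) = \<phi> (\<zeta> b)" using on_line[of a] on_line[of b] a b eq by (simp add: x_def)
      ultimately have z: "\<zeta> a = \<zeta> b" using r(2) by (meson inj_onD)
      have P: "P a (\<zeta> a)" "P b (\<zeta> a)" using P\<zeta>[of a] P\<zeta>[of b] a b z by (auto simp: I_def)
      show "a = b"
      proof (cases "a = 0")
        case False
        then have "\<zeta> a \<noteq> 0" using P(1) by (auto simp: P_def)
        then have "\<phi> (\<zeta> a) \<noteq> 0" using phinz in_ball a by blast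
        then have "X (\<zeta> a) \<noteq> 0" using on_line[of a] a by auto
        then show ?thesis using P by (auto simp: P_def abs_if zero_le_mult_iff split: if_splits)
      qed (use P in \<open>auto simp: P_def\<close>)
    qed
    then show "\<exists>d>0. inj_on x (I \<inter> ball t d)" using d(1) by blast
  qed
  have "open I" by (simp add: I_def)
  obtain g where g: "homeomorphism I (x ` I) x g"
    by (rule invariance_of_domain_homeomorphism[OF \<open>open I\<close> contx _ inj]) (simp, rule that)
  have op: "open (x ` I)" by (rule invariance_of_domain[OF contx \<open>open I\<close> inj])
  have gI: "g y \<in> I" "x (g y) = y" if "y \<in> x ` I" for y using g that unfolding homeomorphism_def by auto
  have "lift k (x ` I) (\<zeta> \<circ> g)"
    unfolding lift_def
  proof (intro conjI ballI)
    show "x ` I \<noteq> {}" using R by (auto simp: I_def)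
    show "open (x ` I)" by (rule op)
    show "connected (x ` I)" by (rule connected_continuous_image[OF contx]) (simp add: I_def)
    show "continuous_on (x ` I) (\<zeta> \<circ> g)"
      using g cont\<zeta> unfolding homeomorphism_def by (intro continuous_on_compose) auto
    fix y assume y: "y \<in> x ` I"
    show "(\<zeta> \<circ> g) y \<in> ball 0 R" using in_ball gI(1)[OF y] by simp
    show "\<phi> ((\<zeta> \<circ> g) y) = complex_of_real y * nodal_dir n k"
      using on_line[OF gI(1)[OF y]] gI(2)[OF y] by (simp add: x_def E_def)
  qed
  moreover have "g ` x ` I = I" using g unfolding homeomorphism_def by simp
  then have "(\<zeta> \<circ> g) ` (x ` I) = L k" using image by (simp only: image_comp[symmetric])
  ultimately show ?thesis by blast
qed

end

subsection \<open>Real parts of holomorphic functions\<close>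

lemma harmonic_on_Re:
  assumes F: "F holomorphic_on D" and D: "open D"
  shows "harmonic_on (\<lambda>z. Re (F z)) D"
proof -
  have F': "deriv F holomorphic_on D" using F D by (rule holomorphic_deriv)
  have F'': "deriv (deriv F) holomorphic_on D" using F' D by (rule holomorphic_deriv)
  have cont: "continuous_on D (deriv (deriv F))" using F'' by (rule holomorphic_on_imp_continuous_on)
  have d: "(G has_derivative (\<lambda>h. deriv G z * h)) (at z)" if "G holomorphic_on D" "z \<in> D" for G z
    using holomorphic_derivI[OF that(1) D that(2)] by (simp add: has_field_derivative_def)
  have Re: "((\<lambda>z. Re (G z)) has_derivative (\<lambda>h. Re (deriv G z) * Re h + - Im (deriv G z) * Im h)) (at z)"
    if "G holomorphic_on D" "z \<in> D" for G z
    using bounded_linear.has_derivative[OF bounded_linear_Re d[OF that]] by simp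
  have Im: "((\<lambda>z. - Im (G z)) has_derivative (\<lambda>h. - Im (deriv G z) * Re h + - Re (deriv G z) * Im h)) (at z)"
    if "G holomorphic_on D" "z \<in> D" for G z
    using has_derivative_minus[OF bounded_linear.has_derivative[OF bounded_linear_Im d[OF that]]] by (simp add: algebra_simps)
  show ?thesis unfolding harmonic_on_def
    apply (rule conjI[OF D], rule exI[of _ "\<lambda>z. Re (deriv F z)"], rule exI[of _ "\<lambda>z. - Im (deriv F z)"],
        rule exI[of _ "\<lambda>z. Re (deriv (deriv F) z)"], rule exI[of _ "\<lambda>z. - Im (deriv (deriv F) z)"],
        rule exI[of _ "\<lambda>z. - Im (deriv (deriv F) z)"], rule exI[of _ "\<lambda>z. - Re (deriv (deriv F) z)"])
    apply (safe intro!: Re[OF F] Re[OF F'] Im[OF F'])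
        apply (intro continuous_intros cont)+
    apply simp
    done
qed

text \<open>Cauchy's formula for F w / (R^2 - cnj z * w), which is holomorphic on the closed disc.
  On the circle R^2 = w * cnj w turns the Cauchy kernel into 1 / |w - z|^2, and at w = z the
  denominator is R^2 - |z|^2.\<close>

lemma Poisson_integral_Re:
  assumes F: "F holomorphic_on ball 0 R'" and R: "0 < R" "R < R'"
  shows "L1_circle R (\<lambda>z. Re (F z))"
    "z \<in> ball 0 R \<Longrightarrow> Poisson_integral R (\<lambda>z. Re (F z)) z = Re (F z)"
proof -
  have inb: "of_real R * cis t \<in> ball 0 R'" for t using R by (simp add: norm_mult)
  have contF: "continuous_on (ball 0 R') F" using F by (rule holomorphic_on_imp_continuous_on)
  have contFt: "continuous_on {0..2 * pi} (\<lambda>t. F (of_real R * cis t))"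
    by (rule continuous_on_compose2[OF contF]) (use inb in \<open>auto intro!: continuous_intros\<close>)
  show "L1_circle R (\<lambda>z. Re (F z))"
    unfolding L1_circle_def by (intro absolutely_integrable_continuous_real continuous_intros contFt)
  assume z: "z \<in> ball 0 R"
  define c where "c = R\<^sup>2 - (cmod z)\<^sup>2"
  have c: "c > 0" using z R by (simp add: c_def power_strict_mono)
  define f where "f = (\<lambda>w. F w / (of_real (R\<^sup>2) - cnj z * w))"
  have nz: "of_real (R\<^sup>2) - cnj z * w \<noteq> 0" if "w \<in> cball 0 R" for w
  proof
    assume "of_real (R\<^sup>2) - cnj z * w = 0"
    then have "cmod (of_real (R\<^sup>2)) = cmod (cnj z * w)" by simp
    also have "\<dots> = cmod z * cmod w" by (simp add: norm_mult)
    also have "\<dots> \<le> cmod z * R" using that by (intro mult_left_mono) auto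
    also have "\<dots> < R * R" using z R by (intro mult_strict_right_mono) auto
    finally show False by (simp add: power2_eq_square norm_mult)
  qed
  have sub: "cball (0::complex) R \<subseteq> ball 0 R'" "ball (0::complex) R \<subseteq> cball 0 R" using R by auto
  have f: "f holomorphic_on cball 0 R"
    unfolding f_def using nz holomorphic_on_subset[OF F sub(1)] by (intro holomorphic_intros) auto
  have "((\<lambda>u. f u / (u - z)) has_contour_integral 2 * of_real pi * \<i> * f z) (circlepath 0 R)"
    by (rule Cauchy_integral_circlepath[OF holomorphic_on_imp_continuous_on[OF f] holomorphic_on_subset[OF f sub(2)]]) (use z in simp)
  then have "((\<lambda>t. f (0 + R * cis t) / (0 + R * cis t - z) * R * \<i> * cis t) has_integral 2 * of_real pi * \<i> * f z) {0..2 * pi}"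
    unfolding circlepath_def by (subst (asm) has_contour_integral_part_circlepath_iff) auto
  then have "((\<lambda>t. f (R * cis t) / (R * cis t - z) * R * \<i> * cis t * (- \<i>)) has_integral 2 * of_real pi * \<i> * f z * (- \<i>)) {0..2 * pi}"
    by (intro has_integral_mult_left) simp
  also have "(\<lambda>t. f (R * cis t) / (R * cis t - z) * R * \<i> * cis t * (- \<i>)) = (\<lambda>t. F (R * cis t) / of_real ((cmod (R * cis t - z))\<^sup>2))"
  proof
    fix t
    define w where "w = of_real R * cis t"
    have w: "cmod w = R" using R by (simp add: w_def norm_mult)
    then have ww: "of_real (R\<^sup>2) = w * cnj w" by (simp only: complex_norm_square[symmetric] w)
    have w0: "w \<noteq> 0" "w - z \<noteq> 0" using w z R by auto
    then have "cnj w - cnj z \<noteq> 0" by (metis complex_cnj_cancel_iff complex_cnj_diff complex_cnj_zero)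
    have "of_real (R\<^sup>2) - cnj z * w = w * (cnj w - cnj z)" unfolding ww by (simp add: algebra_simps)
    then have "f w / (w - z) * w = F w / ((w - z) * cnj (w - z))"
      using w0 \<open>cnj w - cnj z \<noteq> 0\<close> by (simp add: f_def)
    also have "(w - z) * cnj (w - z) = of_real ((cmod (w - z))\<^sup>2)" by (simp only: complex_norm_square)
    finally show "f (R * cis t) / (R * cis t - z) * R * \<i> * cis t * (- \<i>) = F (R * cis t) / of_real ((cmod (R * cis t - z))\<^sup>2)"
      by (simp add: w_def mult_ac)
  qed
  also have "2 * of_real pi * \<i> * f z * (- \<i>) = of_real (2 * pi / c) * F z"
  proof -
    have e: "of_real (R\<^sup>2) - cnj z * z = of_real c"
      unfolding c_def of_real_diff complex_norm_square by (simp add: mult.commute)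
    show ?thesis unfolding f_def e using c by (simp add: mult_ac)
  qed
  finally have "((\<lambda>t. F (R * cis t) / of_real ((cmod (R * cis t - z))\<^sup>2)) has_integral of_real (2 * pi / c) * F z) {0..2 * pi}" .
  from has_integral_mult_right[OF has_integral_linear[OF this bounded_linear_Re], of c]
  have I: "((\<lambda>t. c / (cmod (R * cis t - z))\<^sup>2 * Re (F (R * cis t))) has_integral 2 * pi * Re (F z)) {0..2 * pi}"
    using c by (simp add: o_def Re_divide_of_real del: of_real_power)
  have "set_integrable lebesgue {0..2 * pi} (\<lambda>t. c / (cmod (R * cis t - z))\<^sup>2 * Re (F (R * cis t)))"
  proof (intro absolutely_integrable_continuous_real continuous_intros contFt ballI)
    fix t
    have "cmod (of_real R * cis t) \<noteq> cmod z" using z R by (simp add: norm_mult)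
    then show "(cmod (of_real R * cis t - z))\<^sup>2 \<noteq> 0" by auto
  qed
  from set_lebesgue_integral_eq_integral(2)[OF this]
  have "set_lebesgue_integral lebesgue {0..2 * pi} (\<lambda>t. c / (cmod (R * cis t - z))\<^sup>2 * Re (F (R * cis t))) = 2 * pi * Re (F z)"
    using integral_unique[OF I] by simp
  then show "Poisson_integral R (\<lambda>z. Re (F z)) z = Re (F z)"
    by (simp add: Poisson_integral_def c_def)
qed

subsection \<open>The extremal functions\<close>

text \<open>The factor w^n is left out, so the value at 0 is nonzero. On the unit circle (1 + w) /
  (1 - w) is imaginary, and so is w^n times this function for real \<tau>; the real part thus
  vanishes there except at the pole 1.\<close>

definition extremal :: "nat \<Rightarrow> real \<Rightarrow> complex \<Rightarrow> complex" where
  "extremal n \<tau> w = (1 + w + \<i> * \<tau> * (1 - w)) / (1 - w) ^ (2 * n + 1)"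

lemma extremal_numerator:
  assumes "w \<noteq> 1"
  shows "1 + w + \<i> * \<tau> * (1 - w) = (1 - w) * ((1 + w) / (1 - w) + \<i> * \<tau>)"
  using assms by (simp add: field_simps)

lemma Re_cayley_pos: "cmod w < 1 \<Longrightarrow> Re ((1 + w) / (1 - w)) > 0"
proof -
  assume w: "cmod w < 1"
  then have "w \<noteq> 1" by auto
  moreover have "(cmod w)\<^sup>2 < 1" using w by (simp add: power_less_one_iff abs_square_less_1)
  ultimately show ?thesis by (simp add: Re_herglotz)
qed

lemma extremal_numerator_nz: "cmod w < 1 \<Longrightarrow> 1 + w + \<i> * of_real \<tau> * (1 - w) \<noteq> 0"
proof -
  assume w: "cmod w < 1"
  then have w1: "w \<noteq> 1" by auto
  have "Re ((1 + w) / (1 - w) + \<i> * of_real \<tau>) > 0" using Re_cayley_pos[OF w] by simp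
  then have "(1 + w) / (1 - w) + \<i> * of_real \<tau> \<noteq> 0" by (metis less_irrefl zero_complex.sel(1))
  then show ?thesis unfolding extremal_numerator[OF w1] using w1 by simp
qed

lemma extremal_nz: "cmod w < 1 \<Longrightarrow> extremal n \<tau> w \<noteq> 0"
  using extremal_numerator_nz[of w \<tau>] by (auto simp: extremal_def)

lemma extremal_holomorphic: "extremal n \<tau> holomorphic_on ball 0 1"
  unfolding extremal_def by (intro holomorphic_intros) auto

lemma extremal_has_derivative:
  assumes "w \<noteq> 1"
  shows "(extremal n \<tau> has_field_derivative
    ((1 - \<i> * \<tau>) * (1 - w) + of_nat (2 * n + 1) * (1 + w + \<i> * \<tau> * (1 - w))) / (1 - w) ^ (2 * n + 2)) (at w)"
proof -
  define A where "A = (\<lambda>w. 1 + w + \<i> * \<tau> * (1 - w))"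
  have A: "(A has_field_derivative 1 - \<i> * \<tau>) (at w)"
    unfolding A_def by (auto intro!: derivative_eq_intros)
  have B: "((\<lambda>w. (1 - w) ^ (2 * n + 1)) has_field_derivative - (of_nat (2 * n + 1) * (1 - w) ^ (2 * n))) (at w)"
  proof -
    have "((\<lambda>w. 1 - w) has_field_derivative - 1) (at w)" by (auto intro!: derivative_eq_intros)
    from DERIV_power[OF this, of "2 * n + 1"] show ?thesis by simp
  qed
  have p: "(1 - w) ^ (2 * n + 1) \<noteq> 0" using assms by simp
  have "((\<lambda>w. A w / (1 - w) ^ (2 * n + 1)) has_field_derivative
    ((1 - \<i> * \<tau>) * (1 - w) ^ (2 * n + 1) - A w * - (of_nat (2 * n + 1) * (1 - w) ^ (2 * n))) / ((1 - w) ^ (2 * n + 1) * (1 - w) ^ (2 * n + 1))) (at w)"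
    by (rule DERIV_divide[OF A B p])
  moreover have "((1 - \<i> * \<tau>) * (1 - w) ^ (2 * n + 1) - A w * - (of_nat (2 * n + 1) * (1 - w) ^ (2 * n))) / ((1 - w) ^ (2 * n + 1) * (1 - w) ^ (2 * n + 1))
    = ((1 - \<i> * \<tau>) * (1 - w) + of_nat (2 * n + 1) * A w) / (1 - w) ^ (2 * n + 2)"
  proof -
    define q where "q = 1 - w"
    define p where "p = q ^ (2 * n)"
    have q: "q \<noteq> 0" "p \<noteq> 0" using assms by (simp_all add: q_def p_def)
    have "q ^ (2 * n + 1) = q * p" "q ^ (2 * n + 2) = q * q * p" by (simp_all add: p_def)
    moreover have "(a * (q * p) - b * - (c * p)) / (q * p * (q * p)) = (a * q + c * b) / (q * q * p)" for a b c :: complex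
      using q by (simp add: field_simps)
    ultimately show ?thesis by (simp only: q_def[symmetric] p_def[symmetric])
  qed
  ultimately show ?thesis unfolding A_def extremal_def[abs_def] by simp
qed

text \<open>With \<open>\<omega> = (1 + w) / (1 - w)\<close> one has \<open>w\<^sup>n extremal n \<tau> w = ((\<omega>\<^sup>2 - 1) / 4)\<^sup>n (\<omega> + \<i>\<tau>)\<close>, and the
  real part in question has the sign of \<open>(2 n + 1) \<bar>\<omega> + \<i>\<tau>\<bar>\<^sup>2 - (1 + \<tau>\<^sup>2)\<close>; where the latter is not
  positive, the function has no zero of its real part.\<close>

lemma extremal_transversal:
  assumes n: "n \<ge> 1" and a: "\<tau>\<^sup>2 = 0 \<or> (n = 2 \<or> n = 4 \<or> n \<ge> 6) \<and> \<tau>\<^sup>2 \<le> 3 / (real n + 1)\<^sup>2" and \<tau>: "\<tau> \<ge> 0"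
    and w: "cmod w < 1" and zero: "Re (w ^ n * extremal n \<tau> w) = 0"
  shows "Re (of_nat n + w * (deriv (extremal n \<tau>) w / extremal n \<tau> w)) > 0"
proof -
  define A where "A = 1 + w + \<i> * \<tau> * (1 - w)"
  define \<omega> where "\<omega> = (1 + w) / (1 - w)"
  have w1: "w \<noteq> 1" "1 - w \<noteq> 0" using w by auto
  have A0: "A \<noteq> 0" unfolding A_def using extremal_numerator_nz[OF w] .
  have A\<omega>: "A = (1 - w) * (\<omega> + \<i> * \<tau>)" unfolding A_def \<omega>_def using extremal_numerator[OF w1(1)] .
  have \<omega>: "Re \<omega> > 0" unfolding \<omega>_def using Re_cayley_pos[OF w] .
  have cw: "1 - (cmod w)\<^sup>2 > 0" using w by (simp add: abs_square_less_1)
  have "(2 * real n + 1) * (cmod (\<omega> + \<i> * \<tau>))\<^sup>2 > 1 + \<tau>\<^sup>2"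
  proof (rule ccontr)
    assume "\<not> (2 * real n + 1) * (cmod (\<omega> + \<i> * \<tau>))\<^sup>2 > 1 + \<tau>\<^sup>2"
    then have "Re ((1 - \<omega>\<^sup>2) ^ n * (\<omega> + \<i> * \<tau>)) > 0" by (intro Re_extremal_pos[OF n a \<tau> \<omega>]) simp
    moreover have "w ^ n * extremal n \<tau> w = of_real ((- 1 / 4) ^ n) * ((1 - \<omega>\<^sup>2) ^ n * (\<omega> + \<i> * \<tau>))"
    proof -
      have "1 - \<omega>\<^sup>2 = ((1 - w)\<^sup>2 - (1 + w)\<^sup>2) / (1 - w)\<^sup>2"
        using w1 by (simp add: \<omega>_def power_divide diff_divide_distrib)
      also have "(1 - w)\<^sup>2 - (1 + w)\<^sup>2 = - 4 * w" by (simp add: power2_eq_square algebra_simps)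
      finally have 1: "of_real (- 1 / 4) * (1 - \<omega>\<^sup>2) = w / (1 - w)\<^sup>2" by simp
      have "extremal n \<tau> w = (\<omega> + \<i> * \<tau>) / ((1 - w)\<^sup>2) ^ n"
        unfolding extremal_def A_def[symmetric] A\<omega> using w1 by (simp add: power_mult[symmetric])
      then have "w ^ n * extremal n \<tau> w = (w / (1 - w)\<^sup>2) ^ n * (\<omega> + \<i> * \<tau>)"
        by (simp add: power_divide)
      then show ?thesis unfolding 1[symmetric] power_mult_distrib of_real_power by (simp only: mult.assoc)
    qed
    moreover have "Re (of_real c * z) = c * Re z" for c z by simp
    ultimately show False using zero by simp
  qed
  then have "(2 * real n + 1) * (cmod (\<omega> + \<i> * \<tau>))\<^sup>2 * (cmod (1 - w))\<^sup>2 > (1 + \<tau>\<^sup>2) * (cmod (1 - w))\<^sup>2"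
    using w1 by (intro mult_strict_right_mono) auto
  then have "(2 * real n + 1) * (cmod A)\<^sup>2 > (1 + \<tau>\<^sup>2) * (cmod (1 - w))\<^sup>2"
    by (simp add: A\<omega> norm_mult power_mult_distrib mult_ac)
  then have pos: "(2 * real n + 1) / (cmod (1 - w))\<^sup>2 - (1 + \<tau>\<^sup>2) / (cmod A)\<^sup>2 > 0"
    using w1 A0 by (simp add: field_simps)
  have deriv: "deriv (extremal n \<tau>) w / extremal n \<tau> w = (1 - \<i> * \<tau>) / A + of_nat (2 * n + 1) / (1 - w)"
  proof -
    define p where "p = (1 - w) ^ (2 * n + 1)"
    have p: "p \<noteq> 0" using w1 by (simp add: p_def)
    have "deriv (extremal n \<tau>) w = ((1 - \<i> * \<tau>) * (1 - w) + of_nat (2 * n + 1) * A) / ((1 - w) * p)"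
      using DERIV_imp_deriv[OF extremal_has_derivative[OF w1(1), of n \<tau>]] by (simp add: A_def p_def)
    moreover have "extremal n \<tau> w = A / p" by (simp add: extremal_def A_def p_def)
    moreover have "((b * q + c * A) / (q * p)) / (A / p) = b / A + c / q" if "q \<noteq> 0" for b c q
      using that p A0 by (simp add: field_simps)
    ultimately show ?thesis using w1 by simp
  qed
  \<comment> \<open>The two parts of the logarithmic derivative are brought into forms with explicit
    real parts; the constants 1 / 2 that split off cancel the summand n.\<close>
  have 1: "w * (1 / (1 - w)) = \<omega> / 2 - 1 / 2" using w1 by (simp add: \<omega>_def field_simps)
  have 2: "w * ((1 - \<i> * \<tau>) / A) = 1 / 2 - ((1 + \<i> * \<tau>) - w * (1 - \<i> * \<tau>)) / (2 * A)"
    using A0 by (simp add: divide_simps) (simp add: A_def algebra_simps)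
  have "of_nat n + w * (deriv (extremal n \<tau>) w / extremal n \<tau> w)
    = of_nat n + w * ((1 - \<i> * \<tau>) / A) + of_nat (2 * n + 1) * (w * (1 / (1 - w)))"
  proof -
    have "N + w * (X + m / q) = N + w * X + m * (w * (1 / q))" for N X m q :: complex by (simp add: algebra_simps)
    then show ?thesis unfolding deriv .
  qed
  also have "\<dots> = of_real ((2 * real n + 1) / 2) * \<omega> - (1 / 2) * (((1 + \<i> * \<tau>) - w * (1 - \<i> * \<tau>)) / A)"
    unfolding 1 2 by (simp add: field_simps)
  finally have eq: "of_nat n + w * (deriv (extremal n \<tau>) w / extremal n \<tau> w)
    = of_real ((2 * real n + 1) / 2) * \<omega> - of_real (1 / 2) * (((1 + \<i> * \<tau>) - w * (1 - \<i> * \<tau>)) / A)" by simp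
  have "Re (((1 + \<i> * \<tau>) - w * (1 - \<i> * \<tau>)) / A) = (1 + \<tau>\<^sup>2) * (1 - (cmod w)\<^sup>2) / (cmod A)\<^sup>2"
  proof -
    have "Re (((1 + \<i> * \<tau>) - w * (1 - \<i> * \<tau>)) * cnj A) = (1 + \<tau>\<^sup>2) * (1 - (cmod w)\<^sup>2)"
      by (simp add: A_def cmod_power2) (simp add: power2_eq_square algebra_simps)
    then show ?thesis unfolding complex_div_cnj[of _ A] Re_divide_of_real by simp
  qed
  moreover have "Re \<omega> = (1 - (cmod w)\<^sup>2) / (cmod (1 - w))\<^sup>2" unfolding \<omega>_def using Re_herglotz[OF w1(1)] .
  moreover have "Re (of_real c * z) = c * Re z" for c z by simp
  ultimately have Re_eq: "Re (of_nat n + w * (deriv (extremal n \<tau>) w / extremal n \<tau> w))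
    = (1 - (cmod w)\<^sup>2) / 2 * ((2 * real n + 1) / (cmod (1 - w))\<^sup>2 - (1 + \<tau>\<^sup>2) / (cmod A)\<^sup>2)"
    unfolding eq minus_complex.sel by (simp only:) (simp add: algebra_simps add_divide_distrib diff_divide_distrib)
  show ?thesis unfolding Re_eq using cw pos by (intro mult_pos_pos) auto
qed

text \<open>Dilation by c = \<rho> / r < 1 / r makes the function holomorphic beyond the closed disc
  of radius r and multiplies the curvature by c. The direction e is any solution of the tangent
  equation at 0; it selects the nodal curve.\<close>

lemma extremal_curvature:
  assumes n: "n \<ge> 1" and a: "\<tau>\<^sup>2 = 0 \<or> (n = 2 \<or> n = 4 \<or> n \<ge> 6) \<and> \<tau>\<^sup>2 \<le> 3 / (real n + 1)\<^sup>2" and \<tau>: "\<tau> \<ge> 0"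
    and r: "r > 0" and \<rho>: "0 < \<rho>" "\<rho> < 1" and e: "cmod e = 1" "Re ((1 + \<i> * \<tau>) * e ^ n) = 0"
  obtains u C I \<gamma> t where "admissible n r u" "nodal_curve u (ball 0 r) C" "parametrizes I \<gamma> C" "t \<in> I" "\<gamma> t = 0"
    "\<bar>curvature \<gamma> t\<bar> = \<rho> / r * \<bar>2 * Re ((2 + 2 * of_nat n * (1 + \<i> * \<tau>)) * e ^ (n + 1)) / (real n * Im ((1 + \<i> * \<tau>) * e ^ n))\<bar>"
proof -
  define c where "c = \<rho> / r"
  have c: "c > 0" "c * r < 1" using r \<rho> by (auto simp: c_def)
  define H where "H = (\<lambda>z. extremal n \<tau> (of_real c * z))"
  have cz: "of_real c * z \<in> ball 0 1" if "z \<in> ball 0 (1 / c)" for z :: complex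
    using that c by (simp add: norm_mult field_simps)
  have rc: "r < 1 / c" using c by (simp add: field_simps)
  then have sub: "ball (0::complex) r \<subseteq> ball 0 (1 / c)" by auto
  have Hd: "(H has_field_derivative of_real c * deriv (extremal n \<tau>) (of_real c * z)) (at z)" if "z \<in> ball 0 (1 / c)" for z
  proof -
    have "(extremal n \<tau> has_field_derivative deriv (extremal n \<tau>) (of_real c * z)) (at (of_real c * z))"
      using holomorphic_derivI[OF extremal_holomorphic open_ball cz[OF that]] by simp
    then show ?thesis unfolding H_def mult.commute[of "of_real c" "deriv _ _"]
      by (rule DERIV_chain2) (auto intro!: derivative_eq_intros)
  qed
  have H: "H holomorphic_on ball 0 (1 / c)"
    unfolding holomorphic_on_open[OF open_ball] using Hd by blast
  have Hr: "H holomorphic_on ball 0 r" using H sub by (rule holomorphic_on_subset)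
  have Hnz: "H z \<noteq> 0" if "z \<in> ball 0 r" for z
    using extremal_nz[of "of_real c * z" n \<tau>] cz[of z] sub that unfolding H_def by auto
  obtain g where g: "g holomorphic_on ball 0 r" "\<And>z. z \<in> ball 0 r \<Longrightarrow> H z = exp (g z)"
    using contractible_imp_holomorphic_log[OF Hr _ Hnz] convex_imp_contractible[OF convex_ball] by blast
  define l where "l = (\<lambda>z. g z / of_nat n)"
  have n0: "(of_nat n :: complex) \<noteq> 0" using n by simp
  have power: "(z * exp (l z)) ^ n = z ^ n * H z" if "z \<in> ball 0 r" for z
    using n0 g(2)[OF that] by (simp add: l_def power_mult_distrib exp_of_nat_mult[symmetric])
  have l_deriv: "of_nat n * deriv l z = of_real c * deriv (extremal n \<tau>) (of_real c * z) / H z" if z: "z \<in> ball 0 r" for z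
  proof -
    have gd: "(g has_field_derivative deriv g z) (at z)" using holomorphic_derivI[OF g(1) open_ball z] by simp
    have "(l has_field_derivative deriv g z / of_nat n) (at z)" unfolding l_def by (rule DERIV_cdivide[OF gd])
    then have 1: "of_nat n * deriv l z = deriv g z" using n0 by (simp add: DERIV_imp_deriv)
    have "((\<lambda>z. exp (g z)) has_field_derivative exp (g z) * deriv g z) (at z)"
      by (rule DERIV_chain2[OF DERIV_exp gd])
    then have "(H has_field_derivative exp (g z) * deriv g z) (at z)"
      by (rule has_field_derivative_transform_within_open[OF _ open_ball z]) (simp add: g(2))
    then have "exp (g z) * deriv g z = of_real c * deriv (extremal n \<tau>) (of_real c * z)"
      using Hd z sub DERIV_unique by blast
    then have "H z * deriv g z = of_real c * deriv (extremal n \<tau>) (of_real c * z)" using g(2)[OF z] by simp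
    then show ?thesis unfolding 1 using Hnz[OF z] by (simp add: field_simps)
  qed
  interpret T: transversal_root l r n
  proof
    show "l holomorphic_on ball 0 r" unfolding l_def using g(1) n0 by (intro holomorphic_intros) auto
    fix z assume z: "z \<in> ball 0 r" "Re ((z * exp (l z)) ^ n) = 0"
    define w where "w = of_real c * z"
    have w: "cmod w < 1" using cz[of z] sub z(1) by (auto simp: w_def)
    have "w ^ n * extremal n \<tau> w = of_real (c ^ n) * (z ^ n * H z)" by (simp add: w_def H_def power_mult_distrib)
    moreover have "Re (of_real b * z) = b * Re z" for b z by simp
    ultimately have "Re (w ^ n * extremal n \<tau> w) = 0" using z power by simp
    from extremal_transversal[OF n a \<tau> w this]
    have "Re (of_nat n + z * (of_nat n * deriv l z)) > 0"
      unfolding l_deriv[OF z(1)] by (simp add: w_def H_def mult_ac)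
    also have "of_nat n + z * (of_nat n * deriv l z) = of_real (real n) * (1 + z * deriv l z)"
      by (simp add: algebra_simps)
    finally have "real n * Re (1 + z * deriv l z) > 0" by (simp only: Re_complex_of_real times_complex.simps) simp
    then show "Re (1 + z * deriv l z) > 0" using n by (simp only: zero_less_mult_iff) simp
  qed (use r n in auto)
  define u where "u = (\<lambda>z. Re (T.\<phi> z ^ n))"
  have uH: "u z = Re (z ^ n * H z)" if "z \<in> ball 0 r" for z
    using power[OF that] by (simp add: u_def T.\<phi>_def)
  have curves: "only_nodal_curves_through_0 u (ball 0 r) n" "\<And>k. k < n \<Longrightarrow> nodal_curve u (ball 0 r) (T.L k)"
    unfolding u_def using T.only_nodal_curves_if_lifts[OF T.lift_of_line] by blast+
  have adm: "admissible n r u"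
    unfolding admissible_def
  proof (intro conjI curves(1))
    show "harmonic_on u (ball 0 r)"
      unfolding u_def by (intro harmonic_on_Re holomorphic_on_power T.hol open_ball)
    show "u 0 = 0" using n by (simp add: u_def T.phi0)
    show "\<not> u constant_on ball 0 r"
    proof
      define x where "x = r / 2"
      have x: "of_real x \<in> ball (0::complex) r" "x > 0" "c * x < 1" "(0::complex) \<in> ball 0 r"
        using r \<rho> by (auto simp: x_def c_def)
      assume "u constant_on ball 0 r"
      then have "u (of_real x) = u 0" using x(1,4) unfolding constant_on_def by metis
      then have 0: "u (of_real x) = 0" using \<open>u 0 = 0\<close> by simp
      have "of_real x ^ n * H (of_real x) = of_real (x ^ n / (1 - c * x) ^ (2 * n + 1)) * (of_real (1 + c * x) + \<i> * of_real (\<tau> * (1 - c * x)))"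
        by (simp add: H_def extremal_def)
      then have "u (of_real x) = x ^ n / (1 - c * x) ^ (2 * n + 1) * (1 + c * x)"
        unfolding uH[OF x(1)] by (simp only: Re_complex_of_real times_complex.simps) simp
      moreover have "\<dots> > 0" using x c by (intro mult_pos_pos divide_pos_pos zero_less_power) (auto intro: add_pos_pos)
      ultimately have "u (of_real x) > 0" by (simp only:)
      then show False using 0 by simp
    qed
    show "has_L1_boundary_value u r"
      unfolding has_L1_boundary_value_def
    proof (intro exI conjI ballI)
      have F: "(\<lambda>z. z ^ n * H z) holomorphic_on ball 0 (1 / c)" using H by (intro holomorphic_intros)
      show "L1_circle r (\<lambda>z. Re (z ^ n * H z))" by (rule Poisson_integral_Re(1)[OF F r rc])
      show "u z = Poisson_integral r (\<lambda>z. Re (z ^ n * H z)) z" if "z \<in> ball 0 r" for z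
        using Poisson_integral_Re(2)[OF F r rc that] uH[OF that] by simp
    qed
  qed
  define q where "q = exp (l 0)"
  have z0: "(0::complex) \<in> ball 0 r" using r by simp
  have H0: "H 0 = 1 + \<i> * \<tau>" by (simp add: H_def extremal_def)
  have qn: "q ^ n = 1 + \<i> * \<tau>"
    using n0 g(2)[OF z0] H0 by (simp add: q_def l_def exp_of_nat_mult[symmetric])
  have dphi: "deriv T.\<phi> 0 = q" using T.deriv_phi[OF z0] by (simp add: q_def)
  have "Re ((q * e) ^ n) = 0" using e(2) by (simp add: power_mult_distrib qn)
  then obtain k x where k: "k < n" "q * e = of_real x * nodal_dir n k" using on_nodal_line_exists[OF n] by blast
  have "e \<noteq> 0" using e(1) by auto
  then have x0: "x \<noteq> 0" using k(2) by (auto simp: q_def)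
  obtain J s where s: "T.lift k J s" "s ` J = T.L k" using T.lift_of_line[of k] by (elim exE conjE) (rule that)
  have sJ: "0 \<in> J" "s 0 = 0" using T.lift_at_zero[OF s(1)] s(2) T.zero_in_L by auto
  note reg = T.lift_regular[OF s(1)]
  note rd = regular_analytic_curveD[OF reg(1)]
  have line: "s y \<in> ball 0 r" "T.\<phi> (s y) = of_real y * nodal_dir n k" if "y \<in> J" for y
    using s(1) that unfolding T.lift_def by auto
  have vel: "velocity s 0 * q = nodal_dir n k"
  proof -
    have "s ` J \<subseteq> T.N" using reg(2) T.L_subset_N by blast
    from T.phi_along_curve(1)[OF reg(1) this sJ(1)]
    have 1: "((\<lambda>y. T.\<phi> (s y)) has_vector_derivative velocity s 0 * q) (at 0)" by (simp add: sJ dphi)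
    have "((\<lambda>y. y *\<^sub>R nodal_dir n k) has_vector_derivative 1 *\<^sub>R nodal_dir n k) (at 0)"
      by (intro derivative_eq_intros) auto
    then have "((\<lambda>y. T.\<phi> (s y)) has_vector_derivative 1 *\<^sub>R nodal_dir n k) (at 0)"
      by (rule has_vector_derivative_transform_within_open[OF _ rd(2) sJ(1)]) (simp add: line scaleR_conv_of_real)
    with 1 show ?thesis using vector_derivative_unique_at by fastforce
  qed
  define v where "v = velocity s 0"
  have v: "v = of_real (1 / x) * e"
  proof -
    have "(of_real x * v) * q = e * q" using vel k(2) by (simp add: v_def mult_ac)
    then have "of_real x * v = e" by (simp add: q_def)
    then show ?thesis using x0 by (simp add: field_simps)
  qed
  \<comment> \<open>The lift may run through 0 in the direction - e; this sign drops out of the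
    absolute value of the curvature.\<close>
  define \<sigma> where "\<sigma> = \<bar>x\<bar> / x"
  have \<sigma>: "\<bar>\<sigma>\<bar> = 1" "\<sigma> * \<sigma> = 1" using x0 by (auto simp: \<sigma>_def field_simps)
  have v\<sigma>: "v / of_real (cmod v) = of_real \<sigma> * e"
    using x0 e(1) by (simp add: v \<sigma>_def norm_mult norm_divide field_simps)
  obtain d where d: "d > 0" "ball 0 d \<subseteq> J" using rd(2) sJ(1) openE by blast
  have dJ: "y \<in> J" if "\<bar>y - 0\<bar> < d" for y using d(2) that by (auto simp: dist_real_def)
  have dz: "Re (s y ^ n * H (s y)) = 0" if "\<bar>y - 0\<bar> < d" for y
    using line[OF dJ[OF that]] power[of "s y"] Re_nodal_dir_power[OF n, of y k] by (simp add: T.\<phi>_def)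
  have dH: "deriv H 0 = of_real c * (2 + 2 * of_nat n * (1 + \<i> * \<tau>))"
  proof -
    have "deriv (extremal n \<tau>) 0 = 2 + 2 * of_nat n * (1 + \<i> * \<tau>)"
      using DERIV_imp_deriv[OF extremal_has_derivative[of 0 n \<tau>]] by (simp add: algebra_simps)
    then show ?thesis using DERIV_imp_deriv[OF Hd[of 0]] c by simp
  qed
  have real_scale: "Re (of_real b * z) = b * Re z" "Im (of_real b * z) = b * Im z" for b z by simp_all
  have "curvature s 0 = 2 * Re (deriv H 0 * (v / cmod v) ^ (n + 1)) / (n * Im (H 0 * (v / cmod v) ^ n))"
    unfolding v_def
  proof (rule curvature_nodal(3)[OF rd(4)[OF sJ(1)] sJ(2) rd(5)[OF sJ(1)] Hr r _ d(1) dz n])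
    show "H 0 \<noteq> 0" using Hnz[OF z0] .
  qed
  also have "deriv H 0 * (v / cmod v) ^ (n + 1) = of_real (c * \<sigma> ^ (n + 1)) * ((2 + 2 * of_nat n * (1 + \<i> * \<tau>)) * e ^ (n + 1))"
    unfolding v\<sigma> dH power_mult_distrib of_real_mult of_real_power by (simp only: mult_ac)
  also have "H 0 * (v / cmod v) ^ n = of_real (\<sigma> ^ n) * ((1 + \<i> * \<tau>) * e ^ n)"
    unfolding v\<sigma> H0 power_mult_distrib of_real_power by (simp only: mult_ac)
  also have "Re (of_real (c * \<sigma> ^ (n + 1)) * ((2 + 2 * of_nat n * (1 + \<i> * \<tau>)) * e ^ (n + 1)))
    = c * \<sigma> ^ (n + 1) * Re ((2 + 2 * of_nat n * (1 + \<i> * \<tau>)) * e ^ (n + 1))"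
    by (rule real_scale(1))
  also have "Im (of_real (\<sigma> ^ n) * ((1 + \<i> * \<tau>) * e ^ n)) = \<sigma> ^ n * Im ((1 + \<i> * \<tau>) * e ^ n)"
    by (rule real_scale(2))
  finally have curv: "curvature s 0 = 2 * (c * \<sigma> ^ (n + 1) * Re ((2 + 2 * of_nat n * (1 + \<i> * \<tau>)) * e ^ (n + 1)))
    / (real n * (\<sigma> ^ n * Im ((1 + \<i> * \<tau>) * e ^ n)))" .
  have "\<bar>curvature s 0\<bar> = \<rho> / r * \<bar>2 * Re ((2 + 2 * of_nat n * (1 + \<i> * \<tau>)) * e ^ (n + 1)) / (real n * Im ((1 + \<i> * \<tau>) * e ^ n))\<bar>"
    unfolding curv abs_divide abs_mult power_abs \<sigma>(1) power_one c_def[symmetric] using c(1) by simp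
  moreover have "parametrizes J s (T.L k)" using T.lift_parametrizes[OF s(1)] s(2) by simp
  ultimately show ?thesis using that[of u "T.L k" J s 0] adm curves(2)[OF k(1)] sJ by simp
qed

text \<open>For \<tau> = tan \<beta> the phase condition says that e = cis (pi / 2 + \<beta>) is
  tangent to a nodal curve at 0. Then e^(n+1) is real, and the dilated example has curvature exactly
  \<rho> times the claimed constant, which exceeds any smaller K' once \<rho> is close to 1.\<close>

lemma sharp_if_phase:
  assumes n: "n \<ge> 1" and r: "r > 0" and \<beta>: "0 \<le> \<beta>" "\<beta> < pi / 2"
    and phase: "cos ((real n + 1) * \<beta> + real n * (pi / 2)) = 0"
    and a: "(tan \<beta>)\<^sup>2 = 0 \<or> (n = 2 \<or> n = 4 \<or> n \<ge> 6) \<and> (tan \<beta>)\<^sup>2 \<le> 3 / (real n + 1)\<^sup>2"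
    and bound: "nodal_curvature_bound n r (4 * (real n + 1) / (real n * r) * cos \<beta>)"
  shows "sharp_nodal_curvature_bound n r (4 * (real n + 1) / (real n * r) * cos \<beta>)"
  unfolding sharp_nodal_curvature_bound_def
proof (intro conjI bound allI impI notI)
  define K where "K = 4 * (real n + 1) / (real n * r) * cos \<beta>"
  have cb: "cos \<beta> > 0" using \<beta> by (intro cos_gt_zero_pi) auto
  have K: "K > 0" unfolding K_def using n r cb by (intro mult_pos_pos divide_pos_pos) auto
  fix K' assume K': "K' < K" and b': "nodal_curvature_bound n r K'"
  define \<tau> where "\<tau> = tan \<beta>"
  define e where "e = cis (pi / 2 + \<beta>)"
  \<comment> \<open>Half-way between max 0 (K' / K) and 1, so that K' < \<rho> K even if K' is
    negative.\<close>
  define \<rho> where "\<rho> = (1 + max 0 (K' / K)) / 2"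
  have mx: "max 0 (K' / K) < 1" using K K' by simp
  have \<rho>: "0 < \<rho>" "\<rho> < 1" "max 0 (K' / K) < \<rho>" using mx by (auto simp: \<rho>_def max_def split: if_splits)
  have \<rho>K: "K' < \<rho> * K" using \<rho>(3) K by (simp add: field_simps)
  have h0: "1 + \<i> * \<tau> = of_real (1 / cos \<beta>) * cis \<beta>"
    using cb by (simp add: complex_eq_iff \<tau>_def tan_def)
  define s where "s = sin ((real n + 1) * \<beta> + real n * (pi / 2))"
  have "s\<^sup>2 = 1"
    using sin_cos_squared_add[of "(real n + 1) * \<beta> + real n * (pi / 2)"] unfolding phase s_def by simp
  then have s: "\<bar>s\<bar> = 1" by (auto simp: power2_eq_1_iff)
  have "cis \<beta> * e ^ n = cis ((real n + 1) * \<beta> + real n * (pi / 2))"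
    by (simp add: e_def Complex.DeMoivre cis_mult algebra_simps)
  also have "\<dots> = \<i> * of_real s" using phase by (simp add: complex_eq_iff s_def)
  finally have en: "cis \<beta> * e ^ n = \<i> * of_real s" .
  have he: "(1 + \<i> * \<tau>) * e ^ n = \<i> * of_real (s / cos \<beta>)"
    unfolding h0 mult.assoc en by simp
  have e1: "e ^ (n + 1) = - of_real s"
  proof -
    have "cis \<beta> * e ^ (n + 1) = cis \<beta> * e ^ n * e" by simp
    also have "\<dots> = \<i> * of_real s * e" by (simp only: en)
    also have "\<dots> = cis \<beta> * - of_real s"
      by (simp add: e_def cis_mult[symmetric] complex_eq_iff)
    finally have "cis \<beta> * e ^ (n + 1) = cis \<beta> * - of_real s" .
    then show ?thesis by (simp only: mult_left_cancel[OF cis_neq_zero])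
  qed
  have Ime: "Im e = cos \<beta>" by (simp add: e_def sin_add)
  have num: "Re ((2 + 2 * of_nat n * (1 + \<i> * \<tau>)) * e ^ (n + 1)) = - (2 * real n + 2) * s"
  proof -
    have "(2 + 2 * of_nat n * (1 + \<i> * \<tau>)) * e ^ (n + 1) = 2 * e ^ (n + 1) + 2 * of_nat n * ((1 + \<i> * \<tau>) * e ^ n) * e"
      by (simp add: algebra_simps)
    also have "Re \<dots> = - 2 * s - 2 * real n * (s / cos \<beta>) * Im e" unfolding e1 he by simp
    finally show ?thesis unfolding Ime using cb by (simp add: algebra_simps)
  qed
  obtain u C I \<gamma> t where ex: "admissible n r u" "nodal_curve u (ball 0 r) C" "parametrizes I \<gamma> C" "t \<in> I" "\<gamma> t = 0"
    "\<bar>curvature \<gamma> t\<bar> = \<rho> / r * \<bar>2 * Re ((2 + 2 * of_nat n * (1 + \<i> * \<tau>)) * e ^ (n + 1)) / (real n * Im ((1 + \<i> * \<tau>) * e ^ n))\<bar>"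
  proof (rule extremal_curvature[OF n _ _ r \<rho>(1,2), of \<tau> e])
    have "0 \<le> sin \<beta>" using \<beta> by (intro sin_ge_zero) auto
    then show "0 \<le> \<tau>" using cb by (simp add: \<tau>_def tan_def)
    show "cmod e = 1" by (simp add: e_def)
    show "Re ((1 + \<i> * \<tau>) * e ^ n) = 0" unfolding he by simp
  qed (use a in \<open>simp add: \<tau>_def\<close>)
  have "\<bar>curvature \<gamma> t\<bar> = \<rho> / r * \<bar>2 * (- (2 * real n + 2) * s) / (real n * (s / cos \<beta>))\<bar>"
    unfolding ex(6) num he by simp
  also have "\<dots> = \<rho> / r * (2 * (2 * real n + 2) * \<bar>s\<bar> / (real n * (\<bar>s\<bar> / cos \<beta>)))"
    using cb by (simp add: abs_mult)
  also have "\<dots> = \<rho> * K" unfolding s K_def using cb r n by (simp add: field_simps)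
  finally have "\<bar>curvature \<gamma> t\<bar> > K'" using \<rho>K by simp
  moreover have "\<bar>curvature \<gamma> t\<bar> \<le> K'" using b' ex(1-5) unfolding nodal_curvature_bound_def by blast
  ultimately show False by simp
qed

theorem theorem2:
  fixes n :: nat and r0 :: real
  assumes "n \<ge> 1" and "r0 > 0"
  shows "nodal_curvature_bound n r0 (4 * (real n + 1) / (real n * r0)) \<and>
    (odd n \<longrightarrow> sharp_nodal_curvature_bound n r0 (4 * (real n + 1) / (real n * r0))) \<and>
    (even n \<longrightarrow> sharp_nodal_curvature_bound n r0
       (4 * (real n + 1) / (real n * r0) * cos (pi / (2 * (real n + 1)))))"
proof (intro conjI impI)
  show bound: "nodal_curvature_bound n r0 (4 * (real n + 1) / (real n * r0))"
    by (rule nodal_curvature_bound_general[OF assms])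
  have cos0: "cos (real k * (pi / 2)) = 0" if "odd k" for k :: nat
    by (rule cos_zero_iff[THEN iffD2]) (rule disjI1, rule exI[of _ k], use that in simp)
  \<comment> \<open>For odd n the angle \<beta> = 0 satisfies the phase condition, and its cosine is
    1.\<close>
  show "sharp_nodal_curvature_bound n r0 (4 * (real n + 1) / (real n * r0))" if "odd n"
    using sharp_if_phase[OF assms, of 0] bound cos0[OF that] by simp
  assume ev: "even n"
  \<comment> \<open>The choice (n + 1) \<beta> = pi / 2 makes the phase (n + 1) pi / 2, an odd
    multiple of pi / 2 for even n.\<close>
  define \<beta> where "\<beta> = pi / (2 * (real n + 1))"
  have n2: "n \<ge> 2" using ev assms(1) by (cases "n = 1") auto
  have n\<beta>: "(real n + 1) * \<beta> = pi / 2" by (simp add: \<beta>_def field_simps)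
  have \<beta>: "0 < \<beta>" "\<beta> < pi / 2"
    using assms(1) by (auto simp: \<beta>_def field_simps)
  have "(real n + 1) * \<beta> + real n * (pi / 2) = real (n + 1) * (pi / 2)"
    unfolding n\<beta> by (simp add: field_simps)
  then have phase: "cos ((real n + 1) * \<beta> + real n * (pi / 2)) = 0" using cos0[of "n + 1"] ev by (simp only:) simp
  have "(n = 2 \<or> n = 4 \<or> n \<ge> 6) \<and> (tan \<beta>)\<^sup>2 \<le> 3 / (real n + 1)\<^sup>2"
  proof
    show "n = 2 \<or> n = 4 \<or> n \<ge> 6" using n2 ev by presburger
    \<comment> \<open>For n = 2 this is the equality tan (pi / 6)^2 = 1 / 3. For n \<ge> 4 it
      suffices that sin \<beta> \<le> \<beta> and cos^2 \<beta> \<ge> 9 / 10, because pi^2 / 4 <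
      2.47 < 3 * 9 / 10.\<close>
    show "(tan \<beta>)\<^sup>2 \<le> 3 / (real n + 1)\<^sup>2"
    proof (cases "n = 2")
      case True
      then have b: "\<beta> = pi / 6" by (simp add: \<beta>_def)
      show ?thesis unfolding b using True by (simp add: tan_30 power_divide)
    next
      case False
      then have n4: "n \<ge> 4" using n2 ev by presburger
      define N where "N = real n + 1"
      have N: "N \<ge> 5" "N * \<beta> = pi / 2" using n4 n\<beta> by (auto simp: N_def)
      have "pi \<le> 3.142" using pi_approx(2) by simp
      then have "(N * \<beta>)\<^sup>2 \<le> 1.571\<^sup>2" unfolding N(2) by (intro power_mono) auto
      then have "N\<^sup>2 * \<beta>\<^sup>2 \<le> 1.571\<^sup>2" by (simp only: power_mult_distrib)
      also have "(1.571::real)\<^sup>2 \<le> 247 / 100" by (simp add: power2_eq_square)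
      finally have b1: "N\<^sup>2 * \<beta>\<^sup>2 \<le> 247 / 100" .
      have "5\<^sup>2 * \<beta>\<^sup>2 \<le> N\<^sup>2 * \<beta>\<^sup>2" using N(1) by (intro mult_right_mono power_mono) auto
      then have b2: "\<beta>\<^sup>2 \<le> 1 / 10" using b1 by simp
      have s: "(sin \<beta>)\<^sup>2 \<le> \<beta>\<^sup>2"
        using \<beta> sin_x_le_x[of \<beta>] sin_ge_zero[of \<beta>] by (intro power_mono) auto
      have c: "(cos \<beta>)\<^sup>2 \<ge> 9 / 10" using s b2 sin_cos_squared_add[of \<beta>] by linarith
      have "N\<^sup>2 * (sin \<beta>)\<^sup>2 \<le> N\<^sup>2 * \<beta>\<^sup>2" using s by (intro mult_left_mono) auto
      also have "\<dots> \<le> 3 * (cos \<beta>)\<^sup>2" using b1 c by linarith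
      finally have "N\<^sup>2 * (sin \<beta>)\<^sup>2 \<le> 3 * (cos \<beta>)\<^sup>2" .
      moreover have "(cos \<beta>)\<^sup>2 > 0" using c by linarith
      ultimately have "(sin \<beta>)\<^sup>2 / (cos \<beta>)\<^sup>2 \<le> 3 / N\<^sup>2" using N(1) by (simp add: field_simps)
      then show ?thesis by (simp add: tan_def power_divide N_def)
    qed
  qed
  then show "sharp_nodal_curvature_bound n r0 (4 * (real n + 1) / (real n * r0) * cos (pi / (2 * (real n + 1))))"
    using sharp_if_phase[OF assms less_imp_le[OF \<beta>(1)] \<beta>(2) phase] nodal_curvature_bound_even[OF assms(1) ev assms(2)]
    by (simp add: \<beta>_def)
qed

end
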